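(* Let $(\Delta,\mathbf x;\boldsymbol\sigma)$ be a graded seed with $B(\Delta)$ of full rank and let $\mathcal A:=\overline{\mathcal C}(\Delta,\mathbf x;\boldsymbol\sigma)$. Suppose that $\theta\in\mathbb L$ is a weight such that $\langle\theta,\boldsymbol\sigma(v)\rangle=0$ for all $v\in\Delta_0$ except for a set $\mathbf v$ of frozen vertices, where either all $\langle\theta,\boldsymbol\sigma(v)\rangle<0$ or all $\langle\theta,\boldsymbol\sigma(v)\rangle>0$ ($v\in\mathbf v$). Then the graded subalgebra $\mathcal A_{\theta^\perp}$ is equal to $\mathcal S:=\overline{\mathcal C}(\Delta_{\mathbf v}^{\mathbf u},\mathbf x(\hat{\mathbf v});\boldsymbol\sigma(\hat{\mathbf v}))$, where $\mathbf u$ is attached to $\mathbf v$.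
   Context: $k$ is the base field. An ice quiver $\Delta$ is a finite quiver without loops or oriented 2-cycles whose vertices $1,\dots,q$ are divided into mutable ones ($1,\dots,p$) and frozen ones ($p+1,\dots,q$). Its $B$-matrix is the $p\times q$ matrix $b_{u,v}=\#\{u\to v\}-\#\{v\to u\}$; full rank means rank $p$. A seed $(\Delta,\mathbf x)$ consists of an ice quiver and a family $\mathbf x=(x_v)_{v\in\Delta_0}$ (also written $\mathbf x(v)$) of elements of a field extension of $k$, algebraically independent over $k$. Mutation at a mutable $u$ is Fomin-Zelevinsky mutation (no arrows created between frozen vertices), with $x_ux_u'=\prod_{v\to u}x_v+\prod_{u\to w}x_w$. Put $\mathcal L_{\mathbf x}=k[x_1^{\pm1},\dots,x_p^{\pm1},x_{p+1},\dots,x_q]$ (frozen variables not inverted). The upper cluster algebra is $\overline{\mathcal C}(\Delta,\mathbf x)=\bigcap\mathcal L_{\mathbf x^\dagger}$ over all seeds $(\Delta^\dagger,\mathbf x^\dagger)$ mutation-equivalent to $(\Delta,\mathbf x)$. $\mathbb L\cong\mathbb Z^n$ carries a unimodular (not necessarily symmetric) bilinear form $\langle-,-\rangle$. A weight configuration $\boldsymbol\sigma$ assigns $\boldsymbol\sigma(v)\in\mathbb L$ to each vertex with $\sum_{v\to u}\boldsymbol\sigma(v)=\sum_{u\to w}\boldsymbol\sigma(w)$ for each mutable $u$; setting $\deg x_v=\boldsymbol\sigma(v)$ grades the upper cluster algebra, written $\overline{\mathcal C}(\Delta,\mathbf x;\boldsymbol\sigma)$, and $(\Delta,\mathbf x;\boldsymbol\sigma)$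 is a graded seed. $\mathcal A_{\theta^\perp}=\bigoplus_{\alpha:\langle\theta,\alpha\rangle=0}\mathcal A_\alpha$. The set $\mathbf u$ attached to $\mathbf v$ is the set of all mutable vertices of $\Delta$ joined by an arrow (in either direction) to some vertex of $\mathbf v$. $\Delta_{\mathbf v}^{\mathbf u}$ is obtained from $\Delta$ by deleting the vertices in $\mathbf v$ and making those in $\mathbf u$ frozen. $\mathbf x(\hat{\mathbf v})$ and $\boldsymbol\sigma(\hat{\mathbf v})$ are the restrictions of $\mathbf x$ and $\boldsymbol\sigma$ to $\Delta_0\setminus\mathbf v$. Both $\mathcal A_{\theta^\perp}$ and $\mathcal S$ are regarded as subalgebras of $k(\mathbf x)$. *)

theory Defs
  imports Complex_Main "HOL-Library.Function_Algebras" "HOL-Library.FuncSet" "HOL-Library.Poly_Mapping"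
begin

section \<open>Ice quivers and their mutations\<close>

text \<open>A quiver is recorded by its arrow multiplicities: \<open>arr \<Delta> u v\<close> is the number of
  arrows from \<open>u\<close> to \<open>v\<close>. The vertices of \<open>verts \<Delta>\<close> outside \<open>mutables \<Delta>\<close> are frozen.\<close>

record 'v ice_quiver =
  verts :: "'v set"
  mutables :: "'v set"
  arr :: "'v \<Rightarrow> 'v \<Rightarrow> nat"

definition is_ice_quiver :: "'v ice_quiver \<Rightarrow> bool" where
  "is_ice_quiver \<Delta> \<longleftrightarrow>
     finite (verts \<Delta>) \<and> mutables \<Delta> \<subseteq> verts \<Delta> \<and>
     (\<forall>u v. arr \<Delta> u v > 0 \<longrightarrow> u \<in> verts \<Delta> \<and> v \<in> verts \<Delta>) \<and>
     (\<forall>u. arr \<Delta> u u = 0) \<and>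
     (\<forall>u v. arr \<Delta> u v = 0 \<or> arr \<Delta> v u = 0)"

definition frozens :: "'v ice_quiver \<Rightarrow> 'v set" where
  "frozens \<Delta> = verts \<Delta> - mutables \<Delta>"

definition b_entry :: "'v ice_quiver \<Rightarrow> 'v \<Rightarrow> 'v \<Rightarrow> int" where
  "b_entry \<Delta> u v = int (arr \<Delta> u v) - int (arr \<Delta> v u)"

text \<open>Rows of the \<open>B\<close>-matrix are vectors of \<open>'v \<Rightarrow> rat\<close> indexed by the mutable vertices; their
  entries vanish outside \<open>verts \<Delta>\<close>. The rank is the dimension of the row space over the
  rationals.\<close>

lemma vector_space_rat_fun: "vector_space (\<lambda>(c::rat) (f::'v \<Rightarrow> rat) v. c * f v)"
  by unfold_locales (auto simp: fun_eq_iff algebra_simps)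

definition b_rank :: "'v ice_quiver \<Rightarrow> nat" where
  "b_rank \<Delta> = vector_space.dim (\<lambda>(c::rat) (f::'v \<Rightarrow> rat) v. c * f v)
     ((\<lambda>u v. rat_of_int (b_entry \<Delta> u v)) ` mutables \<Delta>)"

definition full_rank :: "'v ice_quiver \<Rightarrow> bool" where
  "full_rank \<Delta> \<longleftrightarrow> b_rank \<Delta> = card (mutables \<Delta>)"

text \<open>Mutation at \<open>u\<close>: arrows at \<open>u\<close> are reversed; every path \<open>i \<rightarrow> u \<rightarrow> j\<close> creates an arrow
  \<open>i \<rightarrow> j\<close> unless both \<open>i\<close> and \<open>j\<close> are frozen; then 2-cycles are cancelled, which is the
  truncated subtraction on \<open>nat\<close>.\<close>

definition mutate_quiver :: "'v \<Rightarrow> 'v ice_quiver \<Rightarrow> 'v ice_quiver" where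
  "mutate_quiver u \<Delta> = \<Delta>\<lparr> arr := (\<lambda>i j.
     if i = u \<or> j = u then arr \<Delta> j i
     else if i \<notin> mutables \<Delta> \<and> j \<notin> mutables \<Delta> then arr \<Delta> i j
     else (arr \<Delta> i j + arr \<Delta> i u * arr \<Delta> u j) - (arr \<Delta> j i + arr \<Delta> j u * arr \<Delta> u i)) \<rparr>"

lemma is_ice_quiver_mutate_quiver:
  assumes "is_ice_quiver \<Delta>" "u \<in> mutables \<Delta>"
  shows "is_ice_quiver (mutate_quiver u \<Delta>)"
proof -
  have "i \<in> verts \<Delta> \<and> j \<in> verts \<Delta>" if "0 < arr (mutate_quiver u \<Delta>) i j" for i j
  proof -
    have "arr \<Delta> j i > 0 \<or> arr \<Delta> i j > 0 \<or> (arr \<Delta> i u > 0 \<and> arr \<Delta> u j > 0)"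
      by (rule ccontr) (use that in \<open>auto simp: mutate_quiver_def split: if_splits\<close>)
    then show ?thesis
      using assms(1) unfolding is_ice_quiver_def by blast
  qed
  then show ?thesis
    using assms unfolding is_ice_quiver_def by (auto simp: mutate_quiver_def)
qed

definition attached :: "'v ice_quiver \<Rightarrow> 'v set \<Rightarrow> 'v set" where
  "attached \<Delta> vs = {u \<in> mutables \<Delta>. \<exists>v\<in>vs. arr \<Delta> u v > 0 \<or> arr \<Delta> v u > 0}"

definition delete_freeze :: "'v ice_quiver \<Rightarrow> 'v set \<Rightarrow> 'v set \<Rightarrow> 'v ice_quiver" where
  "delete_freeze \<Delta> vs us =
     \<lparr> verts = verts \<Delta> - vs,
       mutables = mutables \<Delta> - vs - us,
       arr = (\<lambda>i j. if i \<in> vs \<or> j \<in> vs then 0 else arr \<Delta> i j) \<rparr>"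


section \<open>Seeds\<close>

text \<open>The base field is a subfield \<open>K\<close> of the ambient field \<open>'f\<close>.\<close>

definition is_subfield :: "'f::field set \<Rightarrow> bool" where
  "is_subfield K \<longleftrightarrow> 0 \<in> K \<and> 1 \<in> K \<and>
     (\<forall>a\<in>K. \<forall>b\<in>K. a + b \<in> K \<and> a * b \<in> K) \<and> (\<forall>a\<in>K. - a \<in> K \<and> inverse a \<in> K)"

definition poly_eval :: "('v \<Rightarrow> 'f::field) \<Rightarrow> (('v \<Rightarrow>\<^sub>0 nat) \<Rightarrow>\<^sub>0 'f) \<Rightarrow> 'f" where
  "poly_eval x P = (\<Sum>m\<in>Poly_Mapping.keys P. Poly_Mapping.lookup P m * (\<Prod>v\<in>Poly_Mapping.keys m. x v ^ Poly_Mapping.lookup m v))"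

definition alg_independent :: "'f::field set \<Rightarrow> 'v set \<Rightarrow> ('v \<Rightarrow> 'f) \<Rightarrow> bool" where
  "alg_independent K V x \<longleftrightarrow>
     (\<forall>P. (\<forall>m. Poly_Mapping.lookup P m \<in> K) \<and> (\<forall>m\<in>Poly_Mapping.keys P. Poly_Mapping.keys m \<subseteq> V) \<and> poly_eval x P = 0 \<longrightarrow> P = 0)"

text \<open>A cluster is a function on all of \<open>'v\<close> of which only the values on \<open>verts \<Delta>\<close> matter.\<close>

definition is_seed :: "'f::field set \<Rightarrow> 'v ice_quiver \<Rightarrow> ('v \<Rightarrow> 'f) \<Rightarrow> bool" where
  "is_seed K \<Delta> x \<longleftrightarrow> is_ice_quiver \<Delta> \<and> alg_independent K (verts \<Delta>) x"

definition mutate_cluster :: "'v \<Rightarrow> 'v ice_quiver \<Rightarrow> ('v \<Rightarrow> 'f::field) \<Rightarrow> 'v \<Rightarrow> 'f" where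
  "mutate_cluster u \<Delta> x = x(u :=
     ((\<Prod>v\<in>verts \<Delta>. x v ^ arr \<Delta> v u) + (\<Prod>w\<in>verts \<Delta>. x w ^ arr \<Delta> u w)) / x u)"

inductive mutation_equivalent ::
    "'v ice_quiver \<Rightarrow> ('v \<Rightarrow> 'f::field) \<Rightarrow> 'v ice_quiver \<Rightarrow> ('v \<Rightarrow> 'f) \<Rightarrow> bool"
  for \<Delta> x where
  refl: "mutation_equivalent \<Delta> x \<Delta> x"
| step: "mutation_equivalent \<Delta> x \<Delta>' x' \<Longrightarrow> u \<in> mutables \<Delta>' \<Longrightarrow>
     mutation_equivalent \<Delta> x (mutate_quiver u \<Delta>') (mutate_cluster u \<Delta>' x')"


section \<open>Upper cluster algebras\<close>

inductive_set adjoin :: "'f::field set \<Rightarrow> 'f set \<Rightarrow> 'f set" for K S where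
  base: "c \<in> K \<Longrightarrow> c \<in> adjoin K S"
| gen: "s \<in> S \<Longrightarrow> s \<in> adjoin K S"
| add: "a \<in> adjoin K S \<Longrightarrow> b \<in> adjoin K S \<Longrightarrow> a + b \<in> adjoin K S"
| mult: "a \<in> adjoin K S \<Longrightarrow> b \<in> adjoin K S \<Longrightarrow> a * b \<in> adjoin K S"

definition laurent_ring :: "'f::field set \<Rightarrow> 'v ice_quiver \<Rightarrow> ('v \<Rightarrow> 'f) \<Rightarrow> 'f set" where
  "laurent_ring K \<Delta> x = adjoin K (x ` verts \<Delta> \<union> (\<lambda>u. inverse (x u)) ` mutables \<Delta>)"

definition upper_cluster_algebra ::
    "'f::field set \<Rightarrow> 'v ice_quiver \<Rightarrow> ('v \<Rightarrow> 'f) \<Rightarrow> 'f set" where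
  "upper_cluster_algebra K \<Delta> x =
     \<Inter> {laurent_ring K \<Delta>' x' | \<Delta>' x'. mutation_equivalent \<Delta> x \<Delta>' x'}"


section \<open>The weight lattice and gradings\<close>

definition is_lattice :: "'l::ab_group_add itself \<Rightarrow> bool" where
  "is_lattice _ \<longleftrightarrow> (\<exists>n (\<phi> :: 'l \<Rightarrow> nat \<Rightarrow> int).
     Modules.additive \<phi> \<and> bij_betw \<phi> UNIV {c. \<forall>i\<ge>n. c i = 0})"

text \<open>Unimodularity: \<open>\<alpha> \<mapsto> \<langle>\<alpha>,-\<rangle>\<close> is an isomorphism from the lattice onto its dual.\<close>

definition is_unimodular_form :: "('l::ab_group_add \<Rightarrow> 'l \<Rightarrow> int) \<Rightarrow> bool" where
  "is_unimodular_form form \<longleftrightarrow>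
     (\<forall>\<alpha>. Modules.additive (form \<alpha>)) \<and> (\<forall>\<beta>. Modules.additive (\<lambda>\<alpha>. form \<alpha> \<beta>)) \<and>
     bij_betw form UNIV {f. Modules.additive f}"

definition int_mult :: "int \<Rightarrow> 'l::ab_group_add \<Rightarrow> 'l" where
  "int_mult m \<alpha> = (if m \<ge> 0 then (\<Sum>i<nat m. \<alpha>) else - (\<Sum>i<nat (- m). \<alpha>))"

definition weight_configuration :: "'v ice_quiver \<Rightarrow> ('v \<Rightarrow> 'l::ab_group_add) \<Rightarrow> bool" where
  "weight_configuration \<Delta> \<sigma> \<longleftrightarrow> (\<forall>u\<in>mutables \<Delta>.
     (\<Sum>v\<in>verts \<Delta>. int_mult (int (arr \<Delta> v u)) (\<sigma> v)) =
     (\<Sum>w\<in>verts \<Delta>. int_mult (int (arr \<Delta> u w)) (\<sigma> w)))"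

definition graded_seed ::
    "'f::field set \<Rightarrow> 'v ice_quiver \<Rightarrow> ('v \<Rightarrow> 'f) \<Rightarrow> ('v \<Rightarrow> 'l::ab_group_add) \<Rightarrow> bool" where
  "graded_seed K \<Delta> x \<sigma> \<longleftrightarrow> is_seed K \<Delta> x \<and> weight_configuration \<Delta> \<sigma>"

text \<open>The component of degree \<open>\<alpha>\<close> of the Laurent ring of the seed: the \<open>K\<close>-span of the Laurent
  monomials of weight \<open>\<alpha>\<close> whose exponents at frozen vertices are nonnegative.\<close>

definition laurent_component ::
    "'f::field set \<Rightarrow> 'v ice_quiver \<Rightarrow> ('v \<Rightarrow> 'f) \<Rightarrow> ('v \<Rightarrow> 'l::ab_group_add) \<Rightarrow> 'l \<Rightarrow> 'f set" where
  "laurent_component K \<Delta> x \<sigma> \<alpha> =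
     {(\<Sum>m\<in>T. c m * (\<Prod>v\<in>verts \<Delta>. x v powi m v)) | (T :: ('v \<Rightarrow> int) set) c.
        finite T \<and> (\<forall>m\<in>T. c m \<in> K \<and> (\<forall>v\<in>frozens \<Delta>. m v \<ge> 0) \<and>
          (\<Sum>v\<in>verts \<Delta>. int_mult (m v) (\<sigma> v)) = \<alpha>)}"

text \<open>The upper cluster algebra lies in the Laurent ring of the initial seed, from which it
  inherits the grading with \<open>deg x\<^sub>v = \<sigma> v\<close>.\<close>

definition upper_cluster_component ::
    "'f::field set \<Rightarrow> 'v ice_quiver \<Rightarrow> ('v \<Rightarrow> 'f) \<Rightarrow> ('v \<Rightarrow> 'l::ab_group_add) \<Rightarrow> 'l \<Rightarrow> 'f set" where
  "upper_cluster_component K \<Delta> x \<sigma> \<alpha> =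
     upper_cluster_algebra K \<Delta> x \<inter> laurent_component K \<Delta> x \<sigma> \<alpha>"

text \<open>The sum, inside the ambient field, of the components of degrees \<open>\<alpha>\<close> with
  \<open>\<langle>\<theta>,\<alpha>\<rangle> = 0\<close>; it is direct because the cluster is algebraically independent.\<close>

definition perp_subalgebra ::
    "'f::field set \<Rightarrow> 'v ice_quiver \<Rightarrow> ('v \<Rightarrow> 'f) \<Rightarrow> ('v \<Rightarrow> 'l::ab_group_add) \<Rightarrow>
     ('l \<Rightarrow> 'l \<Rightarrow> int) \<Rightarrow> 'l \<Rightarrow> 'f set" where
  "perp_subalgebra K \<Delta> x \<sigma> form \<theta> =
     {(\<Sum>\<alpha>\<in>D. a \<alpha>) | (D :: 'l set) a.
        finite D \<and> (\<forall>\<alpha>\<in>D. form \<theta> \<alpha> = 0 \<and> a \<alpha> \<in> upper_cluster_component K \<Delta> x \<sigma> \<alpha>)}"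

text \<open>The restricted data form a graded seed again.\<close>

lemma graded_seed_delete_freeze:
  fixes K :: "'f::field set" and \<Delta> :: "'v ice_quiver"
  assumes gs: "graded_seed K \<Delta> x \<sigma>" and vs: "vs \<subseteq> frozens \<Delta>"
  shows "graded_seed K (delete_freeze \<Delta> vs (attached \<Delta> vs))
           (restrict x (verts \<Delta> - vs)) (restrict \<sigma> (verts \<Delta> - vs))"
proof -
  let ?D = "delete_freeze \<Delta> vs (attached \<Delta> vs)" and ?V = "verts \<Delta> - vs"
  have iq: "is_ice_quiver \<Delta>" and ai: "alg_independent K (verts \<Delta>) x"
    and wc: "weight_configuration \<Delta> \<sigma>"
    using gs by (auto simp: graded_seed_def is_seed_def)
  have iq': "is_ice_quiver ?D"
    using iq vs by (auto simp: is_ice_quiver_def delete_freeze_def frozens_def)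
  have ev: "poly_eval (restrict x ?V) P = poly_eval x P" if "\<forall>m\<in>Poly_Mapping.keys P. Poly_Mapping.keys m \<subseteq> ?V"
    for P :: "('v \<Rightarrow>\<^sub>0 nat) \<Rightarrow>\<^sub>0 'f"
    unfolding poly_eval_def using that
    by (intro sum.cong refl arg_cong2[where f="(*)"] prod.cong) auto
  have ai': "alg_independent K ?V (restrict x ?V)"
    unfolding alg_independent_def
  proof (intro allI impI, elim conjE)
    fix P :: "('v \<Rightarrow>\<^sub>0 nat) \<Rightarrow>\<^sub>0 'f"
    assume *: "\<forall>m. Poly_Mapping.lookup P m \<in> K" "\<forall>m\<in>Poly_Mapping.keys P. Poly_Mapping.keys m \<subseteq> ?V" "poly_eval (restrict x ?V) P = 0"
    then have "\<forall>m\<in>Poly_Mapping.keys P. Poly_Mapping.keys m \<subseteq> verts \<Delta>" by blast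
    then show "P = 0"
      using ai * ev[OF *(2)] unfolding alg_independent_def by auto
  qed
  have eq: "(\<Sum>v\<in>verts ?D. int_mult (int (f v)) (restrict \<sigma> ?V v)) =
      (\<Sum>v\<in>verts \<Delta>. int_mult (int (g v)) (\<sigma> v))"
    if "\<And>v. v \<in> vs \<Longrightarrow> g v = 0" "\<And>v. v \<in> ?V \<Longrightarrow> f v = g v" for f g :: "'v \<Rightarrow> nat"
    using iq that
    by (intro sum.mono_neutral_cong_left) (auto simp: is_ice_quiver_def delete_freeze_def int_mult_def)
  have wc': "weight_configuration ?D (restrict \<sigma> ?V)"
    unfolding weight_configuration_def
  proof
    fix u assume "u \<in> mutables ?D"
    then have u: "u \<in> mutables \<Delta>" "u \<notin> vs" "u \<notin> attached \<Delta> vs"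
      by (auto simp: delete_freeze_def)
    then have z: "arr \<Delta> u v = 0 \<and> arr \<Delta> v u = 0" if "v \<in> vs" for v
      using that by (auto simp: attached_def)
    have a: "(\<Sum>v\<in>verts ?D. int_mult (int (arr ?D v u)) (restrict \<sigma> ?V v)) =
      (\<Sum>v\<in>verts \<Delta>. int_mult (int (arr \<Delta> v u)) (\<sigma> v))"
      by (rule eq) (use u z in \<open>auto simp: delete_freeze_def\<close>)
    have b: "(\<Sum>v\<in>verts ?D. int_mult (int (arr ?D u v)) (restrict \<sigma> ?V v)) =
      (\<Sum>v\<in>verts \<Delta>. int_mult (int (arr \<Delta> u v)) (\<sigma> v))"
      by (rule eq) (use u z in \<open>auto simp: delete_freeze_def\<close>)
    show "(\<Sum>v\<in>verts ?D. int_mult (int (arr ?D v u)) (restrict \<sigma> ?V v)) =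
       (\<Sum>w\<in>verts ?D. int_mult (int (arr ?D u w)) (restrict \<sigma> ?V w))"
      using a b wc u(1) by (simp add: weight_configuration_def)
  qed
  show ?thesis
    using iq' ai' wc' by (simp add: graded_seed_def is_seed_def delete_freeze_def)
qed

end

(*
A Laurent expansion of an element of the upper cluster algebra involves no negative powers of the
deleted frozen variables, so an element of theta-degree 0 does not involve them at all, in any
seed reached by mutation away from the attached vertices. If w is attached to vs, homogeneity of the
exchange relation forces variables of vs into both of its terms; hence x_w' has nonzero theta-degree
of the sign of vs and x_w cannot occur in a denominator of an element of degree 0. This gives one
inclusion. Conversely, an element of the smaller algebra lies in the Laurent rings of the initial
seed of Delta and of all its neighbours, so it suffices that for full rank this upper bound is
already the whole algebra, as in Berenstein-Fomin-Zelevinsky. The upper bound is invariant under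
mutation: clearing denominators by two suitable elements of the target Laurent ring, it is enough
that they form a regular sequence there. Those elements are the two exchange binomials when the
vertices are not joined (regular because the rows of B are not proportional), and one exchange
binomial and one cluster variable otherwise.
*)

theory Submission
  imports Defs
begin

section \<open>Spans of Laurent monomials\<close>

text \<open>There are no formal Laurent polynomials: an element of the ambient field is described by
  sets \<open>S\<close> of exponents over which it expands, so that gradings, positivity at frozen
  vertices and absence of variables are all choices of \<open>S\<close>. Since monomials are
  independent, such conditions can be intersected, and incompatible ones force zero. They pass
  between adjacent clusters after multiplication by a power of the exchange binomial. Full rank
  enters in two ways. The rows are nonzero, so the two terms of an exchange relation differ and
  their sum is nonzero even in characteristic 2; and no two rows are proportional. When clusters two
  exchanges apart are compared, frozen variables are inverted as well, and nonnegativity at frozen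
  vertices is recovered separately. Finally, the perpendicular subalgebra is a sum of homogeneous
  components, so the second inclusion also requires each component of an element of the upper
  cluster algebra to lie in it; for this the weight is carried through all mutations.\<close>

definition lattice_on :: "'v set \<Rightarrow> ('v \<Rightarrow> int) set" where
  "lattice_on V = {m. \<forall>v. v \<notin> V \<longrightarrow> m v = 0}"

definition lmon :: "'v set \<Rightarrow> ('v \<Rightarrow> 'f::field) \<Rightarrow> ('v \<Rightarrow> int) \<Rightarrow> 'f" where
  "lmon V x m = (\<Prod>v\<in>V. x v powi m v)"

text \<open>Built one term at a time, with repeated exponents allowed, so that membership is proved
  monomial by monomial; \<open>lspan_repr\<close> recovers a normal form.\<close>

inductive_set lspan ::
    "'f::field set \<Rightarrow> 'v set \<Rightarrow> ('v \<Rightarrow> 'f) \<Rightarrow> ('v \<Rightarrow> int) set \<Rightarrow> 'f set" for K V x S where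
  zero: "0 \<in> lspan K V x S"
| step: "c \<in> K \<Longrightarrow> m \<in> S \<Longrightarrow> m \<in> lattice_on V \<Longrightarrow> f \<in> lspan K V x S \<Longrightarrow>
    c * lmon V x m + f \<in> lspan K V x S"

text \<open>Linear independence of Laurent monomials, despite the name. It stands in for algebraic
  independence because an exchange passes it on directly. Exponents are taken in
  \<open>lattice_on V\<close> since \<open>lmon\<close> does not see values outside
  \<open>V\<close>: otherwise different exponents would give the same monomial.\<close>

definition lindep :: "'f::field set \<Rightarrow> 'v set \<Rightarrow> ('v \<Rightarrow> 'f) \<Rightarrow> bool" where
  "lindep K V x \<longleftrightarrow> (\<forall>A c. finite A \<longrightarrow> A \<subseteq> lattice_on V \<longrightarrow> (\<forall>m\<in>A. c m \<in> K) \<longrightarrow>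
     (\<Sum>m\<in>A. c m * lmon V x m) = 0 \<longrightarrow> (\<forall>m\<in>A. c m = 0))"

lemma lattice_on_add: "m \<in> lattice_on V \<Longrightarrow> n \<in> lattice_on V \<Longrightarrow> m + n \<in> lattice_on V"
  by (auto simp: lattice_on_def)

lemma lmon_cong: "(\<And>v. v \<in> V \<Longrightarrow> x v = y v) \<Longrightarrow> (\<And>v. v \<in> V \<Longrightarrow> m v = n v) \<Longrightarrow> lmon V x m = lmon V y n"
  unfolding lmon_def by (intro prod.cong) auto

lemma lmon_zero: "lmon V x 0 = 1"
  by (simp add: lmon_def)

lemma lspan_mono: "f \<in> lspan K V x S \<Longrightarrow> S \<inter> lattice_on V \<subseteq> S' \<Longrightarrow> f \<in> lspan K V x S'"
  by (induction rule: lspan.induct) (auto intro: lspan.intros)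

lemma lspan_cong: "f \<in> lspan K V x S \<Longrightarrow> (\<And>v. v \<in> V \<Longrightarrow> x v = y v) \<Longrightarrow> f \<in> lspan K V y S"
proof (induction rule: lspan.induct)
  case (step c m f)
  then have "lmon V x m = lmon V y m" by (intro lmon_cong) auto
  with step show ?case by (auto intro: lspan.intros)
qed (rule lspan.zero)

lemma lspan_add: "f \<in> lspan K V x S \<Longrightarrow> g \<in> lspan K V x S \<Longrightarrow> f + g \<in> lspan K V x S"
  by (induction rule: lspan.induct) (auto intro: lspan.intros simp: add.assoc)

lemma lspan_sum: "(\<And>i. i \<in> I \<Longrightarrow> f i \<in> lspan K V x S) \<Longrightarrow> sum f I \<in> lspan K V x S"
  by (induction I rule: infinite_finite_induct) (auto intro: lspan_add lspan.zero)

lemma is_subfieldD: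
  assumes "is_subfield K"
  shows "0 \<in> K" "1 \<in> K" "a \<in> K \<Longrightarrow> b \<in> K \<Longrightarrow> a + b \<in> K" "a \<in> K \<Longrightarrow> b \<in> K \<Longrightarrow> a * b \<in> K"
    "a \<in> K \<Longrightarrow> - a \<in> K" "a \<in> K \<Longrightarrow> b \<in> K \<Longrightarrow> a - b \<in> K"
  using assms unfolding is_subfield_def by (auto, metis add.commute uminus_add_conv_diff)

lemma sum_in_subfield: "is_subfield K \<Longrightarrow> (\<And>i. i \<in> I \<Longrightarrow> f i \<in> K) \<Longrightarrow> sum f I \<in> K"
  by (induction I rule: infinite_finite_induct) (auto intro: is_subfieldD)

section \<open>Supports, decompositions and products of Laurent expansions\<close>

locale laurent =
  fixes K :: "'f::field set" and V :: "'v set"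
  assumes K: "is_subfield K" and V: "finite V"
begin

abbreviation "T \<equiv> lspan K V"

lemma lspan_scale: "f \<in> T x S \<Longrightarrow> c \<in> K \<Longrightarrow> c * f \<in> T x S"
proof (induction rule: lspan.induct)
  case (step d m f)
  have "c * (d * lmon V x m + f) = (c * d) * lmon V x m + c * f" by (simp add: algebra_simps)
  then show ?case using step by (metis K is_subfieldD(4) lspan.step)
qed (auto intro: lspan.zero)

lemma lspan_uminus: "f \<in> T x S \<Longrightarrow> - f \<in> T x S"
  using lspan_scale[of f x S "-1"] is_subfieldD[OF K] by auto

lemma lspan_diff: "f \<in> T x S \<Longrightarrow> g \<in> T x S \<Longrightarrow> f - g \<in> T x S"
  using lspan_add[of f K V x S "-g"] lspan_uminus by auto

lemma lmon_in: "m \<in> S \<Longrightarrow> m \<in> lattice_on V \<Longrightarrow> lmon V x m \<in> T x S"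
  using lspan.step[of 1 K m S V 0 x] lspan.zero is_subfieldD[OF K] by auto

lemma const_in: "c \<in> K \<Longrightarrow> 0 \<in> S \<Longrightarrow> c \<in> T x S"
  using lspan.step[of c K 0 S V 0 x] lspan.zero by (auto simp: lmon_zero lattice_on_def)

lemma one_in: "0 \<in> S \<Longrightarrow> 1 \<in> T x S"
  by (intro const_in is_subfieldD K)

lemma lspan_repr:
  "f \<in> T x S \<longleftrightarrow> (\<exists>A c. finite A \<and> A \<subseteq> S \<inter> lattice_on V \<and> (\<forall>m\<in>A. c m \<in> K \<and> c m \<noteq> 0) \<and>
     f = (\<Sum>m\<in>A. c m * lmon V x m))" (is "_ \<longleftrightarrow> ?R f")
proof
  show "f \<in> T x S" if "?R f"
    using that by (auto intro!: lspan_sum lspan_scale lmon_in)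
  have R: "?R f" if "finite A" "A \<subseteq> S \<inter> lattice_on V" "\<forall>m\<in>A. c m \<in> K" "f = (\<Sum>m\<in>A. c m * lmon V x m)" for A c f
    using that by (intro exI[of _ "{m\<in>A. c m \<noteq> 0}"] exI[of _ c])
      (auto intro!: sum.mono_neutral_right)
  show "?R f" if "f \<in> T x S"
    using that
  proof (induction rule: lspan.induct)
    case zero
    show ?case by (intro exI[of _ "{}"]) auto
  next
    case (step d n f)
    from step.IH obtain A c where A: "finite A" "A \<subseteq> S \<inter> lattice_on V" "\<forall>m\<in>A. c m \<in> K \<and> c m \<noteq> 0"
      "f = (\<Sum>m\<in>A. c m * lmon V x m)" by auto
    \<comment> \<open>The exponent \<open>n\<close> may already occur in \<open>A\<close>, so
      coefficients are added; \<open>R\<close> drops those that have become zero.\<close>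
    define c' where "c' m = (if m \<in> A then c m else 0) + (if m = n then d else 0)" for m
    show ?case
    proof (rule R[of "insert n A" c'])
      show "\<forall>m\<in>insert n A. c' m \<in> K"
        using step A is_subfieldD[OF K] by (auto simp: c'_def)
      have "(\<Sum>m\<in>insert n A. c' m * lmon V x m) =
        (\<Sum>m\<in>insert n A. if m \<in> A then c m * lmon V x m else 0) + (\<Sum>m\<in>insert n A. if m = n then d * lmon V x m else 0)"
        unfolding sum.distrib[symmetric] by (intro sum.cong) (auto simp: c'_def algebra_simps)
      also have "(\<Sum>m\<in>insert n A. if m \<in> A then c m * lmon V x m else 0) = f"
        unfolding A(4) using A(1) by (intro sum.mono_neutral_cong_right) auto
      also have "(\<Sum>m\<in>insert n A. if m = n then d * lmon V x m else 0) = d * lmon V x n"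
        using A(1) by (simp add: sum.delta)
      finally show "d * lmon V x n + f = (\<Sum>m\<in>insert n A. c' m * lmon V x m)" by simp
    qed (use A step in auto)
  qed
qed

text \<open>By independence the difference of two expansions has zero coefficients, so a term with
  nonzero coefficient occurs in every expansion.\<close>

lemma support_unique:
  assumes ind: "lindep K V x" and A: "finite A" "A \<subseteq> lattice_on V" "\<forall>m\<in>A. c m \<in> K \<and> c m \<noteq> 0"
    and f: "(\<Sum>m\<in>A. c m * lmon V x m) \<in> T x S"
  shows "A \<subseteq> S"
proof
  fix n assume n: "n \<in> A"
  from f obtain B d where B: "finite B" "B \<subseteq> S \<inter> lattice_on V" "\<forall>m\<in>B. d m \<in> K \<and> d m \<noteq> 0"
    "(\<Sum>m\<in>A. c m * lmon V x m) = (\<Sum>m\<in>B. d m * lmon V x m)"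
    unfolding lspan_repr by auto
  define e where "e m = (if m \<in> A then c m else 0) - (if m \<in> B then d m else 0)" for m
  have "(\<Sum>m\<in>A \<union> B. e m * lmon V x m) =
     (\<Sum>m\<in>A \<union> B. if m \<in> A then c m * lmon V x m else 0) - (\<Sum>m\<in>A \<union> B. if m \<in> B then d m * lmon V x m else 0)"
    unfolding sum_subtractf[symmetric] by (intro sum.cong) (auto simp: e_def algebra_simps)
  also have "(\<Sum>m\<in>A \<union> B. if m \<in> A then c m * lmon V x m else 0) = (\<Sum>m\<in>A. c m * lmon V x m)"
    using A(1) B(1) by (intro sum.mono_neutral_cong_right) auto
  also have "(\<Sum>m\<in>A \<union> B. if m \<in> B then d m * lmon V x m else 0) = (\<Sum>m\<in>B. d m * lmon V x m)"
    using A(1) B(1) by (intro sum.mono_neutral_cong_right) auto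
  finally have "(\<Sum>m\<in>A \<union> B. e m * lmon V x m) = 0" using B by simp
  moreover have "\<forall>m\<in>A \<union> B. e m \<in> K"
    using A B is_subfieldD[OF K] by (auto simp: e_def)
  ultimately have "e n = 0"
    using ind[unfolded lindep_def, rule_format, of "A \<union> B" e n] A B n by blast
  then show "n \<in> S"
    using n A B by (auto simp: e_def split: if_splits)
qed

text \<open>There is only one support to constrain, so conditions established separately hold
  together, however many they are.\<close>

lemma lspan_INT:
  assumes "lindep K V x" "f \<in> T x S" "\<And>i. i \<in> I \<Longrightarrow> f \<in> T x (Q i)"
  shows "f \<in> T x (S \<inter> (\<Inter>i\<in>I. Q i))"
proof -
  from assms(2) obtain A c where A: "finite A" "A \<subseteq> S \<inter> lattice_on V" "\<forall>m\<in>A. c m \<in> K \<and> c m \<noteq> 0"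
    "f = (\<Sum>m\<in>A. c m * lmon V x m)"
    unfolding lspan_repr by blast
  have "A \<subseteq> Q i" if "i \<in> I" for i
    using support_unique[OF assms(1) A(1) _ A(3), of "Q i"] A assms(3)[OF that] by auto
  then show ?thesis
    unfolding lspan_repr using A by (intro exI[of _ A] exI[of _ c]) auto
qed

lemma lspan_Int: "lindep K V x \<Longrightarrow> f \<in> T x S \<Longrightarrow> f \<in> T x S' \<Longrightarrow> f \<in> T x (S \<inter> S')"
  using lspan_INT[of x f S "{()}" "\<lambda>_. S'"] by auto

lemma lspan_empty: "f \<in> T x S \<Longrightarrow> S \<inter> lattice_on V = {} \<Longrightarrow> f = 0"
  by (induction rule: lspan.induct) auto

text \<open>The usual way to prove an equality below: the difference is placed in two spans with
  incompatible exponents.\<close>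

lemma lspan_disjoint: "lindep K V x \<Longrightarrow> f \<in> T x S \<Longrightarrow> f \<in> T x S' \<Longrightarrow> S \<inter> S' = {} \<Longrightarrow> f = 0"
  using lspan_Int lspan_empty by blast

lemma lspan_split:
  assumes "f \<in> T x S"
  obtains g h where "f = g + h" "g \<in> T x (S \<inter> Q)" "h \<in> T x (S - Q)"
  using assms
proof (induction arbitrary: thesis rule: lspan.induct)
  case zero
  show ?case by (rule zero[of 0 0]) (auto intro: lspan.zero)
next
  case (step c m f)
  obtain g h where gh: "f = g + h" "g \<in> T x (S \<inter> Q)" "h \<in> T x (S - Q)"
    using step.IH by blast
  show ?case
  proof (cases "m \<in> Q")
    case True
    then show ?thesis using step gh
      by (intro step.prems[of "c * lmon V x m + g" h]) (auto intro: lspan.step simp: add.assoc)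
  next
    case False
    then have "c * lmon V x m + h \<in> T x (S - Q)"
      using step gh by (intro lspan.step) auto
    then show ?thesis
      using gh by (intro step.prems[of g "c * lmon V x m + h"]) (auto simp: add_ac)
  qed
qed

lemma lspan_decompose:
  assumes "f \<in> T x S"
  shows "\<exists>D a. finite D \<and> D \<subseteq> w ` S \<and> f = (\<Sum>\<alpha>\<in>D. a \<alpha>) \<and> (\<forall>\<alpha>. a \<alpha> \<in> T x (S \<inter> {m. w m = \<alpha>}))"
proof -
  from assms obtain A c where A: "finite A" "A \<subseteq> S \<inter> lattice_on V" "\<forall>m\<in>A. c m \<in> K \<and> c m \<noteq> 0"
    "f = (\<Sum>m\<in>A. c m * lmon V x m)"
    unfolding lspan_repr by blast
  define a where "a \<alpha> = (\<Sum>m\<in>{m\<in>A. w m = \<alpha>}. c m * lmon V x m)" for \<alpha>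
  have "f = (\<Sum>\<alpha>\<in>w ` A. a \<alpha>)"
    using A by (simp add: a_def sum.image_gen[symmetric])
  moreover have "a \<alpha> \<in> T x (S \<inter> {m. w m = \<alpha>})" for \<alpha>
    unfolding a_def using A by (auto intro!: lspan_sum lspan_scale lmon_in)
  ultimately show ?thesis
    using A by (intro exI[of _ "w ` A"] exI[of _ a]) auto
qed

text \<open>Stated for all larger \<open>k\<close> so that one bound can serve several elements; it
  decides which power of an exchange binomial clears denominators.\<close>

lemma lspan_bounded:
  fixes l :: "('v \<Rightarrow> int) \<Rightarrow> int"
  assumes "f \<in> T x S"
  obtains n where "\<And>k. n \<le> k \<Longrightarrow> f \<in> T x (S \<inter> {m. \<bar>l m\<bar> \<le> int k})"
proof -
  from assms have "\<exists>n. \<forall>k\<ge>n. f \<in> T x (S \<inter> {m. \<bar>l m\<bar> \<le> int k})"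
  proof (induction rule: lspan.induct)
    case (step c m f)
    then obtain n where n: "\<forall>k\<ge>n. f \<in> T x (S \<inter> {m. \<bar>l m\<bar> \<le> int k})" by auto
    show ?case
    proof (intro exI[of _ "max n (nat \<bar>l m\<bar>)"] allI impI)
      fix k assume "max n (nat \<bar>l m\<bar>) \<le> k"
      then show "c * lmon V x m + f \<in> T x (S \<inter> {m. \<bar>l m\<bar> \<le> int k})"
        using step n by (auto intro: lspan.step)
    qed
  qed (auto intro: lspan.zero)
  then show ?thesis using that by blast
qed

lemma lmon_add:
  assumes "\<And>v. v \<in> V \<Longrightarrow> x v \<noteq> 0"
  shows "lmon V x (m + n) = lmon V x m * lmon V x n"
  unfolding lmon_def prod.distrib[symmetric] using assms by (intro prod.cong) (auto simp: power_int_add)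

lemma lmon_nonzero: "(\<And>v. v \<in> V \<Longrightarrow> x v \<noteq> 0) \<Longrightarrow> lmon V x m \<noteq> 0"
  using V by (auto simp: lmon_def)

lemma lmon_minus:
  assumes "\<And>v. v \<in> V \<Longrightarrow> x v \<noteq> 0"
  shows "lmon V x (- m) = inverse (lmon V x m)"
  using lmon_add[of x m "-m"] assms by (simp add: lmon_zero inverse_unique)

lemma lspan_mult:
  assumes nz: "\<And>v. v \<in> V \<Longrightarrow> x v \<noteq> 0" and f: "f \<in> T x S" and g: "g \<in> T x S'"
    and sub: "\<And>m n. m \<in> S \<Longrightarrow> n \<in> S' \<Longrightarrow> m \<in> lattice_on V \<Longrightarrow> n \<in> lattice_on V \<Longrightarrow> m + n \<in> S''"
  shows "f * g \<in> T x S''"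
  using f
proof (induction rule: lspan.induct)
  case (step c m f)
  have "lmon V x m * g \<in> T x S''"
    using g
  proof (induction rule: lspan.induct)
    case (step d n g)
    have "lmon V x m * (d * lmon V x n + g) = d * lmon V x (m + n) + lmon V x m * g"
      by (simp add: lmon_add[OF nz] algebra_simps)
    then show ?case using step \<open>m \<in> S\<close> \<open>m \<in> lattice_on V\<close> by (auto intro!: lspan.step sub lattice_on_add)
  qed (auto intro: lspan.zero)
  then show ?case using step by (auto simp: algebra_simps intro!: lspan_add lspan_scale)
qed (auto intro: lspan.zero)

lemma lspan_mult_UNIV: "(\<And>v. v \<in> V \<Longrightarrow> x v \<noteq> 0) \<Longrightarrow> f \<in> T x UNIV \<Longrightarrow> g \<in> T x UNIV \<Longrightarrow> f * g \<in> T x UNIV"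
  by (rule lspan_mult) auto

lemma lspan_power_UNIV: "(\<And>v. v \<in> V \<Longrightarrow> x v \<noteq> 0) \<Longrightarrow> f \<in> T x UNIV \<Longrightarrow> f ^ n \<in> T x UNIV"
  by (induction n) (auto intro!: lspan_mult_UNIV one_in)

lemma lmon_single:
  assumes "u \<in> V" shows "lmon V x (\<lambda>v. if v = u then k else 0) = x u powi k"
proof -
  have "lmon V x (\<lambda>v. if v = u then k else 0) = (\<Prod>v\<in>V. if v = u then x v powi k else 1)"
    unfolding lmon_def by (intro prod.cong) auto
  then show ?thesis using assms V by simp
qed

lemma lindep_nonzero:
  assumes ind: "lindep K V x" and v: "v \<in> V"
  shows "x v \<noteq> 0"
proof
  assume "x v = 0"
  then have "lmon V x (\<lambda>w. if w = v then 1 else 0) = 0" using lmon_single[OF v, of x 1] by simp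
  then have "lmon V x (\<lambda>w. if w = v then 1 else 0) \<in> T x {}" by (simp add: lspan.zero)
  moreover have "(\<lambda>w. if w = v then 1 else 0) \<in> lattice_on V" using v by (auto simp: lattice_on_def)
  ultimately show False
    using support_unique[OF ind, of "{\<lambda>w. if w = v then 1 else 0}" "\<lambda>_. 1" "{}"] is_subfieldD[OF K] by auto
qed

end

section \<open>Exchange relations\<close>

text \<open>An exchange relation detached from its quiver, with \<open>a\<close> and
  \<open>b\<close> the exponents of its two terms. As neither involves \<open>u\<close>, both can be
  evaluated in \<open>x\<close> or in \<open>y\<close>, which makes the relation symmetric. If
  \<open>a = b\<close>, the right side would be twice a monomial, hence zero in characteristic
  2.\<close>

definition exch :: "'v set \<Rightarrow> 'v \<Rightarrow> ('v \<Rightarrow> int) \<Rightarrow> ('v \<Rightarrow> int) \<Rightarrow> ('v \<Rightarrow> 'f::field) \<Rightarrow> ('v \<Rightarrow> 'f) \<Rightarrow> bool" where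
  "exch V u a b x y \<longleftrightarrow> u \<in> V \<and> a \<in> lattice_on V \<and> b \<in> lattice_on V \<and> a u = 0 \<and> b u = 0 \<and> a \<noteq> b \<and>
     (\<forall>v\<in>V - {u}. y v = x v) \<and> x u * y u = lmon V x a + lmon V x b"

context laurent
begin

abbreviation "P x a b \<equiv> lmon V x a + lmon V x b"

lemma exch_lmon:
  assumes "exch V u a b x y" "m u = 0"
  shows "lmon V y m = lmon V x m"
  unfolding lmon_def
proof (rule prod.cong)
  fix v assume "v \<in> V"
  then show "y v powi m v = x v powi m v"
    using assms by (cases "v = u") (auto simp: exch_def)
qed simp

lemma exch_sym: "exch V u a b x y \<Longrightarrow> exch V u a b y x"
  using exch_lmon[of u a b x y a] exch_lmon[of u a b x y b] by (auto simp: exch_def mult.commute)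

lemma P_nonzero:
  assumes ind: "lindep K V x" and "a \<in> lattice_on V" "b \<in> lattice_on V" "a \<noteq> b"
  shows "P x a b \<noteq> 0"
proof
  assume "P x a b = 0"
  then have "(\<Sum>m\<in>{a, b}. 1 * lmon V x m) = 0" using assms by simp
  then show False
    using ind[unfolded lindep_def, rule_format, of "{a, b}" "\<lambda>_. 1" a] assms is_subfieldD[OF K] by auto
qed

lemma exch_nonzero:
  assumes "lindep K V x" "exch V u a b x y" "v \<in> V"
  shows "x v \<noteq> 0" "y v \<noteq> 0" "P x a b \<noteq> 0"
proof -
  show *: "P x a b \<noteq> 0" using P_nonzero assms by (auto simp: exch_def)
  show x: "x v \<noteq> 0" using lindep_nonzero assms by auto
  show "y v \<noteq> 0" using assms x * by (cases "v = u") (auto simp: exch_def)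
qed

lemma power_lin_comb:
  assumes nz: "\<And>v. v \<in> V \<Longrightarrow> x v \<noteq> 0" and a: "a \<in> lattice_on V" and b: "b \<in> lattice_on V"
  shows "(P x a b) ^ k \<in> T x {m. \<exists>i j. i + j = k \<and> m = (\<lambda>v. int i * a v + int j * b v)}"
proof (induction k)
  case 0
  show ?case by (auto intro!: one_in)
next
  case (Suc k)
  have "P x a b \<in> T x {a, b}" using a b by (intro lspan_add lmon_in) auto
  from lspan_mult[OF nz this Suc]
  show ?case
    unfolding power_Suc
  proof (rule meta_mp)
    fix m n assume "m \<in> {a, b}" and "n \<in> {m. \<exists>i j. i + j = k \<and> m = (\<lambda>v. int i * a v + int j * b v)}"
    then obtain i j where ij: "i + j = k" "n = (\<lambda>v. int i * a v + int j * b v)" and m: "m = a \<or> m = b"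
      by auto
    from m show "m + n \<in> {m. \<exists>i j. i + j = Suc k \<and> m = (\<lambda>v. int i * a v + int j * b v)}"
    proof
      assume "m = a"
      then show ?thesis using ij by (intro CollectI exI[of _ "Suc i"] exI[of _ j]) (auto simp: algebra_simps)
    next
      assume "m = b"
      then show ?thesis using ij by (intro CollectI exI[of _ i] exI[of _ "Suc j"]) (auto simp: algebra_simps)
    qed
  qed auto
qed

text \<open>Substitute \<open>y u = P x a b / x u\<close>: the exponent at \<open>u\<close> changes
  sign, and the power \<open>m u\<close> of the binomial, possibly negative, becomes nonnegative
  after multiplication by the \<open>N\<close>-th power.\<close>

lemma lmon_flip:
  assumes nz: "\<And>v. v \<in> V \<Longrightarrow> x v \<noteq> 0" "\<And>v. v \<in> V \<Longrightarrow> y v \<noteq> 0" and e: "exch V u a b x y"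
    and N: "- m u \<le> int N"
  shows "(P x a b) ^ N * lmon V y m = lmon V x (m(u := - m u)) * (P x a b) ^ nat (int N + m u)"
proof -
  have u: "u \<in> V" using e by (simp add: exch_def)
  have P: "P x a b = x u * y u" using e by (simp add: exch_def)
  have nzu: "x u \<noteq> 0" "y u \<noteq> 0" using nz u by auto
  have 1: "lmon V y m = y u powi m u * (\<Prod>v\<in>V - {u}. x v powi m v)"
    unfolding lmon_def using u V e by (subst prod.remove[of V u]) (auto simp: exch_def intro!: prod.cong)
  have 2: "lmon V x (m(u := - m u)) = x u powi (- m u) * (\<Prod>v\<in>V - {u}. x v powi m v)"
    unfolding lmon_def using u V by (subst prod.remove[of V u]) (auto intro!: prod.cong)
  have "(P x a b) ^ nat (int N + m u) = (x u * y u) powi (int N + m u)"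
    using N P by (simp add: power_int_def)
  also have "\<dots> = (x u * y u) ^ N * (x u powi m u * y u powi m u)"
    using nzu by (simp add: power_int_add power_int_mult_distrib power_mult_distrib)
  finally have 3: "(P x a b) ^ nat (int N + m u) = (x u * y u) ^ N * (x u powi m u * y u powi m u)" .
  show ?thesis
    unfolding 1 2 3 unfolding P using nzu by (simp add: power_int_minus field_simps)
qed

text \<open>The transfer principle between adjacent clusters. The last hypothesis lists the
  exponents that the substitution produces: the sign at \<open>u\<close> flips, and each of the
  \<open>N + m u\<close> factors of the binomial contributes \<open>a\<close> or
  \<open>b\<close>.\<close>

lemma pull:
  assumes nz: "\<And>v. v \<in> V \<Longrightarrow> x v \<noteq> 0" "\<And>v. v \<in> V \<Longrightarrow> y v \<noteq> 0" and e: "exch V u a b x y"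
    and f: "f \<in> T y S'" and N: "\<And>m. m \<in> S' \<Longrightarrow> - m u \<le> int N"
    and S: "\<And>m i j. m \<in> S' \<Longrightarrow> m \<in> lattice_on V \<Longrightarrow> int i + int j = int N + m u \<Longrightarrow>
      m(u := - m u) + (\<lambda>v. int i * a v + int j * b v) \<in> S"
  shows "(P x a b) ^ N * f \<in> T x S"
  using f
proof (induction rule: lspan.induct)
  case (step c m f)
  have "(P x a b) ^ N * lmon V y m = lmon V x (m(u := - m u)) * (P x a b) ^ nat (int N + m u)"
    using lmon_flip[OF nz e] N step by auto
  also have "\<dots> \<in> T x S"
  proof (rule lspan_mult[OF nz(1)])
    have "u \<in> V" using e by (auto simp: exch_def)
    then show "lmon V x (m(u := - m u)) \<in> T x {m(u := - m u)}"
      using step by (intro lmon_in) (auto simp: lattice_on_def)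
    show "(P x a b) ^ nat (int N + m u) \<in> T x {n. \<exists>i j. i + j = nat (int N + m u) \<and> n = (\<lambda>v. int i * a v + int j * b v)}"
      using e by (intro power_lin_comb nz) (auto simp: exch_def)
    fix n k assume nk: "n \<in> {m(u := - m u)}" "k \<in> {n. \<exists>i j. i + j = nat (int N + m u) \<and> n = (\<lambda>v. int i * a v + int j * b v)}"
    from nk(2) obtain i j where ij: "i + j = nat (int N + m u)" "k = (\<lambda>v. int i * a v + int j * b v)" by blast
    have "int i + int j = int N + m u" using ij(1) N[of m] step by linarith
    from S[of m i j, OF _ _ this] step nk(1) ij(2) show "n + k \<in> S" by auto
  qed
  finally have *: "(P x a b) ^ N * lmon V y m \<in> T x S" .
  have "(P x a b) ^ N * (c * lmon V y m + f) = c * ((P x a b) ^ N * lmon V y m) + (P x a b) ^ N * f"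
    by (simp add: algebra_simps)
  then show ?case using step * by (auto intro!: lspan_add lspan_scale)
qed (auto intro: lspan.zero)

text \<open>Induction on the set of terms, removing the part of top degree \<open>k\<close> in
  \<open>y u\<close>. Pulled back to \<open>x\<close>, it has exponent \<open>- k\<close> at
  \<open>u\<close> while all other terms have larger ones, so it vanishes by itself. It is
  \<open>y u powi k\<close> times a combination free of \<open>u\<close>, to which independence of
  \<open>x\<close> applies.\<close>

lemma lindep_exch:
  assumes ind: "lindep K V x" and e: "exch V u a b x y"
  shows "lindep K V y"
  unfolding lindep_def
proof (intro allI impI)
  fix A c assume "finite A" "A \<subseteq> lattice_on V" "\<forall>m\<in>A. c m \<in> K" "(\<Sum>m\<in>A. c m * lmon V y m) = 0"
  then show "\<forall>m\<in>A. c m = 0"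
  proof (induction A rule: finite_psubset_induct)
    case (psubset A)
    note nz = exch_nonzero[OF ind e]
    show ?case
    proof (cases "A = {}")
      case False
      define k where "k = Max ((\<lambda>m. m u) ` A)"
      have le: "m u \<le> k" if "m \<in> A" for m
        unfolding k_def using that psubset(1) by (intro Max_ge) auto
      define A1 where "A1 = {m\<in>A. m u = k}"
      define A2 where "A2 = {m\<in>A. m u < k}"
      have A: "A = A1 \<union> A2" "A1 \<inter> A2 = {}" using le by (force simp: A1_def A2_def)+
      have "k \<in> (\<lambda>m. m u) ` A" unfolding k_def using False psubset(1) by (intro Max_in) auto
      then have "A1 \<noteq> {}" by (auto simp: A1_def)
      then have A2: "A2 \<subset> A" using A by auto
      define f1 f2 where "f1 = (\<Sum>m\<in>A1. c m * lmon V y m)" and "f2 = (\<Sum>m\<in>A2. c m * lmon V y m)"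
      have f12: "f1 + f2 = 0"
        using psubset(1,5) A unfolding f1_def f2_def by (metis finite_Un sum.union_disjoint)
      \<comment> \<open>Large enough to clear all denominators when expansions over \<open>A\<close>
        are pulled back to \<open>x\<close>.\<close>
      define N where "N = nat (Max ((\<lambda>m. - m u) ` A))"
      have N: "- m u \<le> int N" if "m \<in> A" for m
      proof -
        have "- m u \<le> Max ((\<lambda>m. - m u) ` A)" using that psubset(1) by (intro Max_ge) auto
        then show ?thesis by (simp add: N_def)
      qed
      have 1: "(P x a b) ^ N * f1 \<in> T x {m. m u = - k}"
      proof (rule pull[OF nz(1,2) e])
        show "f1 \<in> T y A1" unfolding f1_def using psubset(1,3,4) by (auto intro!: lspan_sum lspan_scale lmon_in simp: A1_def)
      qed (use N e in \<open>auto simp: A1_def exch_def\<close>)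
      have 2: "(P x a b) ^ N * f2 \<in> T x {m. m u > - k}"
      proof (rule pull[OF nz(1,2) e])
        show "f2 \<in> T y A2" unfolding f2_def using psubset(1,3,4) by (auto intro!: lspan_sum lspan_scale lmon_in simp: A2_def)
      qed (use N e in \<open>auto simp: A2_def exch_def\<close>)
      have "(P x a b) ^ N * f1 = - ((P x a b) ^ N * f2)" using f12 by (simp add: eq_neg_iff_add_eq_0 flip: distrib_left)
      then have 3: "(P x a b) ^ N * f1 \<in> T x {m. m u > - k}" using 2 lspan_uminus by auto
      have "(P x a b) ^ N * f1 = 0" by (rule lspan_disjoint[OF ind 1 3]) auto
      have u: "u \<in> V" using e by (simp add: exch_def)
      have f1: "f1 = 0" using \<open>(P x a b) ^ N * f1 = 0\<close> nz(3)[OF u] by simp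
      have eq: "lmon V y m = y u powi k * lmon V x (m(u := 0))" if "m \<in> A1" for m
      proof -
        have "lmon V x (m(u := 0)) = lmon V y (m(u := 0))" using exch_lmon[OF e, of "m(u := 0)"] by simp
        also have "y u powi k * \<dots> = lmon V y m"
          unfolding lmon_def prod.remove[OF V u] using that by (simp add: A1_def)
        finally show ?thesis by simp
      qed
      have inj: "inj_on (\<lambda>m. m(u := 0)) A1"
      proof (rule inj_onI)
        fix m n assume mn: "m \<in> A1" "n \<in> A1" "m(u := 0) = n(u := 0)"
        have "m = (m(u := 0))(u := k)" using mn(1) by (auto simp: A1_def)
        also have "\<dots> = n" unfolding mn(3) using mn(2) by (auto simp: A1_def)
        finally show "m = n" .
      qed
      define g where "g = the_inv_into A1 (\<lambda>m. m(u := 0))"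
      have g: "g (m(u := 0)) = m" if "m \<in> A1" for m
        unfolding g_def using the_inv_into_f_f[OF inj that] .
      have "y u powi k * (\<Sum>n\<in>(\<lambda>m. m(u := 0)) ` A1. c (g n) * lmon V x n) = f1"
        unfolding sum.reindex[OF inj] sum_distrib_left f1_def by (intro sum.cong) (auto simp: g eq algebra_simps)
      then have "(\<Sum>n\<in>(\<lambda>m. m(u := 0)) ` A1. c (g n) * lmon V x n) = 0" using f1 nz(2) u by auto
      moreover have "finite ((\<lambda>m. m(u := 0)) ` A1)" "(\<lambda>m. m(u := 0)) ` A1 \<subseteq> lattice_on V"
         "\<forall>n\<in>(\<lambda>m. m(u := 0)) ` A1. c (g n) \<in> K"
        using psubset(1,3,4) u by (auto simp: A1_def lattice_on_def g[unfolded A1_def])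
      ultimately have "\<forall>n\<in>(\<lambda>m. m(u := 0)) ` A1. c (g n) = 0"
        using ind[unfolded lindep_def, rule_format, of "(\<lambda>m. m(u := 0)) ` A1" "\<lambda>n. c (g n)"] by blast
      then have "\<forall>m\<in>A1. c m = 0" using g by auto
      moreover have "\<forall>m\<in>A2. c m = 0"
        proof -
        have "f2 = 0" using f1 f12 by simp
        then show ?thesis
          using psubset(2)[OF A2] A2 psubset(3,4) unfolding f2_def by blast
      qed
      ultimately show ?thesis using A(1) by blast
    next
      case True
      then show ?thesis by simp
    qed
  qed
qed

text \<open>The hypothesis \<open>base\<close> is regularity of the pair \<open>p\<close>,
  \<open>q\<close> on \<open>B\<close>, phrased through denominators. It extends to powers by
  lowering first the exponent of \<open>q\<close> against a single \<open>p\<close>, then the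
  exponent of \<open>p\<close>.\<close>

lemma two_power:
  assumes B: "\<And>y. y \<in> B \<Longrightarrow> p * y \<in> B" "\<And>y. y \<in> B \<Longrightarrow> q * y \<in> B"
    and base: "\<And>y. p * y \<in> B \<Longrightarrow> q * y \<in> B \<Longrightarrow> y \<in> B"
    and f: "p ^ M * f \<in> B" "q ^ N * (f::'f) \<in> B"
  shows "f \<in> B"
proof -
  have pw: "q ^ n * y \<in> B" "p ^ n * y \<in> B" if "y \<in> B" for y n
    using that by (induction n) (auto simp: mult.assoc intro: B)
  have C1: "y \<in> B" if "p * y \<in> B" "q ^ n * y \<in> B" for y n
    using that
  proof (induction n)
    case (Suc n)
    have "p * (q ^ n * y) \<in> B" using pw(1)[OF Suc.prems(1), of n] by (simp add: algebra_simps)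
    moreover have "q * (q ^ n * y) \<in> B" using Suc.prems(2) by (simp add: mult.assoc)
    ultimately have "q ^ n * y \<in> B" by (rule base)
    then show ?case using Suc by auto
  qed auto
  show ?thesis
    using f
  proof (induction M)
    case (Suc M)
    have "q ^ N * (p ^ M * f) \<in> B" using pw(2)[OF Suc.prems(2), of M] by (simp add: algebra_simps)
    moreover have "p * (p ^ M * f) \<in> B" using Suc.prems(1) by (simp add: mult.assoc)
    ultimately have "p ^ M * f \<in> B" using C1 by blast
    then show ?case using Suc by auto
  qed auto
qed


section \<open>Elements that are Laurent in two adjacent clusters\<close>

lemma exch_power_in:
  assumes "lindep K V x" "exch V u a b x y"
  shows "(P x a b) ^ N \<in> T x {m. m u = 0}"
proof -
  note nz = exch_nonzero[OF assms]
  have "(P x a b) ^ N \<in> T x {m. \<exists>i j. i + j = N \<and> m = (\<lambda>v. int i * a v + int j * b v)}"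
    using assms(2) by (intro power_lin_comb nz) (auto simp: exch_def)
  then show ?thesis using assms(2) by (elim lspan_mono) (auto simp: exch_def)
qed

lemma exch_P: "exch V u a b x y \<Longrightarrow> P y a b = P x a b"
  using exch_lmon[of u a b x y a] exch_lmon[of u a b x y b] by (auto simp: exch_def)

lemma exch_swap: "exch V u a b x y \<Longrightarrow> exch V u b a x y"
  by (auto simp: exch_def add.commute)

lemma lspan_times_exch_power:
  assumes ind: "lindep K V x" and e: "exch V u a b x y" and f: "f \<in> T x (S \<inter> {m. m u \<in> I})"
  shows "(P x a b) ^ N * f \<in> T x {m. m u \<in> I}"
  by (rule lspan_mult[OF exch_nonzero(1)[OF ind e] exch_power_in[OF ind e] f]) auto

text \<open>With \<open>S\<close> and \<open>S'\<close> everything, this is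
  \<open>L_x \<inter> L_y = R[x u, y u]\<close>, where \<open>R\<close> is the Laurent ring in the
  other variables. Nonnegative powers of \<open>y u\<close> are nonpositive powers of
  \<open>x u\<close>; negative ones are positive powers of \<open>x u\<close> divided by powers of
  the binomial. Hence splitting by sign in \<open>x\<close> and in \<open>y\<close> gives the same
  two parts.\<close>

lemma onestep:
  assumes ind: "lindep K V x" and e: "exch V u a b x y" and f: "f \<in> T x S" "f \<in> T y S'"
  obtains g h where "f = g + h" "g \<in> T y (S' \<inter> {m. 0 \<le> m u})" "g \<in> T x (S \<inter> {m. m u \<le> 0})"
    "h \<in> T x (S \<inter> {m. 0 < m u})" "h \<in> T y (S' \<inter> {m. m u < 0})"
proof -
  note nz = exch_nonzero[OF ind e]
  have u: "u \<in> V" "a u = 0" "b u = 0" using e by (auto simp: exch_def)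
  obtain f1 f2 where f12: "f = f1 + f2" "f1 \<in> T y (S' \<inter> {m. 0 \<le> m u})" "f2 \<in> T y (S' - {m. 0 \<le> m u})"
    using lspan_split[OF f(2)] by blast
  have eq: "S' - {m. 0 \<le> m u} = S' \<inter> {m. m u < 0}" by auto
  have 1: "f1 \<in> T x {m. m u \<in> {..0}}"
    using pull[OF nz(1,2) e f12(2), where N=0 and S="{m. m u \<in> {..0}}"] u by auto
  obtain n where n: "f2 \<in> T y ((S' - {m. 0 \<le> m u}) \<inter> {m. \<bar>m u\<bar> \<le> int n})"
    using lspan_bounded[OF f12(3), of "\<lambda>m. m u"] by (metis order_refl)
  have 2: "(P x a b) ^ n * f2 \<in> T x {m. m u \<in> {0<..}}"
    by (rule pull[OF nz(1,2) e n]) (use u in auto)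
  obtain g h where gh: "f = g + h" "g \<in> T x (S \<inter> {m. m u \<in> {..0}})" "h \<in> T x (S - {m. m u \<in> {..0}})"
    using lspan_split[OF f(1)] by blast
  have h: "h \<in> T x (S \<inter> {m. m u \<in> {0<..}})" using gh(3) by (rule lspan_mono) auto
  have "g - f1 \<in> T x {m. m u \<in> {..0}}"
    using lspan_diff[OF _ 1] gh(2) by (meson inf_le2 lspan_mono inf_le1 order_trans)
  then have 3: "(P x a b) ^ n * (g - f1) \<in> T x {m. m u \<in> {..0}}"
    using lspan_times_exch_power[OF ind e, of "g - f1" UNIV "{..0}" n] by simp
  \<comment> \<open>The left side has exponents \<le> 0 at \<open>u\<close>; the right side, after
    multiplication by a power of the binomial, has exponents > 0. The binomial is free of
    \<open>x u\<close>, so both must be zero.\<close>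
  have "g - f1 = f2 - h" using gh f12 by (simp add: algebra_simps)
  then have "(P x a b) ^ n * (g - f1) = (P x a b) ^ n * f2 - (P x a b) ^ n * h" by (simp add: right_diff_distrib)
  also have "\<dots> \<in> T x {m. m u \<in> {0<..}}"
    by (intro lspan_diff 2 lspan_times_exch_power[OF ind e h])
  finally have "(P x a b) ^ n * (g - f1) = 0" by (rule lspan_disjoint[OF ind 3]) auto
  then have "g = f1" using nz(3)[OF u(1)] by simp
  then show thesis using that[of f1 f2] f12 gh h unfolding eq by auto
qed

text \<open>Let \<open>h\<close> collect the terms negative in \<open>x u\<close>, which are those
  positive in \<open>y u\<close>. Each factor \<open>y u = P x a b / x u\<close> adds at least 1 to
  the total degree in \<open>W\<close>, because both terms of the binomial do; but \<open>h\<close>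
  has \<open>W\<close>-degree 0 in \<open>x\<close>, so it vanishes.\<close>

lemma exponent_nonneg:
  assumes ind: "lindep K V x" and e: "exch V u a b x y" and W: "finite W" "u \<notin> W"
    and ab: "1 \<le> sum a W" "1 \<le> sum b W"
    and f: "f \<in> T x {m. sum m W = 0}" "f \<in> T y {m. 0 \<le> sum m W}"
  shows "f \<in> T x {m. 0 \<le> m u}"
proof -
  note nz = exch_nonzero[OF ind e]
  have u: "u \<in> V" "a u = 0" "b u = 0" using e by (auto simp: exch_def)
  obtain g h where gh: "f = g + h" "g \<in> T x ({m. sum m W = 0} \<inter> {m. 0 \<le> m u})"
    "h \<in> T y ({m. 0 \<le> sum m W} \<inter> {m. 0 < m u})" "h \<in> T x ({m. sum m W = 0} \<inter> {m. m u < 0})"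
    using onestep[OF lindep_exch[OF ind e] exch_sym[OF e] f(2,1)] by metis
  have "(P x a b) ^ 0 * h \<in> T x {m. 1 \<le> sum m W}"
  proof (rule pull[OF nz(1,2) e gh(3)])
    fix m i j assume m: "m \<in> {m. 0 \<le> sum m W} \<inter> {m. 0 < m u}" and ij: "int i + int j = int 0 + m u"
    have "sum (m(u := - m u)) W = sum m W" using W by (intro sum.cong) auto
    moreover have "(\<Sum>v\<in>W. int i * a v + int j * b v) = int i * sum a W + int j * sum b W"
      by (simp add: sum.distrib sum_distrib_left)
    moreover have "int i * 1 \<le> int i * sum a W" "int j * 1 \<le> int j * sum b W"
      using ab by (intro mult_left_mono; simp)+
    ultimately show "m(u := - m u) + (\<lambda>v. int i * a v + int j * b v) \<in> {m. 1 \<le> sum m W}"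
      using m ij by (auto simp: sum.distrib)
  qed auto
  then have h1: "h \<in> T x {m. 1 \<le> sum m W}" by simp
  have "h = 0" by (rule lspan_disjoint[OF ind gh(4) h1]) auto
  then show ?thesis using gh(1,2) by (auto elim: lspan_mono)
qed

text \<open>Since \<open>a\<close> and \<open>b\<close> vanish on \<open>W\<close>, pulling back
  changes no exponent there. The part \<open>h\<close> of the expansion in \<open>y\<close> that
  involves \<open>W\<close> would therefore still involve it in \<open>x\<close>, where
  \<open>f\<close> does not.\<close>

lemma support_transfer:
  assumes ind: "lindep K V x" and e: "exch V u a b x y" and W: "u \<notin> W"
    and ab: "\<forall>v\<in>W. a v = 0 \<and> b v = 0"
    and f: "f \<in> T x {m. \<forall>v\<in>W. m v = 0}" "f \<in> T y S"
  shows "f \<in> T y (S \<inter> {m. \<forall>v\<in>W. m v = 0})"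
proof -
  note nz = exch_nonzero[OF ind e]
  define Q where "Q = {m::'v \<Rightarrow> int. \<forall>v\<in>W. m v = 0}"
  have u: "u \<in> V" "a u = 0" "b u = 0" using e by (auto simp: exch_def)
  obtain g h where gh: "f = g + h" "g \<in> T y (S \<inter> Q)" "h \<in> T y (S - Q)"
    using lspan_split[OF f(2)] by blast
  obtain n1 where n1: "\<And>k. n1 \<le> k \<Longrightarrow> g \<in> T y (S \<inter> Q \<inter> {m. \<bar>m u\<bar> \<le> int k})"
    using lspan_bounded[OF gh(2), of "\<lambda>m. m u"] by metis
  obtain n2 where n2: "\<And>k. n2 \<le> k \<Longrightarrow> h \<in> T y ((S - Q) \<inter> {m. \<bar>m u\<bar> \<le> int k})"
    using lspan_bounded[OF gh(3), of "\<lambda>m. m u"] by metis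
  define n where "n = max n1 n2"
  have "(P x a b) ^ n * g \<in> T x Q"
    by (rule pull[OF nz(1,2) e n1[of n]]) (use ab W in \<open>auto simp: n_def Q_def\<close>)
  moreover have "(P x a b) ^ n * f \<in> T x Q"
  proof (rule lspan_mult[OF nz(1) _ f(1)])
    show "(P x a b) ^ n \<in> T x {m. \<exists>i j. i + j = n \<and> m = (\<lambda>v. int i * a v + int j * b v)}"
      using e by (intro power_lin_comb nz) (auto simp: exch_def)
  qed (use ab in \<open>auto simp: Q_def\<close>)
  ultimately have "(P x a b) ^ n * f - (P x a b) ^ n * g \<in> T x Q"
    using lspan_diff by blast
  then have 1: "(P x a b) ^ n * h \<in> T x Q" using gh(1) by (simp add: algebra_simps)
  have 2: "(P x a b) ^ n * h \<in> T x (- Q)"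
    by (rule pull[OF nz(1,2) e n2[of n]]) (use ab W in \<open>auto simp: n_def Q_def\<close>)
  have "(P x a b) ^ n * h = 0" by (rule lspan_disjoint[OF ind 1 2]) auto
  then have "h = 0" using nz(3) u by auto
  then show ?thesis using gh by (simp add: Q_def)
qed

lemma lmon_upd: "u \<in> V \<Longrightarrow> lmon V x m = x u powi m u * lmon V x (m(u := 0))"
  unfolding lmon_def by (subst (1 2) prod.remove[OF V]) (auto intro!: prod.cong)

lemma var_power_in: "p \<in> V \<Longrightarrow> (\<lambda>v. if v = p then k else 0) \<in> S \<Longrightarrow> x p powi k \<in> T x S"
  using lmon_in[of "\<lambda>v. if v = p then k else 0" S x] by (auto simp: lmon_single lattice_on_def)

text \<open>The binomial and \<open>y p\<close> form a regular pair on the elements without negative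
  powers of \<open>y p\<close>: as \<open>a p\<close> and \<open>b p\<close> are not both positive,
  the binomial is nonzero modulo \<open>y p\<close>. A power of either clears the denominators of
  \<open>f\<close>.\<close>

lemma frozen_transfer:
  assumes ind: "lindep K V x" and e: "exch V u a b x y" and p: "p \<in> V" "p \<noteq> u"
    and ab: "0 \<le> a p" "0 \<le> b p" "a p = 0 \<or> b p = 0"
    and f: "f \<in> T x {m. 0 \<le> m p}" "f \<in> T y UNIV"
  shows "f \<in> T y {m. 0 \<le> m p}"
proof -
  note nz = exch_nonzero[OF ind e]
  have indy: "lindep K V y" using lindep_exch[OF ind e] .
  have u: "u \<in> V" "a u = 0" "b u = 0" "a \<in> lattice_on V" "b \<in> lattice_on V" using e by (auto simp: exch_def)
  let ?B = "T y {m. 0 \<le> m p}"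
  have Pxy: "P x a b = P y a b" using exch_P[OF e] by simp
  have Pin: "P x a b \<in> T y {m. 0 \<le> m p}"
    unfolding Pxy using u ab by (intro lspan_add lmon_in) auto
  have up: "y p * h \<in> T y {m. k + 1 \<le> m p}" if "h \<in> T y {m. k \<le> m p}" for h k
    by (rule lspan_mult[OF nz(2) var_power_in[of p 1 "{m. m p = 1}", simplified] that]) (use p in auto)
  have down: "h \<in> T y {m. k \<le> m p}" if h: "y p * h \<in> T y {m. k + 1 \<le> m p}" for h k
  proof -
    have "y p powi (-1) * (y p * h) \<in> T y {m. k \<le> m p}"
      by (rule lspan_mult[OF nz(2) var_power_in[of p "-1" "{m. m p = -1}"] h]) (use p in auto)
    then show ?thesis using nz(2)[OF p(1)] by (simp flip: mult.assoc)
  qed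
  obtain n where n: "f \<in> T x ({m. 0 \<le> m p} \<inter> {m. \<bar>m u\<bar> \<le> int n})"
    using lspan_bounded[OF f(1), of "\<lambda>m. m u"] by (metis order_refl)
  obtain k where k: "f \<in> T y (UNIV \<inter> {m. \<bar>m p\<bar> \<le> int k})"
    using lspan_bounded[OF f(2), of "\<lambda>m. m p"] by (metis order_refl)
  show ?thesis
  proof (rule two_power[where p="P x a b" and q="y p"])
    fix h assume h: "h \<in> ?B"
    show "P x a b * h \<in> ?B" by (rule lspan_mult[OF nz(2) Pin h]) auto
    show "y p * h \<in> ?B" using up[OF h] by (auto elim: lspan_mono)
  next
    fix w assume w: "P x a b * w \<in> ?B" "y p * w \<in> ?B"
    define h where "h = y p * w"
    have "h \<in> ?B" using w h_def by simp
    \<comment> \<open>\<open>h0\<close> is the constant term in \<open>y p\<close>. The binomial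
      times \<open>h\<close> is divisible by \<open>y p\<close>, hence so is the binomial times
      \<open>h0\<close>, which forces \<open>h0 = 0\<close>.\<close>
    then obtain h0 h1 where h: "h = h0 + h1" "h0 \<in> T y ({m. 0 \<le> m p} \<inter> {m. m p = 0})"
      "h1 \<in> T y ({m. 0 \<le> m p} - {m. m p = 0})"
      by (rule lspan_split)
    have h0: "h0 \<in> T y {m. m p = 0}" using h(2) by (auto elim: lspan_mono)
    have h1: "h1 \<in> T y {m. 1 \<le> m p}" using h(3) by (auto elim: lspan_mono)
    have Ph: "P x a b * h \<in> T y {m. 1 \<le> m p}"
      using up[OF w(1)] by (simp add: h_def algebra_simps)
    have Ph1: "P x a b * h1 \<in> T y {m. 1 \<le> m p}" by (rule lspan_mult[OF nz(2) Pin h1]) auto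
    have Ph0: "P x a b * h0 \<in> T y {m. 1 \<le> m p}"
      using lspan_diff[OF Ph Ph1] h by (simp add: algebra_simps)
    have mon0: "lmon V y c * h0 \<in> T y {m. m p = c p}" if "c \<in> lattice_on V" for c
      by (rule lspan_mult[OF nz(2) lmon_in[of c "{c}"] h0]) (use that in auto)
    have "h0 = 0"
    proof (cases "a p = 0 \<and> b p = 0")
      case True
      have *: "P x a b * h0 \<in> T y {m. m p = 0}"
        using mon0[OF u(4)] mon0[OF u(5)] True unfolding Pxy distrib_right by (auto intro: lspan_add)
      have "P x a b * h0 = 0" by (rule lspan_disjoint[OF indy Ph0 *]) auto
      then show ?thesis using nz(3) u by auto
    next
      case False
      \<comment> \<open>Modulo \<open>y p\<close> only the term with exponent \<open>c\<close>
        survives, and a monomial can be cancelled.\<close>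
      have **: "h0 = 0" if "c p = 0" "0 < d p" "P x a b = lmon V y c + lmon V y d"
        "c \<in> lattice_on V" "d \<in> lattice_on V" for c d
      proof -
        have "lmon V y d * h0 \<in> T y {m. 1 \<le> m p}"
          using mon0[OF that(5)] that(2) by (auto elim: lspan_mono)
        then have *: "lmon V y c * h0 \<in> T y {m. 1 \<le> m p}"
          using lspan_diff[OF Ph0] that(3) by (metis add_diff_cancel_right' distrib_right)
        have "lmon V y c * h0 = 0" by (rule lspan_disjoint[OF indy mon0[OF that(4)] *]) (use that in auto)
        then show ?thesis using lmon_nonzero[OF nz(2)] by auto
      qed
      show ?thesis using **[of a b] **[of b a] False u ab Pxy by (auto simp: add.commute)
    qed
    then have "y p * w \<in> T y {m. 0 + 1 \<le> m p}" using h h1 h_def by simp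
    then show "w \<in> ?B" by (rule down)
  next
    show "(P x a b) ^ n * f \<in> ?B"
      unfolding Pxy by (rule pull[OF nz(2,1) exch_sym[OF e] n]) (use p ab in auto)
  next
    have "y p powi int k * f \<in> ?B"
      by (rule lspan_mult[OF nz(2) var_power_in[of p "int k" "{m. m p = int k}"] k]) (use p in auto)
    then show "y p ^ k * f \<in> ?B" by simp
  qed
qed

text \<open>The shift \<open>\<delta>\<close> is there for the weight of a power of the exchange
  binomial by which all components have been multiplied.\<close>

lemma homogeneous_sum_zero:
  fixes w :: "('v \<Rightarrow> int) \<Rightarrow> 'l::ab_group_add"
  assumes ind: "lindep K V x" and D: "finite D" "(\<Sum>\<alpha>\<in>D. e \<alpha>) = 0"
    and e: "\<And>\<alpha>. \<alpha> \<in> D \<Longrightarrow> e \<alpha> \<in> T x {m. w m = \<alpha> + \<delta>}" and \<alpha>: "\<alpha> \<in> D"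
  shows "e \<alpha> = (0::'f)"
proof -
  have "(\<Sum>\<beta>\<in>D - {\<alpha>}. e \<beta>) \<in> T x {m. w m \<noteq> \<alpha> + \<delta>}"
    by (intro lspan_sum lspan_mono[OF e]) auto
  then have "- (\<Sum>\<beta>\<in>D - {\<alpha>}. e \<beta>) \<in> T x {m. w m \<noteq> \<alpha> + \<delta>}" by (rule lspan_uminus)
  moreover have "- (\<Sum>\<beta>\<in>D - {\<alpha>}. e \<beta>) = e \<alpha>"
    using D \<alpha> by (simp add: sum.remove[of D \<alpha>] minus_unique add.commute)
  ultimately have "e \<alpha> \<in> T x {m. w m \<noteq> \<alpha> + \<delta>}" by simp
  from lspan_disjoint[OF ind e[OF \<alpha>] this] show ?thesis by auto
qed

text \<open>\<open>w'\<close> is \<open>w\<close> rewritten in the cluster \<open>y\<close>, where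
  \<open>y u\<close> has weight \<open>w a\<close> minus that of \<open>x u\<close>. The binomial is
  homogeneous by \<open>w a = w b\<close>, so after multiplication by one of its powers the
  decompositions found in \<open>x\<close> and in \<open>y\<close> can be compared in
  \<open>x\<close>, and they agree component by component.\<close>

lemma homogeneous_transfer:
  fixes w :: "('v \<Rightarrow> int) \<Rightarrow> 'l::ab_group_add"
  assumes ind: "lindep K V x" and e: "exch V u a b x y"
    and w: "\<And>m n. w (m + n) = w m + w n" and ab: "w a = w b"
    and w': "\<And>m. w' m = w (m(u := - m u)) + w (\<lambda>v. m u * a v)"
    and D: "finite D" and f: "(\<Sum>\<alpha>\<in>D. c \<alpha>) \<in> T y S"
    and c: "\<And>\<alpha>. \<alpha> \<in> D \<Longrightarrow> c \<alpha> \<in> T x {m. w m = \<alpha>}" and \<alpha>: "\<alpha> \<in> D"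
  shows "c \<alpha> \<in> T y (S \<inter> {m. w' m = \<alpha>})"
proof -
  note nz = exch_nonzero[OF ind e]
  have u: "u \<in> V" "a u = 0" "b u = 0" using e by (auto simp: exch_def)
  have wk: "w (\<lambda>v. (k + l) * h v) = w (\<lambda>v. k * h v) + w (\<lambda>v. l * h v)" for k l h
    using w[of "\<lambda>v. k * h v" "\<lambda>v. l * h v"] by (simp add: plus_fun_def distrib_right)
  have w0: "w (\<lambda>v. 0) = 0" using wk[of 0 0] by simp
  have "w (\<lambda>v. int k * a v) = w (\<lambda>v. int k * b v)" for k
    by (induction k) (use wk[of 1 "int _"] ab in auto)
  moreover have "w (\<lambda>v. int i * a v + int j * b v) = w (\<lambda>v. int i * a v) + w (\<lambda>v. int j * b v)" for i j
    using w[of "\<lambda>v. int i * a v" "\<lambda>v. int j * b v"] by (simp add: plus_fun_def)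
  ultimately have wij: "w (\<lambda>v. int i * a v + int j * b v) = w (\<lambda>v. (int i + int j) * a v)" for i j
    using wk by simp
  have pl: "(P x a b) ^ N * g \<in> T x {m. w m = \<beta> + w (\<lambda>v. int N * a v)}"
    if "g \<in> T y ({m. w' m = \<beta>} \<inter> {m. \<bar>m u\<bar> \<le> int N})" for N g \<beta>
    by (rule pull[OF nz(1,2) e that]) (auto simp: w wij w' wk add_ac)
  have px: "(P x a b) ^ N * g \<in> T x {m. w m = \<beta> + w (\<lambda>v. int N * a v)}"
    if "g \<in> T x {m. w m = \<beta>}" for N g \<beta>
  proof (rule lspan_mult[OF nz(1) _ that])
    show "(P x a b) ^ N \<in> T x {m. \<exists>i j. i + j = N \<and> m = (\<lambda>v. int i * a v + int j * b v)}"
      using e by (intro power_lin_comb nz) (auto simp: exch_def)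
  qed (auto simp: w wij)
  obtain D' d where D': "finite D'" "(\<Sum>\<alpha>\<in>D. c \<alpha>) = (\<Sum>\<alpha>\<in>D'. d \<alpha>)"
    "\<forall>\<alpha>. d \<alpha> \<in> T y (S \<inter> {m. w' m = \<alpha>})"
    using lspan_decompose[OF f, of w'] by blast
  \<comment> \<open>Extended by zero, both decompositions run over the same weights
    \<open>D \<union> D'\<close>.\<close>
  define c' d' where "c' \<beta> = (if \<beta> \<in> D then c \<beta> else 0)" and "d' \<beta> = (if \<beta> \<in> D' then d \<beta> else 0)" for \<beta>
  have c': "c' \<beta> \<in> T x {m. w m = \<beta>}" for \<beta> using c by (auto simp: c'_def lspan.zero)
  have d': "d' \<beta> \<in> T y (S \<inter> {m. w' m = \<beta>})" for \<beta> using D'(3) by (auto simp: d'_def lspan.zero)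
  have sums: "(\<Sum>\<beta>\<in>D \<union> D'. c' \<beta>) = (\<Sum>\<beta>\<in>D \<union> D'. d' \<beta>)"
  proof -
    have "(\<Sum>\<beta>\<in>D \<union> D'. c' \<beta>) = (\<Sum>\<beta>\<in>D. c \<beta>)"
      using D D' by (intro sum.mono_neutral_cong_right) (auto simp: c'_def)
    moreover have "(\<Sum>\<beta>\<in>D \<union> D'. d' \<beta>) = (\<Sum>\<beta>\<in>D'. d \<beta>)"
      using D D' by (intro sum.mono_neutral_cong_right) (auto simp: d'_def)
    ultimately show ?thesis using D' by simp
  qed
  \<comment> \<open>One power of the binomial has to clear all components simultaneously.\<close>
  have "\<exists>n. \<forall>\<beta>\<in>D \<union> D'. d' \<beta> \<in> T y ({m. w' m = \<beta>} \<inter> {m. \<bar>m u\<bar> \<le> int n})"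
  proof -
    have "\<exists>n. \<forall>k\<ge>n. d' \<beta> \<in> T y ({m. w' m = \<beta>} \<inter> {m. \<bar>m u\<bar> \<le> int k})" for \<beta>
    proof -
      obtain n where n: "\<And>k. n \<le> k \<Longrightarrow> d' \<beta> \<in> T y (S \<inter> {m. w' m = \<beta>} \<inter> {m. \<bar>m u\<bar> \<le> int k})"
        using lspan_bounded[OF d'[of \<beta>], of "\<lambda>m. m u"] by metis
      show ?thesis by (intro exI[of _ n] allI impI lspan_mono[OF n]) auto
    qed
    then obtain n where n: "\<And>\<beta> k. n \<beta> \<le> k \<Longrightarrow> d' \<beta> \<in> T y ({m. w' m = \<beta>} \<inter> {m. \<bar>m u\<bar> \<le> int k})" by metis
    have "n \<beta> \<le> Max (n ` (D \<union> D'))" if "\<beta> \<in> D \<union> D'" for \<beta> using that D D' by auto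
    then show ?thesis using n by blast
  qed
  then obtain N where N: "\<And>\<beta>. \<beta> \<in> D \<union> D' \<Longrightarrow> d' \<beta> \<in> T y ({m. w' m = \<beta>} \<inter> {m. \<bar>m u\<bar> \<le> int N})" by blast
  have "(P x a b) ^ N * (c' \<alpha> - d' \<alpha>) = 0"
  proof (rule homogeneous_sum_zero[OF ind, where w=w and \<delta>="w (\<lambda>v. int N * a v)" and D="D \<union> D'"])
    show "(\<Sum>\<beta>\<in>D \<union> D'. (P x a b) ^ N * (c' \<beta> - d' \<beta>)) = 0"
      using sums by (simp add: sum_subtractf flip: sum_distrib_left)
    fix \<beta> assume "\<beta> \<in> D \<union> D'"
    then show "(P x a b) ^ N * (c' \<beta> - d' \<beta>) \<in> T x {m. w m = \<beta> + w (\<lambda>v. int N * a v)}"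
      unfolding right_diff_distrib by (intro lspan_diff px c' pl N)
  qed (use D D' \<alpha> in auto)
  then have "c' \<alpha> = d' \<alpha>" using nz(3) u by auto
  then show ?thesis using d'[of \<alpha>] \<alpha> by (simp add: c'_def)
qed

end

section \<open>Two consecutive exchanges\<close>

context laurent
begin

text \<open>The quotient by the second binomial is approximated by truncated geometric series; the
  grading \<open>l\<close>, for which the first binomial is homogeneous, cuts off the error term.\<close>

lemma coprime_binomials_aux:
  fixes l :: "('v \<Rightarrow> int) \<Rightarrow> int"
  assumes ind: "lindep K V x" and mem: "a \<in> lattice_on V" "b \<in> lattice_on V" "c \<in> lattice_on V" "d \<in> lattice_on V"
    and ab: "a \<noteq> b" and l: "\<And>m n. l (m + n) = l m + l n" "l a = l b" "l c < l d"
    and y: "P x a b * y \<in> T x UNIV" "P x c d * y \<in> T x UNIV"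
  shows "y \<in> T x UNIV"
proof -
  note nz = lindep_nonzero[OF ind]
  have l0: "l 0 = 0" using l(1)[of 0 0] by simp
  have ld: "l (m - n) = l m - l n" for m n using l(1)[of "m - n" n] by simp
  define t where "t = l d - l c"
  have t: "t > 0" using l by (simp add: t_def)
  \<comment> \<open>Up to the unit \<open>lmon V x c\<close>, the second binomial is
    \<open>1 + z\<close>, and \<open>z\<close> has positive degree \<open>t\<close>.\<close>
  define z where "z = lmon V x (d + (- c))"
  have z_in: "z \<in> T x {m. l m = t}"
    unfolding z_def using mem by (intro lmon_in) (auto simp: ld t_def lattice_on_def)
  have z_pow: "(- z) ^ k \<in> T x {m. l m = int k * t}" for k
  proof (induction k)
    case (Suc k)
    show ?case unfolding power_Suc
    proof (rule lspan_mult[OF nz lspan_uminus[OF z_in] Suc])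
      fix m n assume "m \<in> {m. l m = t}" "n \<in> {m. l m = int k * t}"
      then show "m + n \<in> {m. l m = int (Suc k) * t}" by (simp add: l(1) distrib_right)
    qed
  next
    case 0
    show ?case by (simp add: l0 one_in)
  qed
  have zU: "(- z) ^ k \<in> T x UNIV" for k using z_pow[of k] by (rule lspan_mono) auto
  have add: "lmon V x (m + n) = lmon V x m * lmon V x n" "lmon V x (- m) = inverse (lmon V x m)" for m n
    by (rule lmon_add lmon_minus; rule nz; assumption)+
  have c0: "lmon V x c \<noteq> 0" using lmon_nonzero[OF nz] .
  have zc: "P x c d = lmon V x c * (1 + z)"
    unfolding z_def add using c0 by (simp add: field_simps)
  have "lmon V x (- c) * (P x c d * y) \<in> T x UNIV"
    using mem by (intro lspan_mult_UNIV nz y lmon_in) (auto simp: lattice_on_def)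
  then have zy: "(1 + z) * y \<in> T x UNIV"
    unfolding zc add using c0 by (simp flip: mult.assoc)
  define h where "h = P x a b * y"
  obtain n where n: "h \<in> T x (UNIV \<inter> {m. \<bar>l m\<bar> \<le> int n})"
    using lspan_bounded[OF y(1), of l] unfolding h_def by blast
  \<comment> \<open>The degrees of \<open>h\<close> lie between \<open>- n\<close> and
    \<open>n\<close>, and \<open>t\<close> is at least 1, so \<open>(- z) ^ N * h\<close> lives
    strictly above degree \<open>n\<close>.\<close>
  define N where "N = 2 * n + 1"
  have "(\<Sum>k<N. (- z) ^ k) * ((1 + z) * y) \<in> T x UNIV"
    by (intro lspan_mult_UNIV nz zy lspan_sum zU)
  moreover have "(1 + z) * (\<Sum>k<N. (- z) ^ k) = 1 - (- z) ^ N"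
    using one_diff_power_eq[of "- z" N] by simp
  ultimately have yN: "(1 - (- z) ^ N) * y \<in> T x UNIV"
    by (metis mult.assoc mult.commute)
  \<comment> \<open>The first binomial has degree \<open>l a\<close>; the cut is placed so that it
    takes \<open>y1\<close> to degrees at most \<open>n\<close> and \<open>y2\<close> to degrees
    above \<open>n\<close>.\<close>
  obtain y1 y2 where y12: "(1 - (- z) ^ N) * y = y1 + y2"
    "y1 \<in> T x (UNIV \<inter> {m. l m \<le> int n - l a})" "y2 \<in> T x (UNIV - {m. l m \<le> int n - l a})"
    using lspan_split[OF yN] by blast
  have Pin: "P x a b \<in> T x {m. l m = l a}"
    using mem l by (intro lspan_add lmon_in) auto
  have 1: "P x a b * y1 \<in> T x {m. l m \<le> int n}"
    by (rule lspan_mult[OF nz Pin y12(2)]) (auto simp: l(1))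
  have 2: "P x a b * y2 \<in> T x {m. int n < l m}"
    by (rule lspan_mult[OF nz Pin y12(3)]) (auto simp: l(1))
  have 3: "(- z) ^ N * h \<in> T x {m. int n < l m}"
  proof (rule lspan_mult[OF nz z_pow n])
    fix m k assume "m \<in> {m. l m = int N * t}" "k \<in> UNIV \<inter> {m. \<bar>l m\<bar> \<le> int n}"
    then have "l m = int N * t" "\<bar>l k\<bar> \<le> int n" by auto
    moreover have "int N * 1 \<le> int N * t" using t by (intro mult_left_mono) auto
    moreover have "int N = 2 * int n + 1" by (simp add: N_def)
    ultimately have "int n < l m + l k" by linarith
    then show "m + k \<in> {m. int n < l m}" by (simp add: l(1))
  qed
  have "P x a b * y1 - h = - ((- z) ^ N * h + P x a b * y2)"
  proof -
    have "P x a b * y1 + P x a b * y2 = (1 - (- z) ^ N) * h"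
      unfolding distrib_left[symmetric] y12(1)[symmetric] h_def by (rule mult.left_commute)
    then have "P x a b * y1 + P x a b * y2 = h - (- z) ^ N * h" by (simp only: left_diff_distrib mult_1_left)
    then show ?thesis by (simp only: eq_diff_eq diff_eq_eq minus_add_distrib) (simp add: algebra_simps)
  qed
  also have "\<dots> \<in> T x {m. int n < l m}" using 2 3 by (intro lspan_uminus lspan_add)
  finally have 4: "P x a b * y1 - h \<in> T x {m. int n < l m}" .
  have 5: "P x a b * y1 - h \<in> T x {m. l m \<le> int n}"
    by (intro lspan_diff 1 lspan_mono[OF n]) auto
  have "P x a b * y1 - h = 0" by (rule lspan_disjoint[OF ind 4 5]) auto
  then have "y1 = y" using P_nonzero[OF ind mem(1,2) ab] by (simp add: h_def)
  then show ?thesis using y12(2) by (auto elim: lspan_mono)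
qed

lemma coprime_binomials:
  fixes l :: "('v \<Rightarrow> int) \<Rightarrow> int"
  assumes "lindep K V x" "a \<in> lattice_on V" "b \<in> lattice_on V" "c \<in> lattice_on V" "d \<in> lattice_on V"
    "a \<noteq> b" "\<And>m n. l (m + n) = l m + l n" "l a = l b" "l c \<noteq> l d"
    "P x a b * y \<in> T x UNIV" "P x c d * y \<in> T x UNIV"
  shows "y \<in> T x UNIV"
proof (cases "l c < l d")
  case True
  show ?thesis by (rule coprime_binomials_aux[OF assms(1-8) True assms(10,11)])
next
  case False
  then have lt: "l d < l c" using assms(9) by simp
  have "P x d c * y \<in> T x UNIV" using assms(11) by (simp only: add.commute)
  then show ?thesis by (rule coprime_binomials_aux[OF assms(1-3,5,4,6-8) lt assms(10)])
qed

text \<open>Exchanges at unlinked vertices commute, so \<open>z\<close> is adjacent to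
  \<open>xu\<close> and to \<open>xj\<close>. Each of these neighbours lets one of the two binomials
  clear the denominators of \<open>f\<close> in \<open>z\<close>, and \<open>l\<close> witnesses
  that the binomials are coprime.\<close>

lemma two_step_commuting:
  fixes l :: "('v \<Rightarrow> int) \<Rightarrow> int"
  assumes ind: "lindep K V x"
    and e: "exch V u a b x xu" "exch V j c d x xj" "exch V j c d xu z"
    and uj: "u \<noteq> j" "a j = 0" "b j = 0" "c u = 0" "d u = 0"
    and l: "\<And>m n. l (m + n) = l m + l n" "l a = l b" "l c \<noteq> l d"
    and f: "f \<in> T xu UNIV" "f \<in> T xj UNIV"
  shows "f \<in> T z UNIV"
proof -
  note nz = exch_nonzero[OF ind e(1)]
  have indu: "lindep K V xu" using lindep_exch[OF ind e(1)] .
  have indz: "lindep K V z" using lindep_exch[OF indu e(3)] .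
  note nzz = lindep_nonzero[OF indz]
  have m: "a \<in> lattice_on V" "b \<in> lattice_on V" "c \<in> lattice_on V" "d \<in> lattice_on V" "a \<noteq> b" "j \<in> V" "u \<in> V"
    using e by (auto simp: exch_def)
  have zj: "z j = xj j"
  proof -
    have "x j * z j = x j * xj j"
      using e(3) e(2) e(1) exch_lmon[OF e(1), of c] exch_lmon[OF e(1), of d] uj by (auto simp: exch_def)
    then show ?thesis using nz(1)[OF m(6)] by simp
  qed
  \<comment> \<open>The other path, through \<open>xj\<close>, ends in the same cluster.\<close>
  have e4: "exch V u a b xj z"
  proof -
    have "z v = xj v" if "v \<in> V - {u}" for v
      using that zj e by (cases "v = j") (auto simp: exch_def)
    moreover have "xj u * z u = x u * xu u" using e uj by (auto simp: exch_def)
    moreover have "P xj a b = P x a b" using exch_lmon[OF e(2), of a] exch_lmon[OF e(2), of b] uj by simp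
    ultimately show ?thesis using e(1) by (auto simp: exch_def)
  qed
  have indj: "lindep K V xj" using lindep_exch[OF ind e(2)] .
  obtain N where N: "f \<in> T xu (UNIV \<inter> {m. \<bar>m j\<bar> \<le> int N})"
    using lspan_bounded[OF f(1), of "\<lambda>m. m j"] by (metis order_refl)
  obtain M where M: "f \<in> T xj (UNIV \<inter> {m. \<bar>m u\<bar> \<le> int M})"
    using lspan_bounded[OF f(2), of "\<lambda>m. m u"] by (metis order_refl)
  show ?thesis
  proof (rule two_power[where p="P z a b" and q="P z c d"])
    show "P z a b ^ M * f \<in> T z UNIV"
      by (rule pull[OF nzz lindep_nonzero[OF indj] exch_sym[OF e4] M]) auto
    show "P z c d ^ N * f \<in> T z UNIV"
      by (rule pull[OF nzz lindep_nonzero[OF indu] exch_sym[OF e(3)] N]) auto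
    show "y \<in> T z UNIV" if "P z a b * y \<in> T z UNIV" "P z c d * y \<in> T z UNIV" for y
      using coprime_binomials[OF indz m(1-5) l that] .
  qed (use m in \<open>auto intro!: lspan_mult_UNIV nzz lspan_add lmon_in\<close>)
qed

lemma lmon_scale: "lmon V x (\<lambda>v. int n * m v) = lmon V x m ^ n"
  unfolding lmon_def prod_power_distrib
proof (rule prod.cong)
  show "x v powi (int n * m v) = (x v powi m v) ^ n" for v
    using power_int_mult[of "x v" "m v" "int n"] by (simp only: mult.commute power_int_of_nat)
qed simp

text \<open>Here \<open>g\<close> is the exponent of the common factor of both terms cancelled with the 2-cycles. With
  \<open>P = p + x j * w\<close> the first exchange binomial and \<open>G\<close> the monomial of \<open>g\<close>, the relation
  \<open>p ^ n * xj j = x u ^ n * G * z j - s * (P ^ n - p ^ n) / x j\<close> puts \<open>xj j\<close> into the Laurent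
  ring of \<open>z\<close>.\<close>

lemma two_step_linked:
  assumes ind: "lindep K V x"
    and e: "exch V u a b x xu" "exch V j c d x xj" "exch V j c' d' xu z"
    and uj: "u \<noteq> j" "a j = 0" "b j = int n" "0 < n" "c u = int n" "d u = 0"
    and g: "g \<in> lattice_on V" "g u = 0" "g j = 0"
      "c' + g = c(u := 0) + (\<lambda>v. int n * a v)" "d' + g = d(u := int n)"
    and f: "f \<in> T x UNIV" "f \<in> T xu UNIV" "f \<in> T xj UNIV"
  shows "f \<in> T z UNIV"
proof -
  let ?B = "T z UNIV"
  have indu: "lindep K V xu" using lindep_exch[OF ind e(1)] .
  have indj: "lindep K V xj" using lindep_exch[OF ind e(2)] .
  have indz: "lindep K V z" using lindep_exch[OF indu e(3)] .
  note nz = lindep_nonzero[OF ind] lindep_nonzero[OF indu] lindep_nonzero[OF indj] lindep_nonzero[OF indz]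
  have m: "a \<in> lattice_on V" "b \<in> lattice_on V" "c \<in> lattice_on V" "d \<in> lattice_on V" "a u = 0" "b u = 0"
    "c j = 0" "d j = 0" "j \<in> V" "u \<in> V"
    using e by (auto simp: exch_def)
  have add: "lmon V x (m + k) = lmon V x m * lmon V x k" "lmon V xu (m + k) = lmon V xu m * lmon V xu k"
    "lmon V x (- m) = inverse (lmon V x m)" for m k
    by (rule lmon_add lmon_minus; rule nz; assumption)+
  have val: "xu j = x j" "z u = xu u" "xj u = x u" "x u * xu u = P x a b" "x j * xj j = P x c d"
    "x j * z j = P xu c' d'"
    using e uj m by (auto simp: exch_def)
  have Bmult: "v * w \<in> ?B" if "v \<in> ?B" "w \<in> ?B" for v w using that by (intro lspan_mult_UNIV nz)
  have Bpow: "v ^ k \<in> ?B" if "v \<in> ?B" for v k using that by (intro lspan_power_UNIV nz)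
  \<comment> \<open>Nonnegative powers of \<open>xu j\<close> become nonpositive powers of
    \<open>z j\<close> without any denominator, hence \<open>N=0\<close>.\<close>
  have Bxu: "w \<in> ?B" if "w \<in> T xu {m. 0 \<le> m j}" for w
    using pull[OF nz(4,2) exch_sym[OF e(3)] that, where N=0 and S=UNIV] by auto
  have BR: "lmon V x k \<in> ?B" if "k \<in> lattice_on V" "k u = 0" "k j = 0" for k
  proof -
    have "lmon V z k = lmon V x k" using exch_lmon[OF e(3), of k] exch_lmon[OF e(1), of k] that by simp
    then show ?thesis using lmon_in[of k UNIV z] that(1) by simp
  qed
  \<comment> \<open>As \<open>n > 0\<close>, the term with exponent \<open>b\<close> contains
    \<open>x j\<close>, and \<open>w\<close> is the rest of it, still without negative powers of
    \<open>x j\<close>. The other term \<open>p\<close> avoids \<open>u\<close> and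
    \<open>j\<close>, so it is a unit of the Laurent ring of \<open>z\<close>.\<close>
  define p w where "p = lmon V x a" and "w = lmon V x (b(j := int n - 1))"
  have b: "lmon V x b = x j * w"
  proof -
    have "b = (\<lambda>v. if v = j then 1 else 0) + b(j := int n - 1)" using uj by auto
    then have "lmon V x b = lmon V x (\<lambda>v. if v = j then 1 else 0) * w"
      unfolding w_def by (metis add(1))
    then show ?thesis using lmon_single[OF m(9), of x 1] by simp
  qed
  have Pp: "P x a b = p + x j * w" by (simp add: p_def b)
  have p_in: "p \<in> ?B" "p \<noteq> 0" unfolding p_def using m uj by (auto intro!: BR lmon_nonzero nz)
  have pinv: "inverse p \<in> ?B"
  proof -
    have "inverse p = lmon V x (- a)" unfolding p_def using add(3) by simp
    then show ?thesis using m uj BR[of "- a"] by (auto simp: lattice_on_def)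
  qed
  have w_in: "w \<in> ?B"
  proof (rule Bxu)
    have "w = lmon V xu (b(j := int n - 1))" unfolding w_def using exch_lmon[OF e(1), of "b(j := int n - 1)"] m uj by simp
    then show "w \<in> T xu {m. 0 \<le> m j}" using m uj by (auto intro!: lmon_in simp: lattice_on_def)
  qed
  have xj_in: "x j \<in> ?B"
    using Bxu[OF var_power_in[of j 1 _ xu]] m val by auto
  have PB: "P x a b \<in> ?B" unfolding Pp by (intro lspan_add Bmult p_in w_in xj_in)
  have zu_in: "xu u \<in> ?B" "inverse (xu u) \<in> ?B"
    using var_power_in[of u 1 UNIV z] var_power_in[of u "-1" UNIV z] m val by auto
  have xu_in: "x u \<in> ?B"
  proof -
    have "x u = P x a b * inverse (xu u)" using val(4) nz(2)[OF m(10)] by (simp add: field_simps)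
    then show ?thesis using Bmult[OF PB zu_in(2)] by simp
  qed
  have xjj_in: "xj j \<in> ?B"
  proof -
    \<comment> \<open>The cofactor of \<open>P x a b - p = x j * w\<close> in the difference of
      \<open>n\<close>-th powers.\<close>
    define S where "S = (\<Sum>i<n. p ^ (n - Suc i) * P x a b ^ i)"
    have S: "P x a b ^ n - p ^ n = x j * w * S"
      using power_diff_sumr2[of "P x a b" n p] unfolding S_def by (simp add: Pp)
    have S_in: "S \<in> ?B" unfolding S_def by (intro lspan_sum Bmult Bpow p_in PB)
    define G r s where "G = lmon V x g" and "r = lmon V x (c(u := 0))" and "s = lmon V x d"
    have G_in: "G \<in> ?B" and s_in: "s \<in> ?B" unfolding G_def s_def using g m uj by (auto intro!: BR)
    have zj_in: "z j \<in> ?B" using var_power_in[of j 1 UNIV z] m by auto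
    have 1: "x j * xj j = x u ^ n * r + s"
      unfolding val(5) lmon_upd[OF m(10), of x c] by (simp add: r_def s_def uj)
    have xuG: "lmon V xu g = G" unfolding G_def using exch_lmon[OF e(1), of g] g(2) by simp
    have "G * lmon V xu c' = lmon V xu (c(u := 0) + (\<lambda>v. int n * a v))"
      unfolding xuG[symmetric] g(4)[symmetric] by (simp add: add(2) mult.commute)
    also have "\<dots> = r * p ^ n"
      using add(2)[of "c(u := 0)" "\<lambda>v. int n * a v"] lmon_scale[of xu n a]
        exch_lmon[OF e(1), of "c(u := 0)"] exch_lmon[OF e(1), of a] m by (simp add: r_def p_def)
    finally have 2: "G * lmon V xu c' = r * p ^ n" .
    have "G * lmon V xu d' = lmon V xu (d(u := int n))"
      unfolding xuG[symmetric] g(5)[symmetric] by (simp add: add(2) mult.commute)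
    also have "\<dots> = xu u ^ n * s"
      unfolding lmon_upd[OF m(10), of xu "d(u := int n)"] s_def
      using exch_lmon[OF e(1), of d] uj by (simp add: fun_upd_idem)
    finally have 3: "G * lmon V xu d' = xu u ^ n * s" .
    \<comment> \<open>The relation for \<open>xj j\<close> is checked after multiplication by
      \<open>x j\<close>, which brings in both exchange relations at \<open>j\<close>; the power of
      \<open>x u * xu u\<close> is that of the first binomial.\<close>
    have "x j * (x u ^ n * G * z j) = x u ^ n * (G * (x j * z j))" by (simp add: mult_ac)
    also have "\<dots> = x u ^ n * (r * p ^ n) + (x u * xu u) ^ n * s"
      unfolding val(6) distrib_left 2 3 by (simp add: power_mult_distrib mult_ac)
    also have "(x u * xu u) ^ n = p ^ n + x j * w * S" using S val(4) by (simp add: diff_eq_eq add.commute)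
    also have "x u ^ n * (r * p ^ n) + (p ^ n + x j * w * S) * s = p ^ n * (x u ^ n * r + s) + x j * (w * S * s)"
      by (simp add: algebra_simps)
    also have "\<dots> = x j * (p ^ n * xj j + w * S * s)" unfolding 1[symmetric] by (simp add: algebra_simps)
    finally have "x u ^ n * G * z j = p ^ n * xj j + w * S * s"
      using nz(1)[OF m(9)] by simp
    then have "xj j = inverse p ^ n * (x u ^ n * G * z j - w * S * s)"
      using p_in(2) by (simp add: field_simps)
    also have "\<dots> \<in> ?B" by (intro Bmult Bpow lspan_diff pinv xu_in G_in zj_in w_in S_in s_in)
    finally show ?thesis .
  qed
  \<comment> \<open>The Laurent ring of \<open>z\<close> localized at the first binomial. It
    contains the inverse of \<open>x u\<close>, because \<open>x u * xu u\<close> is that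
    binomial.\<close>
  define D where "D = {y. \<exists>M. P x a b ^ M * y \<in> ?B}"
  have DB: "y \<in> D" if "y \<in> ?B" for y unfolding D_def using that by (intro CollectI exI[of _ 0]) simp
  have Dmult: "y * y' \<in> D" if yy: "y \<in> D" "y' \<in> D" for y y'
  proof -
    obtain M M' where MM: "P x a b ^ M * y \<in> ?B" "P x a b ^ M' * y' \<in> ?B" using yy by (auto simp: D_def)
    have "P x a b ^ (M + M') * (y * y') = (P x a b ^ M * y) * (P x a b ^ M' * y')" by (simp add: power_add mult_ac)
    then have "P x a b ^ (M + M') * (y * y') \<in> ?B" using Bmult[OF MM] by metis
    then show ?thesis unfolding D_def by blast
  qed
  have Dadd: "y + y' \<in> D" if yy: "y \<in> D" "y' \<in> D" for y y'
  proof -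
    obtain M M' where MM: "P x a b ^ M * y \<in> ?B" "P x a b ^ M' * y' \<in> ?B" using yy by (auto simp: D_def)
    have "P x a b ^ (M + M') * (y + y') = P x a b ^ M' * (P x a b ^ M * y) + P x a b ^ M * (P x a b ^ M' * y')"
      by (simp add: power_add algebra_simps)
    also have "\<dots> \<in> ?B" by (intro lspan_add Bmult Bpow PB MM)
    finally show ?thesis unfolding D_def by blast
  qed
  have Dpow: "y ^ k \<in> D" if "y \<in> D" for y k
  proof (induction k)
    case (Suc k)
    show ?case unfolding power_Suc by (rule Dmult[OF that Suc])
  qed (simp add: DB one_in)
  have "P x a b ^ 1 * inverse (x u) = xu u" using val(4) nz(1)[OF m(10)] by (simp add: field_simps)
  then have xui: "inverse (x u) \<in> D" unfolding D_def using zu_in(1) by (intro CollectI exI[of _ 1]) simp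
  have xuD: "x u powi k \<in> D" for k
    using Dpow[OF DB[OF xu_in], of "nat k"] Dpow[OF xui, of "nat (- k)"] by (auto simp: power_int_def)
  \<comment> \<open>Neither part has \<open>x j\<close> as a denominator: \<open>y\<close> is
    polynomial in \<open>xj j\<close>, and \<open>h\<close> has positive powers of
    \<open>x j\<close>. So both lie in the localization.\<close>
  obtain y h where yh: "f = y + h" "y \<in> T xj (UNIV \<inter> {m. 0 \<le> m j})" "h \<in> T x (UNIV \<inter> {m. 0 < m j})"
    using onestep[OF ind e(2) f(1,3)] by metis
  have "y \<in> D"
    using yh(2)
  proof (induction rule: lspan.induct)
    case zero
    show ?case by (intro DB lspan.zero)
  next
    case (step k q y)
    define q' where "q' = q(u := 0, j := 0)"
    have "lmon V xj q = x u powi q u * (xj j powi q j * lmon V xj q')"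
      unfolding lmon_upd[OF m(10), of xj q] lmon_upd[OF m(9), of xj "q(u := 0)"] val q'_def using uj by simp
    also have "lmon V xj q' = lmon V x q'" using exch_lmon[OF e(2), of q'] by (simp add: q'_def)
    also have "xj j powi q j = xj j ^ nat (q j)" using step by (simp add: power_int_def)
    also have "x u powi q u * (xj j ^ nat (q j) * lmon V x q') \<in> D"
      using step by (intro Dmult xuD Dpow DB BR xjj_in) (auto simp: q'_def lattice_on_def)
    finally have "lmon V xj q \<in> D" .
    moreover have "k \<in> D" using step by (intro DB const_in) auto
    ultimately show ?case using Dadd[OF Dmult] step by blast
  qed
  moreover have "h \<in> D"
  proof -
    obtain M where M: "h \<in> T x (UNIV \<inter> {m. 0 < m j} \<inter> {m. \<bar>m u\<bar> \<le> int M})"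
      using lspan_bounded[OF yh(3), of "\<lambda>m. m u"] by (metis order_refl)
    have "P xu a b ^ M * h \<in> T xu {m. 0 \<le> m j}"
      by (rule pull[OF nz(2,1) exch_sym[OF e(1)] M]) (use uj in auto)
    then show ?thesis unfolding D_def exch_P[OF e(1)] using Bxu by blast
  qed
  ultimately obtain M where M: "P x a b ^ M * f \<in> ?B" using Dadd yh(1) unfolding D_def by blast
  \<comment> \<open>The second denominator: a power of \<open>x j\<close> clears the negative
    exponents at \<open>j\<close> of the expansion in \<open>xu\<close>.\<close>
  obtain N where N: "f \<in> T xu (UNIV \<inter> {m. \<bar>m j\<bar> \<le> int N})"
    using lspan_bounded[OF f(2), of "\<lambda>m. m j"] by (metis order_refl)
  have "xu j powi int N * f \<in> T xu {m. 0 \<le> m j}"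
    by (rule lspan_mult[OF nz(2) var_power_in[of j "int N" "{m. m j = int N}"] N]) (use m in auto)
  then have N': "x j ^ N * f \<in> ?B" using Bxu val by simp
  show ?thesis
  proof (rule two_power[OF _ _ _ M N'])
    \<comment> \<open>Modulo \<open>x j\<close> the binomial is the unit \<open>p\<close>, so the
      two denominators form a regular pair.\<close>
    fix y assume y: "P x a b * y \<in> ?B" "x j * y \<in> ?B"
    have "p * y = P x a b * y - w * (x j * y)" unfolding Pp by (simp add: algebra_simps)
    also have "\<dots> \<in> ?B" by (intro lspan_diff Bmult y w_in)
    finally have "inverse p * (p * y) \<in> ?B" using Bmult pinv by blast
    then show "y \<in> ?B" using p_in(2) by (simp flip: mult.assoc)
  qed (auto intro: Bmult PB xj_in)
qed

end

section \<open>Laurent rings of seeds and the rank of the exchange matrix\<close>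

lemma adjoin_prod: "is_subfield K \<Longrightarrow> (\<And>i. i \<in> I \<Longrightarrow> f i \<in> adjoin K S) \<Longrightarrow> prod f I \<in> adjoin K S"
  by (induction I rule: infinite_finite_induct) (auto intro: adjoin.intros is_subfieldD)

lemma adjoin_power: "is_subfield K \<Longrightarrow> f \<in> adjoin K S \<Longrightarrow> f ^ n \<in> adjoin K S"
  using adjoin_prod[of K "{..<n}" "\<lambda>_. f" S] by simp

lemma adjoin_subset:
  assumes "\<And>s. s \<in> S \<Longrightarrow> s \<in> adjoin K S'" "f \<in> adjoin K S"
  shows "f \<in> adjoin K S'"
  using assms(2) by (induction rule: adjoin.induct) (auto intro: adjoin.intros assms(1))

lemma frozens_subset: "frozens \<Delta> \<subseteq> verts \<Delta>"
  by (auto simp: frozens_def)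

text \<open>Products of generators are monomials with inverses at mutable vertices only.
  Independence supplies nonzero variables, without which exponents would not add.\<close>

lemma laurent_ring_eq_lspan:
  assumes K: "is_subfield K" and q: "is_ice_quiver \<Delta>" and ind: "lindep K (verts \<Delta>) x"
  shows "laurent_ring K \<Delta> x = lspan K (verts \<Delta>) x {m. \<forall>p\<in>frozens \<Delta>. 0 \<le> m p}" (is "_ = ?R")
proof -
  let ?V = "verts \<Delta>"
  interpret laurent K ?V using K q by unfold_locales (auto simp: is_ice_quiver_def)
  note nz = lindep_nonzero[OF ind]
  have mut: "mutables \<Delta> \<subseteq> ?V" using q by (simp add: is_ice_quiver_def)
  show ?thesis
  proof (intro subset_antisym subsetI)
    fix f assume "f \<in> laurent_ring K \<Delta> x"
    then show "f \<in> ?R"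
      unfolding laurent_ring_def
    proof (induction rule: adjoin.induct)
      case (gen s)
      then consider v where "v \<in> ?V" "s = x v powi 1" | v where "v \<in> mutables \<Delta>" "s = x v powi (-1)" by auto
      then show ?case
      proof cases
        case 1
        show ?thesis unfolding 1(2) by (rule var_power_in[OF 1(1)]) simp
      next
        case 2
        then have "v \<in> ?V" "v \<notin> frozens \<Delta>" using mut by (auto simp: frozens_def)
        then show ?thesis unfolding 2(2) by (intro var_power_in) auto
      qed
    next
      case (mult a b)
      show ?case by (rule lspan_mult[OF nz mult.IH]) auto
    qed (auto intro: const_in lspan_add)
  next
    fix f assume "f \<in> ?R"
    then show "f \<in> laurent_ring K \<Delta> x"
      unfolding laurent_ring_def
    proof (induction rule: lspan.induct)
      case zero
      show ?case using K by (intro adjoin.base is_subfieldD)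
    next
      case (step c m f)
      have "x v powi m v \<in> adjoin K (x ` ?V \<union> (\<lambda>u. inverse (x u)) ` mutables \<Delta>)" if "v \<in> ?V" for v
      proof (cases "0 \<le> m v")
        case True
        have "x v \<in> adjoin K (x ` ?V \<union> (\<lambda>u. inverse (x u)) ` mutables \<Delta>)"
          using that by (intro adjoin.gen) blast
        then show ?thesis using True by (simp add: power_int_def adjoin_power[OF K])
      next
        case False
        then have "v \<in> mutables \<Delta>" using step that by (auto simp: frozens_def)
        then have "inverse (x v) \<in> adjoin K (x ` ?V \<union> (\<lambda>u. inverse (x u)) ` mutables \<Delta>)"
          by (intro adjoin.gen) blast
        then show ?thesis using False by (simp add: power_int_def adjoin_power[OF K] flip: power_inverse)
      qed
      then have "lmon ?V x m \<in> adjoin K (x ` ?V \<union> (\<lambda>u. inverse (x u)) ` mutables \<Delta>)"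
        unfolding lmon_def by (intro adjoin_prod K)
      then show ?case using step by (auto intro: adjoin.intros)
    qed
  qed
qed

text \<open>A relation between Laurent monomials becomes polynomial after multiplication by a
  monomial with large exponents.\<close>

lemma lindep_of_alg_independent:
  fixes x :: "'v \<Rightarrow> 'f::field"
  assumes K: "is_subfield K" and V: "finite V" and alg: "alg_independent K V x"
  shows "lindep K V x"
  unfolding lindep_def
proof (intro allI impI)
  interpret laurent K V using K V by unfold_locales
  fix A :: "('v \<Rightarrow> int) set" and c
  assume A: "finite A" "A \<subseteq> lattice_on V" "\<forall>m\<in>A. c m \<in> K" "(\<Sum>m\<in>A. c m * lmon V x m) = 0"
  have nz: "x v \<noteq> 0" if "v \<in> V" for v
  proof
    assume "x v = 0"
    \<comment> \<open>If \<open>x v\<close> were zero, the single variable \<open>v\<close> would be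
      a polynomial relation.\<close>
    define q where "q = (Poly_Mapping.single v 1 :: 'v \<Rightarrow>\<^sub>0 nat)"
    define Q where "Q = Poly_Mapping.single q (1::'f)"
    have "poly_eval x Q = 0" using \<open>x v = 0\<close> by (simp add: poly_eval_def Q_def q_def)
    moreover have "\<forall>m. Poly_Mapping.lookup Q m \<in> K" using is_subfieldD[OF K] by (auto simp: Q_def lookup_single when_def)
    moreover have "\<forall>m\<in>Poly_Mapping.keys Q. Poly_Mapping.keys m \<subseteq> V" using that by (auto simp: Q_def q_def)
    ultimately have "Q = 0" using alg by (simp add: alg_independent_def)
    moreover have "Poly_Mapping.lookup Q q = 1" by (simp add: Q_def)
    ultimately show False by simp
  qed
  define B where "B = (\<lambda>(m, v). \<bar>m v\<bar>) ` (A \<times> V)"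
  define N where "N = nat (Max B)"
  have N: "\<bar>m v\<bar> \<le> int N" if "m \<in> A" "v \<in> V" for m v
  proof -
    have "\<bar>m v\<bar> \<le> Max B" unfolding B_def using A(1) V that by (intro Max_ge) auto
    then show ?thesis unfolding N_def by linarith
  qed
  \<comment> \<open>\<open>N\<close> bounds all exponents, so the shift by \<open>s\<close> makes
    them nonnegative and truncation by \<open>nat\<close> identifies no two of them.\<close>
  define s where "s = (\<lambda>v. if v \<in> V then int N else 0)"
  define pm where "pm m = Abs_poly_mapping (\<lambda>v. nat (m v + s v) when v \<in> V)" for m
  have pm: "Poly_Mapping.lookup (pm m) v = (if v \<in> V then nat (m v + s v) else 0)" for m v
    unfolding pm_def using V by (subst Abs_poly_mapping_inverse) (auto simp: when_def intro: finite_subset)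
  have keys_pm: "Poly_Mapping.keys (pm m) \<subseteq> V" for m using pm by (auto simp: in_keys_iff split: if_splits)
  have inj: "inj_on pm A"
  proof (rule inj_onI, rule ext)
    fix m n v assume mn: "m \<in> A" "n \<in> A" "pm m = pm n"
    show "m v = n v"
    proof (cases "v \<in> V")
      case True
      then have "nat (m v + int N) = nat (n v + int N)" using pm[of m v] pm[of n v] mn(3) by (simp add: s_def)
      then show ?thesis using N[OF mn(1) True] N[OF mn(2) True] by linarith
    next
      case False
      moreover have "m \<in> lattice_on V" "n \<in> lattice_on V" using mn(1,2) A(2) by blast+
      ultimately show ?thesis by (simp add: lattice_on_def)
    qed
  qed
  define Q where "Q = (\<Sum>m\<in>A. Poly_Mapping.single (pm m) (c m))"
  have Q: "Poly_Mapping.lookup Q k = (\<Sum>m\<in>A. if pm m = k then c m else 0)" for k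
    unfolding Q_def lookup_sum by (intro sum.cong) (auto simp: lookup_single when_def)
  have Qpm: "Poly_Mapping.lookup Q (pm n) = c n" if "n \<in> A" for n
  proof -
    have "(\<Sum>m\<in>A. if pm m = pm n then c m else 0) = (\<Sum>m\<in>A. if m = n then c m else 0)"
      using inj that by (intro sum.cong) (auto simp: inj_on_def)
    then show ?thesis using A(1) that by (simp add: Q)
  qed
  have keysQ: "Poly_Mapping.keys Q \<subseteq> pm ` A"
  proof
    fix k assume "k \<in> Poly_Mapping.keys Q"
    then have "(\<Sum>m\<in>A. if pm m = k then c m else 0) \<noteq> 0" by (simp add: in_keys_iff Q)
    moreover have "(\<Sum>m\<in>A. if pm m = k then c m else 0) = 0" if "k \<notin> pm ` A"
      using that by (intro sum.neutral) auto
    ultimately show "k \<in> pm ` A" by blast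
  qed
  have mon: "(\<Prod>v\<in>Poly_Mapping.keys (pm m). x v ^ Poly_Mapping.lookup (pm m) v) = lmon V x s * lmon V x m"
    if "m \<in> A" for m
  proof -
    have "(\<Prod>v\<in>Poly_Mapping.keys (pm m). x v ^ Poly_Mapping.lookup (pm m) v) =
      (\<Prod>v\<in>V. x v ^ Poly_Mapping.lookup (pm m) v)"
      using V keys_pm by (intro prod.mono_neutral_left) (auto simp: in_keys_iff)
    also have "\<dots> = (\<Prod>v\<in>V. x v powi s v * x v powi m v)"
    proof (rule prod.cong)
      fix v assume v: "v \<in> V"
      have "x v ^ Poly_Mapping.lookup (pm m) v = x v powi (s v + m v)"
        using v N[OF that v] by (simp add: pm s_def power_int_def add.commute)
      also have "\<dots> = x v powi s v * x v powi m v" using nz[OF v] by (simp add: power_int_add)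
      finally show "x v ^ Poly_Mapping.lookup (pm m) v = x v powi s v * x v powi m v" .
    qed simp
    finally show ?thesis by (simp add: lmon_def prod.distrib)
  qed
  have "poly_eval x Q = (\<Sum>k\<in>pm ` A. Poly_Mapping.lookup Q k * (\<Prod>v\<in>Poly_Mapping.keys k. x v ^ Poly_Mapping.lookup k v))"
    unfolding poly_eval_def using A(1) keysQ by (intro sum.mono_neutral_left) (auto simp: in_keys_iff)
  also have "\<dots> = (\<Sum>m\<in>A. lmon V x s * (c m * lmon V x m))"
    unfolding sum.reindex[OF inj] by (intro sum.cong) (simp_all add: Qpm mon mult_ac)
  also have "\<dots> = 0" using A(4) by (simp flip: sum_distrib_left)
  finally have "poly_eval x Q = 0" .
  moreover have "\<forall>m. Poly_Mapping.lookup Q m \<in> K"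
    unfolding Q using A(3) is_subfieldD(1)[OF K] by (auto intro!: sum_in_subfield[OF K])
  moreover have "\<forall>m\<in>Poly_Mapping.keys Q. Poly_Mapping.keys m \<subseteq> V" using keysQ keys_pm by blast
  ultimately have "Q = 0" using alg by (simp add: alg_independent_def)
  then show "\<forall>m\<in>A. c m = 0" using Qpm by auto
qed

section \<open>Exponents of the exchange relations and independence of the rows\<close>

definition in_arrows :: "'v ice_quiver \<Rightarrow> 'v \<Rightarrow> 'v \<Rightarrow> int" where "in_arrows \<Delta> u v = int (arr \<Delta> v u)"
definition out_arrows :: "'v ice_quiver \<Rightarrow> 'v \<Rightarrow> 'v \<Rightarrow> int" where "out_arrows \<Delta> u v = int (arr \<Delta> u v)"

definition rows_indep :: "'v ice_quiver \<Rightarrow> bool" where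
  "rows_indep \<Delta> \<longleftrightarrow> (\<forall>c :: 'v \<Rightarrow> rat. (\<forall>v. (\<Sum>u\<in>mutables \<Delta>. c u * of_int (b_entry \<Delta> u v)) = 0) \<longrightarrow>
     (\<forall>u\<in>mutables \<Delta>. c u = 0))"

lemma is_ice_quiverD:
  assumes "is_ice_quiver \<Delta>"
  shows "finite (verts \<Delta>)" "finite (mutables \<Delta>)" "mutables \<Delta> \<subseteq> verts \<Delta>" "arr \<Delta> u u = 0"
    "arr \<Delta> u v = 0 \<or> arr \<Delta> v u = 0" "u \<notin> verts \<Delta> \<or> v \<notin> verts \<Delta> \<Longrightarrow> arr \<Delta> u v = 0"
  using assms unfolding is_ice_quiver_def by (auto intro: finite_subset)

lemma mutate_quiver_simps [simp]:
  "verts (mutate_quiver u \<Delta>) = verts \<Delta>" "mutables (mutate_quiver u \<Delta>) = mutables \<Delta>"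
  "frozens (mutate_quiver u \<Delta>) = frozens \<Delta>"
  by (simp_all add: mutate_quiver_def frozens_def)

lemma sum_fun_apply: "(\<Sum>i\<in>I. f i) v = (\<Sum>i\<in>I. f i v)"
  by (induction I rule: infinite_finite_induct) auto

text \<open>\<open>b_rank\<close> is computed from the set of rows, where equal rows count once.
  Comparing the size of a maximal independent subset with the number of mutable vertices shows that
  the rows are distinct and that all of them belong to it.\<close>

lemma rows_indep_of_full_rank:
  fixes \<Delta> :: "'v ice_quiver"
  assumes q: "is_ice_quiver \<Delta>" and fr: "full_rank \<Delta>"
  shows "rows_indep \<Delta>"
  unfolding rows_indep_def
proof (intro allI impI)
  interpret vs: vector_space "\<lambda>(c::rat) (f::'v \<Rightarrow> rat) v. c * f v" by (rule vector_space_rat_fun)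
  define f where "f u v = rat_of_int (b_entry \<Delta> u v)" for u v
  let ?M = "mutables \<Delta>"
  have fin: "finite ?M" using is_ice_quiverD[OF q] by simp
  have dim: "vs.dim (f ` ?M) = card ?M" using fr by (simp add: full_rank_def b_rank_def f_def[abs_def])
  obtain B where B: "B \<subseteq> f ` ?M" "vs.independent B" "f ` ?M \<subseteq> vs.span B"
    using vs.maximal_independent_subset by blast
  have "card B = card ?M" using vs.basis_card_eq_dim[OF B(1,3,2)] dim by simp
  moreover have "card B \<le> card (f ` ?M)" "card (f ` ?M) \<le> card ?M" using B(1) fin by (auto intro: card_mono card_image_le)
  ultimately have cards: "card (f ` ?M) = card ?M" "B = f ` ?M"
    using card_subset_eq[of "f ` ?M" B] B(1) fin by simp_all
  have inj: "inj_on f ?M" using cards(1) fin by (rule eq_card_imp_inj_on[rotated])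
  fix c :: "'v \<Rightarrow> rat" assume c: "\<forall>v. (\<Sum>u\<in>?M. c u * of_int (b_entry \<Delta> u v)) = 0"
  define g where "g = the_inv_into ?M f"
  have g: "g (f u) = u" if "u \<in> ?M" for u unfolding g_def using the_inv_into_f_f[OF inj that] .
  have "(\<Sum>w\<in>f ` ?M. (\<lambda>v. c (g w) * w v)) = (\<lambda>v. 0)"
    unfolding sum.reindex[OF inj] using c g by (auto simp: fun_eq_iff f_def sum_fun_apply)
  then have "(\<Sum>w\<in>f ` ?M. (\<lambda>v. c (g w) * w v)) = 0" by (simp add: zero_fun_def)
  then have "c (g (f u)) = 0" if "u \<in> ?M" for u
    using vs.independentD[OF B(2), of "f ` ?M" "\<lambda>w. c (g w)" "f u"] fin that cards by auto
  then show "\<forall>u\<in>?M. c u = 0" using g by auto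
qed

text \<open>Cancelling 2-cycles leaves signed counts unchanged, and the exception for frozen pairs
  does not apply as \<open>i\<close> is mutable. Off column \<open>u\<close>, row \<open>i\<close>
  receives a multiple of row \<open>u\<close> and multiples of its own entry in column
  \<open>u\<close>.\<close>

lemma b_entry_mutate:
  assumes "is_ice_quiver \<Delta>" "i \<in> mutables \<Delta>" "i \<noteq> u"
  shows "b_entry (mutate_quiver u \<Delta>) i v =
    (if v = u then - b_entry \<Delta> i v else b_entry \<Delta> i v + int (arr \<Delta> i u) * b_entry \<Delta> u v + b_entry \<Delta> i u * int (arr \<Delta> v u))"
proof -
  define A B where "A = arr \<Delta> i v + arr \<Delta> i u * arr \<Delta> u v" and "B = arr \<Delta> v i + arr \<Delta> v u * arr \<Delta> u i"
  have "arr (mutate_quiver u \<Delta>) i v = A - B" "arr (mutate_quiver u \<Delta>) v i = B - A" if "v \<noteq> u"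
    using assms that by (simp_all add: mutate_quiver_def A_def B_def)
  moreover have "int (A - B) - int (B - A) = int A - int B" by simp
  ultimately have "b_entry (mutate_quiver u \<Delta>) i v = int A - int B" if "v \<noteq> u"
    using that unfolding b_entry_def by simp
  then show ?thesis
    using assms(3) by (auto simp: b_entry_def A_def B_def algebra_simps) (auto simp: mutate_quiver_def)
qed

text \<open>A dependence \<open>c\<close> of the new rows gives a dependence \<open>d\<close> of the
  old ones: by column \<open>u\<close> the column operation contributes nothing, and the row
  operation collects \<open>E\<close> into the coefficient of row \<open>u\<close>, whose sign is
  reversed.\<close>

lemma rows_indep_mutate:
  assumes q: "is_ice_quiver \<Delta>" and u: "u \<in> mutables \<Delta>" and ri: "rows_indep \<Delta>"
  shows "rows_indep (mutate_quiver u \<Delta>)"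
  unfolding rows_indep_def mutate_quiver_simps
proof (intro allI impI)
  let ?M = "mutables \<Delta>" and ?D = "mutate_quiver u \<Delta>"
  have fin: "finite ?M" using is_ice_quiverD[OF q] by simp
  fix c :: "'a \<Rightarrow> rat" assume c: "\<forall>v. (\<Sum>i\<in>?M. c i * of_int (b_entry ?D i v)) = 0"
  define C where "C = ?M - {u}"
  define E where "E = (\<Sum>i\<in>C. c i * of_nat (arr \<Delta> i u))"
  have split: "(\<Sum>i\<in>?M. h i) = h u + (\<Sum>i\<in>C. h i)" for h :: "'a \<Rightarrow> rat"
    unfolding C_def using fin u by (simp add: sum.remove)
  have bu: "b_entry ?D u v = - b_entry \<Delta> u v" for v by (simp add: b_entry_def mutate_quiver_def)
  have uu: "b_entry \<Delta> u u = 0" by (simp add: b_entry_def)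
  have z: "(\<Sum>i\<in>C. c i * of_int (b_entry \<Delta> i u)) = 0"
  proof -
    have "(\<Sum>i\<in>C. c i * of_int (b_entry ?D i u)) = 0" using c[rule_format, of u] by (simp add: split bu uu)
    moreover have "(\<Sum>i\<in>C. c i * of_int (b_entry ?D i u)) = (\<Sum>i\<in>C. - (c i * of_int (b_entry \<Delta> i u)))"
      using q by (intro sum.cong) (auto simp: C_def b_entry_mutate)
    ultimately show ?thesis by (simp add: sum_negf)
  qed
  define d where "d i = (if i = u then E - c u else c i)" for i
  have "(\<Sum>i\<in>?M. d i * of_int (b_entry \<Delta> i v)) = 0" for v
  proof -
    have s: "(\<Sum>i\<in>?M. d i * of_int (b_entry \<Delta> i v)) = (E - c u) * of_int (b_entry \<Delta> u v) + (\<Sum>i\<in>C. c i * of_int (b_entry \<Delta> i v))"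
      unfolding split by (simp add: d_def) (auto intro!: sum.cong simp: C_def)
    show ?thesis
    proof (cases "v = u")
      case True
      then show ?thesis using s z uu by simp
    next
      case False
      have "0 = (\<Sum>i\<in>?M. c i * of_int (b_entry ?D i v))" using c by simp
      also have "\<dots> = - c u * of_int (b_entry \<Delta> u v) + (\<Sum>i\<in>C. c i * of_int (b_entry ?D i v))"
        by (simp add: split bu)
      also have "(\<Sum>i\<in>C. c i * of_int (b_entry ?D i v)) =
        (\<Sum>i\<in>C. c i * of_int (b_entry \<Delta> i v) + of_int (b_entry \<Delta> u v) * (c i * of_nat (arr \<Delta> i u)) +
          of_nat (arr \<Delta> v u) * (c i * of_int (b_entry \<Delta> i u)))"
        using q False by (intro sum.cong) (auto simp: C_def b_entry_mutate algebra_simps)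
      also have "\<dots> = (\<Sum>i\<in>C. c i * of_int (b_entry \<Delta> i v)) + of_int (b_entry \<Delta> u v) * E"
        using z by (simp add: sum.distrib E_def flip: sum_distrib_left)
      finally show ?thesis unfolding s by (simp add: algebra_simps)
    qed
  qed
  then have d0: "\<forall>i\<in>?M. d i = 0" using ri unfolding rows_indep_def by blast
  then have cC: "c i = 0" if "i \<in> C" for i using that by (auto simp: C_def d_def)
  then have "E = 0" by (simp add: E_def)
  then show "\<forall>i\<in>?M. c i = 0" using d0 cC u by (auto simp: d_def C_def split: if_splits)
qed

lemma rows_indep_nonzero:
  assumes q: "is_ice_quiver \<Delta>" and u: "u \<in> mutables \<Delta>" and ri: "rows_indep \<Delta>"
  shows "in_arrows \<Delta> u \<noteq> out_arrows \<Delta> u"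
proof
  assume "in_arrows \<Delta> u = out_arrows \<Delta> u"
  then have b: "b_entry \<Delta> u v = 0" for v by (metis b_entry_def diff_self in_arrows_def out_arrows_def)
  have "(\<Sum>i\<in>mutables \<Delta>. (if i = u then 1 else 0) * rat_of_int (b_entry \<Delta> i v)) = 0" for v
    using b by (intro sum.neutral) auto
  then show False using ri u unfolding rows_indep_def by fastforce
qed

text \<open>\<open>l\<close> pairs an exponent with row \<open>u\<close> as a 2 by 2 minor in the
  columns \<open>i\<close> and \<open>v\<close>. It kills row \<open>u\<close> and takes row
  \<open>j\<close> to the minor of both rows up to sign, nonzero for a suitable \<open>v\<close>
  because the rows are not proportional.\<close>

lemma rows_indep_functional:
  fixes \<Delta> :: "'v ice_quiver"
  assumes q: "is_ice_quiver \<Delta>" and u: "u \<in> mutables \<Delta>" "j \<in> mutables \<Delta>" "u \<noteq> j" and ri: "rows_indep \<Delta>"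
  shows "\<exists>l :: ('v \<Rightarrow> int) \<Rightarrow> int. (\<forall>m n. l (m + n) = l m + l n) \<and> l (in_arrows \<Delta> u) = l (out_arrows \<Delta> u) \<and>
    l (in_arrows \<Delta> j) \<noteq> l (out_arrows \<Delta> j)"
proof -
  have fin: "finite (mutables \<Delta>)" using is_ice_quiverD[OF q] by simp
  obtain i where i: "b_entry \<Delta> u i \<noteq> 0"
    using rows_indep_nonzero[OF q u(1) ri] by (force simp: b_entry_def in_arrows_def out_arrows_def fun_eq_iff)
  define c where "c k = (if k = u then - rat_of_int (b_entry \<Delta> j i) else if k = j then of_int (b_entry \<Delta> u i) else 0)" for k
  have s: "(\<Sum>k\<in>mutables \<Delta>. c k * of_int (b_entry \<Delta> k v)) =
      of_int (b_entry \<Delta> u i * b_entry \<Delta> j v - b_entry \<Delta> j i * b_entry \<Delta> u v)" for v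
  proof -
    have "(\<Sum>k\<in>mutables \<Delta>. c k * of_int (b_entry \<Delta> k v)) = (\<Sum>k\<in>{u, j}. c k * of_int (b_entry \<Delta> k v))"
      using fin u by (intro sum.mono_neutral_right) (auto simp: c_def)
    then show ?thesis using u(3) by (simp add: c_def)
  qed
  have "c j \<noteq> 0" using i u(3) by (simp add: c_def)
  then obtain v where v: "b_entry \<Delta> u i * b_entry \<Delta> j v \<noteq> b_entry \<Delta> j i * b_entry \<Delta> u v"
    using ri[unfolded rows_indep_def, rule_format, of c j] u(2) s by (metis eq_iff_diff_eq_0 of_int_0)
  show ?thesis
    by (rule exI[of _ "\<lambda>m. b_entry \<Delta> u i * m v - b_entry \<Delta> u v * m i"])
      (use v in \<open>auto simp: algebra_simps b_entry_def in_arrows_def out_arrows_def\<close>)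
qed

section \<open>Invariance of the upper bound under mutation\<close>

definition good_seed :: "'f::field set \<Rightarrow> 'v ice_quiver \<Rightarrow> ('v \<Rightarrow> 'f) \<Rightarrow> bool" where
  "good_seed K \<Delta> x \<longleftrightarrow> is_ice_quiver \<Delta> \<and> lindep K (verts \<Delta>) x \<and> rows_indep \<Delta>"

lemma laurent_verts: "is_subfield K \<Longrightarrow> is_ice_quiver \<Delta> \<Longrightarrow> laurent K (verts \<Delta>)"
  by unfold_locales (auto simp: is_ice_quiver_def)

lemma in_out_arrows_lattice: "is_ice_quiver \<Delta> \<Longrightarrow> in_arrows \<Delta> u \<in> lattice_on (verts \<Delta>)" "is_ice_quiver \<Delta> \<Longrightarrow> out_arrows \<Delta> u \<in> lattice_on (verts \<Delta>)"
  using is_ice_quiverD(6)[of \<Delta>] by (auto simp: lattice_on_def in_arrows_def out_arrows_def)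

lemma exch_mutate:
  assumes K: "is_subfield K" and g: "good_seed K \<Delta> x" and u: "u \<in> mutables \<Delta>"
  shows "exch (verts \<Delta>) u (in_arrows \<Delta> u) (out_arrows \<Delta> u) x (mutate_cluster u \<Delta> x)"
proof -
  have q: "is_ice_quiver \<Delta>" and ind: "lindep K (verts \<Delta>) x" and ri: "rows_indep \<Delta>"
    using g by (auto simp: good_seed_def)
  interpret laurent K "verts \<Delta>" by (rule laurent_verts[OF K q])
  have uV: "u \<in> verts \<Delta>" using is_ice_quiverD(3)[OF q] u by auto
  show ?thesis
    unfolding exch_def
    using uV in_out_arrows_lattice[OF q] rows_indep_nonzero[OF q u ri] is_ice_quiverD(4)[OF q] lindep_nonzero[OF ind uV]
    by (auto simp: mutate_cluster_def lmon_def in_arrows_def out_arrows_def)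
qed

lemma good_seed_mutate:
  assumes "is_subfield K" "good_seed K \<Delta> x" "u \<in> mutables \<Delta>"
  shows "good_seed K (mutate_quiver u \<Delta>) (mutate_cluster u \<Delta> x)"
proof -
  have q: "is_ice_quiver \<Delta>" using assms by (simp add: good_seed_def)
  interpret laurent K "verts \<Delta>" by (rule laurent_verts[OF assms(1) q])
  show ?thesis
    using assms lindep_exch[OF _ exch_mutate[OF assms]] is_ice_quiver_mutate_quiver[OF q assms(3)]
      rows_indep_mutate[OF q assms(3)] by (auto simp: good_seed_def)
qed

lemma good_seed_laurent_ring:
  "is_subfield K \<Longrightarrow> good_seed K \<Delta> x \<Longrightarrow>
     laurent_ring K \<Delta> x = lspan K (verts \<Delta>) x {m. \<forall>p\<in>frozens \<Delta>. 0 \<le> m p}"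
  by (rule laurent_ring_eq_lspan) (auto simp: good_seed_def)

lemma laurent_ring_mutate_quiver: "laurent_ring K (mutate_quiver u \<Delta>) x = laurent_ring K \<Delta> x"
  by (simp add: laurent_ring_def)

lemma laurent_ring_in_UNIV:
  assumes "is_subfield K" "good_seed K \<Delta> x" "f \<in> laurent_ring K \<Delta> x"
  shows "f \<in> lspan K (verts \<Delta>) x UNIV"
  using assms(3) unfolding good_seed_laurent_ring[OF assms(1,2)] by (rule lspan_mono) simp

lemma laurent_ring_mutate_in_UNIV:
  assumes "is_subfield K" "good_seed K \<Delta> x" "u \<in> mutables \<Delta>" "f \<in> laurent_ring K \<Delta> (mutate_cluster u \<Delta> x)"
  shows "f \<in> lspan K (verts \<Delta>) (mutate_cluster u \<Delta> x) UNIV"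
  using laurent_ring_in_UNIV[OF assms(1) good_seed_mutate[OF assms(1-3)]] assms(4)
  by (simp add: laurent_ring_mutate_quiver)

text \<open>Without 2-cycles a frozen variable divides at most one term of an exchange relation, so
  nonnegativity at frozen vertices carries over. This is why new expansions are sought below with
  frozen variables inverted.\<close>

lemma laurent_ring_mutate:
  assumes K: "is_subfield K" and g: "good_seed K \<Delta> x" and u: "u \<in> mutables \<Delta>"
    and f: "f \<in> laurent_ring K \<Delta> x" "f \<in> lspan K (verts \<Delta>) (mutate_cluster u \<Delta> x) UNIV"
  shows "f \<in> laurent_ring K \<Delta> (mutate_cluster u \<Delta> x)"
proof -
  have q: "is_ice_quiver \<Delta>" and ind: "lindep K (verts \<Delta>) x"
    using g by (auto simp: good_seed_def)
  interpret laurent K "verts \<Delta>" by (rule laurent_verts[OF K q])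
  let ?y = "mutate_cluster u \<Delta> x"
  note e = exch_mutate[OF K g u]
  have "f \<in> T ?y {m. 0 \<le> m p}" if p: "p \<in> frozens \<Delta>" for p
  proof (rule frozen_transfer[OF ind e _ _ _ _ _ _ f(2)])
    show "p \<in> verts \<Delta>" "p \<noteq> u" using p u by (auto simp: frozens_def)
    show "in_arrows \<Delta> u p = 0 \<or> out_arrows \<Delta> u p = 0" using is_ice_quiverD(5)[OF q, of u p] by (auto simp: in_arrows_def out_arrows_def)
    show "f \<in> T x {m. 0 \<le> m p}"
      using f(1) p unfolding good_seed_laurent_ring[OF K g] by (auto elim: lspan_mono)
  qed (simp_all add: in_arrows_def out_arrows_def)
  then have "f \<in> T ?y (UNIV \<inter> (\<Inter>p\<in>frozens \<Delta>. {m. 0 \<le> m p}))"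
    by (rule lspan_INT[OF lindep_exch[OF ind e] f(2)])
  then have "f \<in> T ?y {m. \<forall>p\<in>frozens \<Delta>. 0 \<le> m p}" by (rule lspan_mono) auto
  then show ?thesis
    using good_seed_laurent_ring[OF K good_seed_mutate[OF K g u]] by (simp add: laurent_ring_mutate_quiver)
qed

text \<open>A Laurent ring depends on the quiver only through its mutable and frozen vertices, so
  the neighbouring clusters are combined with \<open>\<Delta>\<close> itself.\<close>

definition upper_bound :: "'f::field set \<Rightarrow> 'v ice_quiver \<Rightarrow> ('v \<Rightarrow> 'f) \<Rightarrow> 'f set" where
  "upper_bound K \<Delta> x = laurent_ring K \<Delta> x \<inter> (\<Inter>u\<in>mutables \<Delta>. laurent_ring K \<Delta> (mutate_cluster u \<Delta> x))"

text \<open>Invariance of the upper bound comes down to clusters two exchanges away. Arrows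
  \<open>j \<rightarrow> u\<close> reduce to arrows \<open>u \<rightarrow> j\<close> by swapping the
  two terms of all three relations.\<close>

lemma two_step:
  assumes K: "is_subfield K" and g: "good_seed K \<Delta> x" and u: "u \<in> mutables \<Delta>"
    and j: "j \<in> mutables \<Delta>" "j \<noteq> u" and f: "f \<in> upper_bound K \<Delta> x"
  shows "f \<in> lspan K (verts \<Delta>) (mutate_cluster j (mutate_quiver u \<Delta>) (mutate_cluster u \<Delta> x)) UNIV"
proof -
  have q: "is_ice_quiver \<Delta>" and ind: "lindep K (verts \<Delta>) x" and ri: "rows_indep \<Delta>"
    using g by (auto simp: good_seed_def)
  interpret laurent K "verts \<Delta>" by (rule laurent_verts[OF K q])
  let ?D = "mutate_quiver u \<Delta>" and ?xu = "mutate_cluster u \<Delta> x" and ?xj = "mutate_cluster j \<Delta> x"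
  let ?z = "mutate_cluster j ?D ?xu"
  note gu = good_seed_mutate[OF K g u]
  note e1 = exch_mutate[OF K g u] and e2 = exch_mutate[OF K g j(1)]
  have e3: "exch (verts \<Delta>) j (in_arrows ?D j) (out_arrows ?D j) ?xu ?z"
    using exch_mutate[OF K gu, of j] j by simp
  have fU: "f \<in> T x UNIV" "f \<in> T ?xu UNIV" "f \<in> T ?xj UNIV"
    using f u j laurent_ring_in_UNIV[OF K g] laurent_ring_mutate_in_UNIV[OF K g]
    unfolding upper_bound_def by blast+
  have arr_uu: "arr \<Delta> v v = 0" for v using is_ice_quiverD(4)[OF q] .
  have V: "arr \<Delta> v w = 0" if "v \<notin> verts \<Delta> \<or> w \<notin> verts \<Delta>" for v w using is_ice_quiverD(6)[OF q that] .
  have two: "arr \<Delta> v w = 0 \<or> arr \<Delta> w v = 0" for v w using is_ice_quiverD(5)[OF q] .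
  have mn: "int (k - m) + int (min k m) = int k" "int (m - k) + int (min k m) = int m" for k m :: nat
    by (auto simp: min_def)
  consider "arr \<Delta> u j = 0" "arr \<Delta> j u = 0" | "0 < arr \<Delta> u j" "arr \<Delta> j u = 0" | "0 < arr \<Delta> j u" "arr \<Delta> u j = 0"
    using two[of u j] by auto
  then show ?thesis
  proof cases
    case 1
    \<comment> \<open>No path through \<open>u\<close> starts or ends at \<open>j\<close>, so the
      arrows at \<open>j\<close> stay as they are.\<close>
    have io: "in_arrows ?D j = in_arrows \<Delta> j" "out_arrows ?D j = out_arrows \<Delta> j"
    proof -
      have "arr ?D v j = arr \<Delta> v j" "arr ?D j v = arr \<Delta> j v" for v
        using 1 j two[of v j] by (auto simp: mutate_quiver_def)
      then show "in_arrows ?D j = in_arrows \<Delta> j" "out_arrows ?D j = out_arrows \<Delta> j" by (auto simp: in_arrows_def out_arrows_def)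
    qed
    obtain l :: "_ \<Rightarrow> int" where l: "\<forall>m n. l (m + n) = l m + l n" "l (in_arrows \<Delta> u) = l (out_arrows \<Delta> u)"
      "l (in_arrows \<Delta> j) \<noteq> l (out_arrows \<Delta> j)"
      using rows_indep_functional[OF q u j(1) j(2)[symmetric] ri] by blast
    show ?thesis
      by (rule two_step_commuting[OF ind e1 e2 e3[unfolded io] j(2)[symmetric] _ _ _ _ l(1)[rule_format] l(2,3) fU(2,3)])
        (use 1 in \<open>auto simp: in_arrows_def out_arrows_def\<close>)
  next
    case 2
    define n where "n = arr \<Delta> u j"
    \<comment> \<open>The number of 2-cycles cancelled between \<open>v\<close> and
      \<open>j\<close>: putting them back restores the common factor of both terms.\<close>
    define h where "h v = (if v = u then 0 else int (min (arr \<Delta> v j + n * arr \<Delta> v u) (arr \<Delta> j v)))" for v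
    have D: "arr ?D v j = (if v = u then 0 else arr \<Delta> v j + n * arr \<Delta> v u - arr \<Delta> j v)"
      "arr ?D j v = (if v = u then n else arr \<Delta> j v - (arr \<Delta> v j + n * arr \<Delta> v u))" for v
      using 2 j by (auto simp: mutate_quiver_def n_def mult.commute)
    show ?thesis
    proof (rule two_step_linked[OF ind e1 e2 e3, where n=n and g=h])
      show "in_arrows ?D j + h = (in_arrows \<Delta> j)(u := 0) + (\<lambda>v. int n * in_arrows \<Delta> u v)"
        by (auto simp: mn(1) in_arrows_def D h_def arr_uu fun_eq_iff simp del: of_nat_min)
      show "out_arrows ?D j + h = (out_arrows \<Delta> j)(u := int n)"
        by (auto simp: mn(2) out_arrows_def D h_def arr_uu fun_eq_iff simp del: of_nat_min)
      show "h \<in> lattice_on (verts \<Delta>)" using V by (auto simp: lattice_on_def h_def)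
    qed (use 2 j arr_uu fU in \<open>auto simp: in_arrows_def out_arrows_def n_def h_def\<close>)
  next
    case 3
    define n where "n = arr \<Delta> j u"
    define h where "h v = (if v = u then 0 else int (min (arr \<Delta> j v + n * arr \<Delta> u v) (arr \<Delta> v j)))" for v
    have D: "arr ?D j v = (if v = u then 0 else arr \<Delta> j v + n * arr \<Delta> u v - arr \<Delta> v j)"
      "arr ?D v j = (if v = u then n else arr \<Delta> v j - (arr \<Delta> j v + n * arr \<Delta> u v))" for v
      using 3 j by (auto simp: mutate_quiver_def n_def mult.commute)
    show ?thesis
    proof (rule two_step_linked[OF ind exch_swap[OF e1] exch_swap[OF e2] exch_swap[OF e3], where n=n and g=h])
      show "out_arrows ?D j + h = (out_arrows \<Delta> j)(u := 0) + (\<lambda>v. int n * out_arrows \<Delta> u v)"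
        by (auto simp: mn(1) out_arrows_def D h_def arr_uu fun_eq_iff simp del: of_nat_min)
      show "in_arrows ?D j + h = (in_arrows \<Delta> j)(u := int n)"
        by (auto simp: mn(2) in_arrows_def D h_def arr_uu fun_eq_iff simp del: of_nat_min)
      show "h \<in> lattice_on (verts \<Delta>)" using V by (auto simp: lattice_on_def h_def)
    qed (use 3 j arr_uu fU in \<open>auto simp: in_arrows_def out_arrows_def n_def h_def\<close>)
  qed
qed

lemma upper_bound_mutate:
  assumes K: "is_subfield K" and g: "good_seed K \<Delta> x" and u: "u \<in> mutables \<Delta>" and f: "f \<in> upper_bound K \<Delta> x"
  shows "f \<in> upper_bound K (mutate_quiver u \<Delta>) (mutate_cluster u \<Delta> x)"
proof -
  have q: "is_ice_quiver \<Delta>" and ind: "lindep K (verts \<Delta>) x"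
    using g by (auto simp: good_seed_def)
  interpret laurent K "verts \<Delta>" by (rule laurent_verts[OF K q])
  let ?D = "mutate_quiver u \<Delta>" and ?xu = "mutate_cluster u \<Delta> x"
  note gu = good_seed_mutate[OF K g u]
  have 1: "f \<in> laurent_ring K ?D ?xu"
    using f u by (auto simp: upper_bound_def laurent_ring_mutate_quiver)
  have "f \<in> laurent_ring K ?D (mutate_cluster j ?D ?xu)" if j: "j \<in> mutables \<Delta>" for j
  proof (cases "j = u")
    \<comment> \<open>Mutating twice at \<open>u\<close> returns to \<open>x\<close>, whose Laurent
      ring is part of the upper bound.\<close>
    case True
    note e = exch_mutate[OF K g u]
    have e': "exch (verts \<Delta>) u (in_arrows ?D u) (out_arrows ?D u) ?xu (mutate_cluster u ?D ?xu)"
      using exch_mutate[OF K gu, of u] u by simp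
    have "in_arrows ?D u = out_arrows \<Delta> u" "out_arrows ?D u = in_arrows \<Delta> u"
      by (auto simp: in_arrows_def out_arrows_def mutate_quiver_def)
    then have "?xu u * mutate_cluster u ?D ?xu u = x u * ?xu u"
      using e e' exch_P[OF e] by (simp add: exch_def add.commute)
    then have "mutate_cluster u ?D ?xu u = x u" using exch_nonzero(2)[OF ind e, of u] e by (simp add: exch_def)
    then have "mutate_cluster u ?D ?xu v = x v" for v by (cases "v = u") (auto simp: mutate_cluster_def)
    then have "mutate_cluster u ?D ?xu = x" by blast
    then show ?thesis using f True by (simp add: upper_bound_def laurent_ring_mutate_quiver)
  next
    case False
    show ?thesis
      by (rule laurent_ring_mutate[OF K gu _ 1]) (use two_step[OF K g u j False f] j in simp_all)
  qed
  then show ?thesis using 1 by (simp add: upper_bound_def)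
qed

lemma upper_bound_subset:
  assumes K: "is_subfield K" and g: "good_seed K \<Delta> x"
  shows "upper_bound K \<Delta> x \<subseteq> upper_cluster_algebra K \<Delta> x"
proof
  fix f assume f: "f \<in> upper_bound K \<Delta> x"
  have "good_seed K \<Delta>' x' \<and> f \<in> upper_bound K \<Delta>' x'" if "mutation_equivalent \<Delta> x \<Delta>' x'" for \<Delta>' x'
    using that by (induction rule: mutation_equivalent.induct)
      (auto intro: g f upper_bound_mutate[OF K] good_seed_mutate[OF K])
  then show "f \<in> upper_cluster_algebra K \<Delta> x"
    unfolding upper_cluster_algebra_def upper_bound_def by blast
qed

section \<open>Gradings\<close>

lemma int_mult_zero: "int_mult 0 \<alpha> = 0"
  by (simp add: int_mult_def)

lemma int_mult_succ: "int_mult (k + 1) \<alpha> = int_mult k \<alpha> + \<alpha>"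
proof -
  consider "0 \<le> k" | "k = -1" | "k < -1" by linarith
  then show ?thesis
  proof cases
    case 1
    then have "nat (k + 1) = Suc (nat k)" by simp
    then show ?thesis using 1 by (simp add: int_mult_def)
  next
    case 3
    then have "nat (- k) = Suc (nat (- (k + 1)))" by simp
    then show ?thesis using 3 by (simp add: int_mult_def del: minus_add_distrib)
  qed (simp add: int_mult_def)
qed

lemma int_mult_pred: "int_mult (k - 1) \<alpha> = int_mult k \<alpha> - \<alpha>"
  using int_mult_succ[of "k - 1" \<alpha>] by simp

lemma int_mult_add: "int_mult (k + l) \<alpha> = int_mult k \<alpha> + int_mult l \<alpha>"
proof (induction l rule: int_induct[where k=0])
  case (step1 i)
  then show ?case using int_mult_succ[of "k + i" \<alpha>] int_mult_succ[of i \<alpha>] by (simp add: add.assoc)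
next
  case (step2 i)
  then show ?case using int_mult_pred[of "k + i" \<alpha>] int_mult_pred[of i \<alpha>] by (simp add: add_diff_eq)
qed (simp add: int_mult_zero)

lemma additive_int_mult:
  fixes F :: "'l::ab_group_add \<Rightarrow> int"
  assumes "Modules.additive F"
  shows "F (int_mult k \<alpha>) = k * F \<alpha>"
proof (induction k rule: int_induct[where k=0])
  case base
  show ?case using additive.zero[OF assms] by (simp add: int_mult_zero)
next
  case (step1 i)
  then show ?case using additive.add[OF assms] by (simp add: int_mult_succ distrib_right)
next
  case (step2 i)
  then show ?case using additive.diff[OF assms] by (simp add: int_mult_pred left_diff_distrib)
qed

definition weight :: "'v set \<Rightarrow> ('v \<Rightarrow> 'l::ab_group_add) \<Rightarrow> ('v \<Rightarrow> int) \<Rightarrow> 'l" where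
  "weight V \<sigma> m = (\<Sum>v\<in>V. int_mult (m v) (\<sigma> v))"

lemma weight_add: "weight V \<sigma> (m + n) = weight V \<sigma> m + weight V \<sigma> n"
  by (simp add: weight_def int_mult_add sum.distrib)

lemma additive_weight:
  fixes F :: "'l::ab_group_add \<Rightarrow> int"
  assumes "Modules.additive F"
  shows "F (weight V \<sigma> m) = (\<Sum>v\<in>V. m v * F (\<sigma> v))"
  using additive.sum[OF assms, of "\<lambda>v. int_mult (m v) (\<sigma> v)" V]
  by (simp add: weight_def additive_int_mult[OF assms])

text \<open>An abstract weight on exponents rather than one given by \<open>\<sigma>\<close>:
  mutation then transforms it by a formula, and additivity and homogeneity of the exchange relations
  are all that has to be preserved.\<close>

definition homogeneous_weight :: "'v ice_quiver \<Rightarrow> (('v \<Rightarrow> int) \<Rightarrow> 'l::ab_group_add) \<Rightarrow> bool" where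
  "homogeneous_weight \<Delta> w \<longleftrightarrow> (\<forall>m n. w (m + n) = w m + w n) \<and> (\<forall>j\<in>mutables \<Delta>. w (in_arrows \<Delta> j) = w (out_arrows \<Delta> j))"

lemma homogeneous_weight_mutate:
  assumes q: "is_ice_quiver \<Delta>" and h: "homogeneous_weight \<Delta> w" and u: "u \<in> mutables \<Delta>"
  shows "homogeneous_weight (mutate_quiver u \<Delta>) (\<lambda>m. w (m(u := - m u)) + w (\<lambda>v. m u * in_arrows \<Delta> u v))"
proof -
  let ?w = "\<lambda>m. w (m(u := - m u)) + w (\<lambda>v. m u * in_arrows \<Delta> u v)" and ?D = "mutate_quiver u \<Delta>"
  have add: "w (m + n) = w m + w n" for m n using h by (simp add: homogeneous_weight_def)
  have w0: "w 0 = 0" using add[of 0 0] by simp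
  have wd: "w (m - n) = w m - w n" for m n using add[of "m - n" n] by simp
  have wadd: "?w (m + n) = ?w m + ?w n" for m n
  proof -
    have "(m + n)(u := - (m + n) u) = m(u := - m u) + n(u := - n u)"
      "(\<lambda>v. (m + n) u * in_arrows \<Delta> u v) = (\<lambda>v. m u * in_arrows \<Delta> u v) + (\<lambda>v. n u * in_arrows \<Delta> u v)"
      by (auto simp: fun_eq_iff distrib_right)
    then show ?thesis by (simp add: add add_ac)
  qed
  have wdiff: "?w (m - n) = ?w m - ?w n" for m n using wadd[of "m - n" n] by simp
  have uu: "in_arrows \<Delta> u u = 0" "out_arrows \<Delta> u u = 0" using is_ice_quiverD(4)[OF q] by (auto simp: in_arrows_def out_arrows_def)
  have wk: "w (\<lambda>v. int k * (in_arrows \<Delta> u v - out_arrows \<Delta> u v)) = 0" for k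
  proof (induction k)
    case 0
    have "(\<lambda>v. 0) = (0::'a \<Rightarrow> int)" by (simp add: zero_fun_def)
    then show ?case using w0 by simp
  next
    case (Suc k)
    have "(\<lambda>v. int (Suc k) * (in_arrows \<Delta> u v - out_arrows \<Delta> u v)) =
      (in_arrows \<Delta> u - out_arrows \<Delta> u) + (\<lambda>v. int k * (in_arrows \<Delta> u v - out_arrows \<Delta> u v))"
      by (auto simp: fun_eq_iff algebra_simps)
    then show ?case using Suc h u by (simp add: add wd homogeneous_weight_def)
  qed
  have "?w (in_arrows ?D j) = ?w (out_arrows ?D j)" if j: "j \<in> mutables \<Delta>" for j
  proof (cases "j = u")
    case True
    have "in_arrows ?D u = out_arrows \<Delta> u" "out_arrows ?D u = in_arrows \<Delta> u"
      by (auto simp: in_arrows_def out_arrows_def mutate_quiver_def)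
    moreover have "(\<lambda>v. 0) = (0::'a \<Rightarrow> int)" by (simp add: zero_fun_def)
    ultimately show ?thesis using True h u uu w0 by (simp add: homogeneous_weight_def fun_upd_idem)
  next
    case False
    define \<beta> \<beta>' where "\<beta> = in_arrows \<Delta> j - out_arrows \<Delta> j" and "\<beta>' = in_arrows ?D j - out_arrows ?D j"
    have \<beta>: "\<beta> v = - b_entry \<Delta> j v" "\<beta>' v = - b_entry ?D j v" for v
      by (auto simp: \<beta>_def \<beta>'_def in_arrows_def out_arrows_def b_entry_def)
    have \<beta>u: "\<beta>' u = - \<beta> u" using b_entry_mutate[OF q j False, of u] by (simp add: \<beta>)
    \<comment> \<open>The mutation rule for row \<open>j\<close>, rewritten in the old cluster. The
      multiple of the exchange vector of \<open>u\<close> has weight 0, and the multiple of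
      \<open>in_arrows \<Delta> u\<close> cancels the second summand of
      \<open>?w \<beta>'\<close>.\<close>
    have flip: "\<beta>'(u := - \<beta>' u) = \<beta> + ((\<lambda>v. int (arr \<Delta> j u) * (in_arrows \<Delta> u v - out_arrows \<Delta> u v)) + (\<lambda>v. \<beta> u * in_arrows \<Delta> u v))"
    proof
      fix v
      show "(\<beta>'(u := - \<beta>' u)) v = (\<beta> + ((\<lambda>v. int (arr \<Delta> j u) * (in_arrows \<Delta> u v - out_arrows \<Delta> u v)) + (\<lambda>v. \<beta> u * in_arrows \<Delta> u v))) v"
      proof (cases "v = u")
        case True
        then show ?thesis using uu \<beta>u by simp
      next
        case False
        then show ?thesis
          using b_entry_mutate[OF q j \<open>j \<noteq> u\<close>, of v]
          by (simp add: \<beta> in_arrows_def out_arrows_def b_entry_def[of \<Delta> u v] algebra_simps)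
      qed
    qed
    have "w (\<lambda>v. \<beta> u * in_arrows \<Delta> u v) + w (\<lambda>v. \<beta>' u * in_arrows \<Delta> u v) = w ((\<lambda>v. \<beta> u * in_arrows \<Delta> u v) + (\<lambda>v. \<beta>' u * in_arrows \<Delta> u v))"
      by (simp add: add)
    also have "(\<lambda>v. \<beta> u * in_arrows \<Delta> u v) + (\<lambda>v. \<beta>' u * in_arrows \<Delta> u v) = 0" by (auto simp: fun_eq_iff \<beta>u)
    finally have "w (\<lambda>v. \<beta> u * in_arrows \<Delta> u v) + w (\<lambda>v. \<beta>' u * in_arrows \<Delta> u v) = 0" using w0 by (simp add: zero_fun_def)
    moreover have "w \<beta> = 0" unfolding \<beta>_def using h j by (simp add: wd homogeneous_weight_def)
    ultimately have "?w \<beta>' = 0" unfolding flip add wk by simp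
    then show ?thesis unfolding \<beta>'_def wdiff by simp
  qed
  then show ?thesis unfolding homogeneous_weight_def mutate_quiver_simps using wadd by blast
qed

text \<open>The same field elements \<open>c \<alpha>\<close> are followed through all mutations;
  what changes from seed to seed is the weight \<open>w'\<close> for which they are
  homogeneous.\<close>

lemma component_in_upper_cluster_algebra:
  assumes K: "is_subfield K" and g: "good_seed K \<Delta> x" and h: "homogeneous_weight \<Delta> w"
    and D: "finite D" and f: "(\<Sum>\<alpha>\<in>D. c \<alpha>) \<in> upper_cluster_algebra K \<Delta> x"
    and c: "\<And>\<alpha>. \<alpha> \<in> D \<Longrightarrow> c \<alpha> \<in> lspan K (verts \<Delta>) x ({m. \<forall>p\<in>frozens \<Delta>. 0 \<le> m p} \<inter> {m. w m = \<alpha>})"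
    and \<alpha>: "\<alpha> \<in> D"
  shows "c \<alpha> \<in> upper_cluster_algebra K \<Delta> x"
proof -
  have *: "good_seed K \<Delta>' x' \<and> (\<exists>w'. homogeneous_weight \<Delta>' w' \<and>
      (\<forall>\<alpha>\<in>D. c \<alpha> \<in> lspan K (verts \<Delta>') x' ({m. \<forall>p\<in>frozens \<Delta>'. 0 \<le> m p} \<inter> {m. w' m = \<alpha>})))"
    if "mutation_equivalent \<Delta> x \<Delta>' x'" for \<Delta>' x'
    using that
  proof (induction rule: mutation_equivalent.induct)
    case refl
    then show ?case using g h c by blast
  next
    case (step \<Delta>' x' u)
    let ?D = "mutate_quiver u \<Delta>'" and ?y = "mutate_cluster u \<Delta>' x'"
    from step.IH obtain w' where g': "good_seed K \<Delta>' x'" and h': "homogeneous_weight \<Delta>' w'"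
      and c': "\<And>\<alpha>. \<alpha> \<in> D \<Longrightarrow> c \<alpha> \<in> lspan K (verts \<Delta>') x' ({m. \<forall>p\<in>frozens \<Delta>'. 0 \<le> m p} \<inter> {m. w' m = \<alpha>})"
      by blast
    have q: "is_ice_quiver \<Delta>'" and ind: "lindep K (verts \<Delta>') x'" using g' by (auto simp: good_seed_def)
    interpret laurent K "verts \<Delta>'" by (rule laurent_verts[OF K q])
    note gu = good_seed_mutate[OF K g' step.hyps(2)]
    have "mutation_equivalent \<Delta> x ?D ?y" using step.hyps by (rule mutation_equivalent.step)
    then have fD: "(\<Sum>\<alpha>\<in>D. c \<alpha>) \<in> laurent_ring K ?D ?y" using f unfolding upper_cluster_algebra_def by blast
    have fL: "(\<Sum>\<alpha>\<in>D. c \<alpha>) \<in> T ?y {m. \<forall>p\<in>frozens \<Delta>'. 0 \<le> m p}"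
      using fD good_seed_laurent_ring[OF K gu] by simp
    let ?w = "\<lambda>m. w' (m(u := - m u)) + w' (\<lambda>v. m u * in_arrows \<Delta>' u v)"
    have "c \<alpha> \<in> T ?y ({m. \<forall>p\<in>frozens \<Delta>'. 0 \<le> m p} \<inter> {m. ?w m = \<alpha>})" if "\<alpha> \<in> D" for \<alpha>
    proof (rule homogeneous_transfer[OF ind exch_mutate[OF K g' step.hyps(2)], where w=w' and D=D and c=c])
      show "w' (m + n) = w' m + w' n" for m n using h' by (simp add: homogeneous_weight_def)
      show "w' (in_arrows \<Delta>' u) = w' (out_arrows \<Delta>' u)" using h' step.hyps(2) by (simp add: homogeneous_weight_def)
      show "c \<alpha> \<in> T x' {m. w' m = \<alpha>}" if "\<alpha> \<in> D" for \<alpha> using c'[OF that] by (rule lspan_mono) auto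
    qed (use D fL that in auto)
    then show ?case
      using gu homogeneous_weight_mutate[OF q h' step.hyps(2)] by auto
  qed
  have "c \<alpha> \<in> laurent_ring K \<Delta>' x'" if "mutation_equivalent \<Delta> x \<Delta>' x'" for \<Delta>' x'
  proof -
    from *[OF that] \<alpha> have "c \<alpha> \<in> lspan K (verts \<Delta>') x' {m. \<forall>p\<in>frozens \<Delta>'. 0 \<le> m p}"
      by (auto elim: lspan_mono)
    then show ?thesis using *[OF that] good_seed_laurent_ring[OF K] by blast
  qed
  then show ?thesis unfolding upper_cluster_algebra_def by blast
qed

section \<open>Homogeneous components and restricted clusters as spans\<close>

lemma laurent_component_eq_lspan:
  fixes x :: "'v \<Rightarrow> 'f::field"
  assumes K: "is_subfield K" and q: "is_ice_quiver \<Delta>"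
  shows "laurent_component K \<Delta> x \<sigma> \<alpha> =
    lspan K (verts \<Delta>) x ({m. \<forall>p\<in>frozens \<Delta>. 0 \<le> m p} \<inter> {m. weight (verts \<Delta>) \<sigma> m = \<alpha>})" (is "_ = lspan K ?V x ?S")
proof (intro subset_antisym subsetI)
  interpret laurent K ?V by (rule laurent_verts[OF K q])
  fix f
  {
    assume "f \<in> laurent_component K \<Delta> x \<sigma> \<alpha>"
    then obtain A c where A: "finite A" "f = (\<Sum>m\<in>A. c m * (\<Prod>v\<in>?V. x v powi m v))"
      "\<forall>m\<in>A. c m \<in> K \<and> (\<forall>v\<in>frozens \<Delta>. 0 \<le> m v) \<and> (\<Sum>v\<in>?V. int_mult (m v) (\<sigma> v)) = \<alpha>"
      unfolding laurent_component_def by blast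
    have "lmon ?V x m \<in> T x ?S" if "m \<in> A" for m
    proof -
      \<comment> \<open>Exponents in \<open>laurent_component\<close> are arbitrary off the
        vertices; resetting them to zero there changes neither monomial nor weight.\<close>
      define m' where "m' v = (if v \<in> ?V then m v else 0)" for v
      have "lmon ?V x m = lmon ?V x m'" by (intro lmon_cong) (auto simp: m'_def)
      moreover have "weight ?V \<sigma> m' = weight ?V \<sigma> m" unfolding weight_def by (intro sum.cong) (auto simp: m'_def)
      ultimately show ?thesis using A(3) that
        by (auto intro!: lmon_in simp: lattice_on_def m'_def weight_def)
    qed
    then show "f \<in> T x ?S" unfolding A(2) using A(3) by (auto intro!: lspan_sum lspan_scale simp: lmon_def)
  next
    assume "f \<in> T x ?S"
    then show "f \<in> laurent_component K \<Delta> x \<sigma> \<alpha>"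
      unfolding lspan_repr laurent_component_def lmon_def weight_def by blast
  }
qed

text \<open>Lets the restricted seed be studied inside the Laurent rings of the full one, deletion
  of variables being a condition on exponents.\<close>

lemma lspan_restrict:
  "lspan K (V - W) x S = lspan K V x (S \<inter> {m. \<forall>v\<in>W. m v = 0})" if "finite V" for x :: "'v \<Rightarrow> 'f::field"
proof -
  have lat: "m \<in> lattice_on (V - W) \<longleftrightarrow> m \<in> lattice_on V \<and> (\<forall>v\<in>W. m v = 0)" for m :: "'v \<Rightarrow> int"
    by (auto simp: lattice_on_def)
  have mon: "lmon (V - W) x m = lmon V x m" if "\<forall>v\<in>W. m v = 0" for m
    unfolding lmon_def using \<open>finite V\<close> that by (intro prod.mono_neutral_left) auto
  show ?thesis
  proof (intro subset_antisym subsetI)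
    fix f assume "f \<in> lspan K (V - W) x S"
    then show "f \<in> lspan K V x (S \<inter> {m. \<forall>v\<in>W. m v = 0})"
      by (induction rule: lspan.induct) (auto simp: lat mon intro!: lspan.intros)
  next
    fix f assume "f \<in> lspan K V x (S \<inter> {m. \<forall>v\<in>W. m v = 0})"
    then show "f \<in> lspan K (V - W) x S"
    proof (induction rule: lspan.induct)
      case (step c m f)
      then have "c * lmon (V - W) x m + f \<in> lspan K (V - W) x S" by (intro lspan.step) (auto simp: lat)
      then show ?case using step mon[of m] by simp
    qed (rule lspan.zero)
  qed
qed

lemma lindep_restrict:
  fixes x :: "'v \<Rightarrow> 'f::field"
  assumes V: "finite V" and ind: "lindep K V x" and xy: "\<And>v. v \<in> V - W \<Longrightarrow> y v = x v"
  shows "lindep K (V - W) y"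
  unfolding lindep_def
proof (intro allI impI)
  fix A c assume A: "finite A" "A \<subseteq> lattice_on (V - W)" "\<forall>m\<in>A. c m \<in> K" "(\<Sum>m\<in>A. c m * lmon (V - W) y m) = 0"
  have "lmon (V - W) y m = lmon V x m" if "m \<in> A" for m
  proof -
    have "lmon (V - W) y m = lmon (V - W) x m" using xy by (intro lmon_cong) auto
    also have "\<dots> = lmon V x m"
      unfolding lmon_def using V subsetD[OF A(2) that] by (intro prod.mono_neutral_left) (auto simp: lattice_on_def)
    finally show ?thesis .
  qed
  then have "(\<Sum>m\<in>A. c m * lmon V x m) = 0" using A(4) by simp
  moreover have "A \<subseteq> lattice_on V" using A(2) by (auto simp: lattice_on_def)
  ultimately show "\<forall>m\<in>A. c m = 0" using ind A unfolding lindep_def by blast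
qed

section \<open>Deleting frozen vertices\<close>

text \<open>\<open>\<Gamma>\<close> is obtained from \<open>\<Delta>\<close> by deleting \<open>vs\<close> and freezing \<open>us\<close>, up to arrows between
  frozen vertices, which mutation in \<open>\<Delta>\<close> may create between vertices of \<open>us\<close> but mutation in
  \<open>\<Gamma>\<close> does not.\<close>

definition mirrors :: "'v set \<Rightarrow> 'v set \<Rightarrow> 'v ice_quiver \<Rightarrow> ('v \<Rightarrow> 'f::field) \<Rightarrow> 'v ice_quiver \<Rightarrow> ('v \<Rightarrow> 'f) \<Rightarrow> bool" where
  "mirrors vs us \<Gamma> y \<Delta> x \<longleftrightarrow> is_ice_quiver \<Gamma> \<and> verts \<Gamma> = verts \<Delta> - vs \<and> mutables \<Gamma> = mutables \<Delta> - us \<and>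
     vs \<subseteq> frozens \<Delta> \<and> us \<subseteq> mutables \<Delta> \<and> (\<forall>v\<in>verts \<Gamma>. y v = x v) \<and>
     (\<forall>i j. i \<notin> vs \<longrightarrow> j \<notin> vs \<longrightarrow> i \<in> mutables \<Gamma> \<or> j \<in> mutables \<Gamma> \<longrightarrow> arr \<Gamma> i j = arr \<Delta> i j) \<and>
     (\<forall>v\<in>vs. \<forall>u\<in>mutables \<Gamma>. arr \<Delta> u v = 0 \<and> arr \<Delta> v u = 0) \<and>
     (\<forall>u\<in>us. (\<exists>v\<in>vs. 0 < arr \<Delta> v u) \<and> (\<exists>v\<in>vs. 0 < arr \<Delta> u v))"

text \<open>The deleted vertices are not joined to \<open>u\<close>, so no arrow at them changes:
  vertices of \<open>us\<close> keep their arrows from and to \<open>vs\<close>, and no other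
  mutable vertex becomes attached.\<close>

lemma mirrors_mutate:
  assumes q: "is_ice_quiver \<Delta>" and m: "mirrors vs us \<Gamma> y \<Delta> x" and u: "u \<in> mutables \<Gamma>"
  shows "mirrors vs us (mutate_quiver u \<Gamma>) (mutate_cluster u \<Gamma> y) (mutate_quiver u \<Delta>) (mutate_cluster u \<Delta> x)"
proof -
  from m have V: "verts \<Gamma> = verts \<Delta> - vs" and M: "mutables \<Gamma> = mutables \<Delta> - us" and vs: "vs \<subseteq> frozens \<Delta>"
    and us: "us \<subseteq> mutables \<Delta>" and y: "\<And>v. v \<in> verts \<Gamma> \<Longrightarrow> y v = x v"
    and A: "\<And>i j. i \<notin> vs \<Longrightarrow> j \<notin> vs \<Longrightarrow> i \<in> mutables \<Gamma> \<or> j \<in> mutables \<Gamma> \<Longrightarrow> arr \<Gamma> i j = arr \<Delta> i j"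
    and Z: "\<And>v i. v \<in> vs \<Longrightarrow> i \<in> mutables \<Gamma> \<Longrightarrow> arr \<Delta> i v = 0" "\<And>v i. v \<in> vs \<Longrightarrow> i \<in> mutables \<Gamma> \<Longrightarrow> arr \<Delta> v i = 0"
    and U: "\<And>i. i \<in> us \<Longrightarrow> (\<exists>v\<in>vs. 0 < arr \<Delta> v i) \<and> (\<exists>v\<in>vs. 0 < arr \<Delta> i v)"
    and qG: "is_ice_quiver \<Gamma>"
    unfolding mirrors_def by blast+
  have uvs: "u \<notin> vs" "u \<in> mutables \<Delta>" "u \<notin> us" using u vs M by (auto simp: frozens_def)
  have vsm: "v \<notin> mutables \<Delta>" if "v \<in> vs" for v using vs that by (auto simp: frozens_def)
  have two: "arr \<Delta> i j - arr \<Delta> j i = arr \<Delta> i j" for i j using is_ice_quiverD(5)[OF q, of i j] by auto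
  have vsarr: "arr (mutate_quiver u \<Delta>) v i = arr \<Delta> v i" "arr (mutate_quiver u \<Delta>) i v = arr \<Delta> i v" if "v \<in> vs" for v i
    using Z[OF that u] two uvs that vsm by (auto simp: mutate_quiver_def)
  have prods: "(\<Prod>v\<in>verts \<Gamma>. y v ^ h v) = (\<Prod>v\<in>verts \<Delta>. x v ^ k v)"
    if "\<And>v. v \<in> vs \<Longrightarrow> k v = 0" "\<And>v. v \<in> verts \<Gamma> \<Longrightarrow> h v = k v" for h k
    using that y is_ice_quiverD(1)[OF q] by (intro prod.mono_neutral_cong_left) (auto simp: V)
  have "(\<Prod>v\<in>verts \<Gamma>. y v ^ arr \<Gamma> v u) = (\<Prod>v\<in>verts \<Delta>. x v ^ arr \<Delta> v u)"
    using Z u A uvs by (intro prods) (auto simp: V)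
  moreover have "(\<Prod>v\<in>verts \<Gamma>. y v ^ arr \<Gamma> u v) = (\<Prod>v\<in>verts \<Delta>. x v ^ arr \<Delta> u v)"
    using Z u A uvs by (intro prods) (auto simp: V)
  moreover have "u \<in> verts \<Gamma>" using is_ice_quiverD(3)[OF qG] u by auto
  ultimately have Y: "\<forall>v\<in>verts \<Gamma>. mutate_cluster u \<Gamma> y v = mutate_cluster u \<Delta> x v"
    using y by (auto simp: mutate_cluster_def)
  \<comment> \<open>Pairs that are frozen in \<open>\<Gamma>\<close> are left out: there mutation in
    \<open>\<Delta>\<close> may create arrows that mutation in \<open>\<Gamma>\<close> does
    not.\<close>
  have arrs: "arr (mutate_quiver u \<Gamma>) i j = arr (mutate_quiver u \<Delta>) i j"
    if "i \<notin> vs" "j \<notin> vs" "i \<in> mutables \<Gamma> \<or> j \<in> mutables \<Gamma>" for i j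
  proof (cases "i = u \<or> j = u")
    case True
    then show ?thesis using A[OF that(2,1)] u by (auto simp: mutate_quiver_def)
  next
    case False
    have "i \<in> mutables \<Delta> \<or> j \<in> mutables \<Delta>" using that M by auto
    then show ?thesis
      using False A[OF that(1,2)] A[OF that(2,1)] A[OF that(1) uvs(1)] A[OF uvs(1) that(2)] A[OF that(2) uvs(1)]
        A[OF uvs(1) that(1)] that u by (auto simp: mutate_quiver_def)
  qed
  show ?thesis
    unfolding mirrors_def mutate_quiver_simps
    using is_ice_quiver_mutate_quiver[OF qG u] V M vs us Y arrs vsarr Z U by auto
qed

lemma mirrors_laurent_subset:
  assumes q: "is_ice_quiver \<Delta>" and m: "mirrors vs us \<Gamma> y \<Delta> x" and f: "f \<in> laurent_ring K \<Gamma> y"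
  shows "f \<in> laurent_ring K \<Delta> x"
proof -
  from m have V: "verts \<Gamma> \<subseteq> verts \<Delta>" and M: "mutables \<Gamma> \<subseteq> mutables \<Delta>" "mutables \<Gamma> \<subseteq> verts \<Gamma>"
    and y: "\<And>v. v \<in> verts \<Gamma> \<Longrightarrow> y v = x v"
    unfolding mirrors_def using is_ice_quiverD(3)[of \<Gamma>] by auto
  have "y ` verts \<Gamma> \<subseteq> x ` verts \<Delta>" "(\<lambda>u. inverse (y u)) ` mutables \<Gamma> \<subseteq> (\<lambda>u. inverse (x u)) ` mutables \<Delta>"
    using V M y by force+
  then have "y ` verts \<Gamma> \<union> (\<lambda>u. inverse (y u)) ` mutables \<Gamma> \<subseteq> x ` verts \<Delta> \<union> (\<lambda>u. inverse (x u)) ` mutables \<Delta>"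
    by blast
  with f show ?thesis
    unfolding laurent_ring_def by (elim adjoin_subset[rotated]) (rule adjoin.gen, blast)
qed

lemma mirrors_laurent_eq:
  assumes K: "is_subfield K" and g: "good_seed K \<Delta> x" and m: "mirrors vs us \<Gamma> y \<Delta> x"
  shows "laurent_ring K \<Gamma> y = lspan K (verts \<Delta>) x ({m. \<forall>p\<in>frozens \<Gamma>. 0 \<le> m p} \<inter> {m. \<forall>v\<in>vs. m v = 0})"
proof -
  have q: "is_ice_quiver \<Delta>" and ind: "lindep K (verts \<Delta>) x" using g by (auto simp: good_seed_def)
  have fin: "finite (verts \<Delta>)" using is_ice_quiverD[OF q] by simp
  from m have V: "verts \<Gamma> = verts \<Delta> - vs" and qG: "is_ice_quiver \<Gamma>"
    and y: "\<And>v. v \<in> verts \<Gamma> \<Longrightarrow> y v = x v" unfolding mirrors_def by blast+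
  have indG: "lindep K (verts \<Gamma>) y" unfolding V using y by (intro lindep_restrict[OF fin ind]) (auto simp: V)
  have "lspan K (verts \<Gamma>) y S = lspan K (verts \<Gamma>) x S" for S
    using lspan_cong[of _ K "verts \<Gamma>" y S x] lspan_cong[of _ K "verts \<Gamma>" x S y] y by (metis subsetI subset_antisym)
  then show ?thesis
    unfolding laurent_ring_eq_lspan[OF K qG indG] V[symmetric] lspan_restrict[OF fin, symmetric] V[symmetric] by simp
qed

text \<open>A mutation sequence of the restricted seed is repeated in the full one. The variables of
  \<open>vs\<close> stay absent from \<open>f\<close> since they occur in none of the exchange
  relations used.\<close>

lemma mirrored_seed:
  assumes K: "is_subfield K" and g: "good_seed K \<Delta> x" and m: "mirrors vs us \<Gamma> y \<Delta> x"
    and me: "mutation_equivalent \<Gamma> y \<Gamma>' y'"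
    and f: "f \<in> upper_cluster_algebra K \<Delta> x" "f \<in> lspan K (verts \<Delta>) x {m. \<forall>v\<in>vs. m v = 0}"
  shows "\<exists>\<Delta>' x'. mutation_equivalent \<Delta> x \<Delta>' x' \<and> mirrors vs us \<Gamma>' y' \<Delta>' x' \<and> good_seed K \<Delta>' x' \<and>
    f \<in> lspan K (verts \<Delta>') x' {m. \<forall>v\<in>vs. m v = 0}"
  using me
proof (induction rule: mutation_equivalent.induct)
  case refl
  then show ?case using m g f mutation_equivalent.refl by blast
next
  case (step \<Gamma>' y' u)
  then obtain \<Delta>' x' where IH: "mutation_equivalent \<Delta> x \<Delta>' x'" "mirrors vs us \<Gamma>' y' \<Delta>' x'" "good_seed K \<Delta>' x'"
    "f \<in> lspan K (verts \<Delta>') x' {m. \<forall>v\<in>vs. m v = 0}" by blast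
  have q: "is_ice_quiver \<Delta>'" and ind: "lindep K (verts \<Delta>') x'" using IH(3) by (auto simp: good_seed_def)
  interpret laurent K "verts \<Delta>'" by (rule laurent_verts[OF K q])
  have u: "u \<in> mutables \<Delta>'" "u \<notin> vs" "\<forall>v\<in>vs. in_arrows \<Delta>' u v = 0 \<and> out_arrows \<Delta>' u v = 0"
    using IH(2) step.hyps(2) by (auto simp: mirrors_def frozens_def in_arrows_def out_arrows_def)
  note gu = good_seed_mutate[OF K IH(3) u(1)]
  have me': "mutation_equivalent \<Delta> x (mutate_quiver u \<Delta>') (mutate_cluster u \<Delta>' x')"
    by (rule mutation_equivalent.step[OF IH(1) u(1)])
  then have "f \<in> laurent_ring K (mutate_quiver u \<Delta>') (mutate_cluster u \<Delta>' x')"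
    using f(1) unfolding upper_cluster_algebra_def by blast
  then have "f \<in> T (mutate_cluster u \<Delta>' x') UNIV"
    using laurent_ring_in_UNIV[OF K gu] by simp
  from support_transfer[OF ind exch_mutate[OF K IH(3) u(1)] u(2,3) IH(4) this]
  have "f \<in> T (mutate_cluster u \<Delta>' x') {m. \<forall>v\<in>vs. m v = 0}" by simp
  then show ?case using me' gu mirrors_mutate[OF q IH(2) step.hyps(2)]
    by (intro exI[of _ "mutate_quiver u \<Delta>'"] exI[of _ "mutate_cluster u \<Delta>' x'"]) simp
qed

text \<open>In the lifted seed \<open>f\<close> is free of \<open>vs\<close>, so signs of exponents
  remain to be checked. At a newly frozen vertex \<open>p\<close> of \<open>us\<close> the expansion
  in the neighbour at \<open>p\<close> decides, as both terms of that exchange relation involve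
  \<open>vs\<close>.\<close>

lemma upper_cluster_algebra_restrict:
  assumes K: "is_subfield K" and g: "good_seed K \<Delta> x" and m: "mirrors vs us \<Gamma> y \<Delta> x"
    and f: "f \<in> upper_cluster_algebra K \<Delta> x" "f \<in> lspan K (verts \<Delta>) x {m. \<forall>v\<in>vs. m v = 0}"
  shows "f \<in> upper_cluster_algebra K \<Gamma> y"
  unfolding upper_cluster_algebra_def
proof (clarify)
  fix \<Gamma>' y' assume me: "mutation_equivalent \<Gamma> y \<Gamma>' y'"
  obtain \<Delta>' x' where D: "mutation_equivalent \<Delta> x \<Delta>' x'" "mirrors vs us \<Gamma>' y' \<Delta>' x'" "good_seed K \<Delta>' x'"
    "f \<in> lspan K (verts \<Delta>') x' {m. \<forall>v\<in>vs. m v = 0}"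
    using mirrored_seed[OF K g m me f] by blast
  have q: "is_ice_quiver \<Delta>'" and ind: "lindep K (verts \<Delta>') x'" using D(3) by (auto simp: good_seed_def)
  interpret laurent K "verts \<Delta>'" by (rule laurent_verts[OF K q])
  have vs: "vs \<subseteq> frozens \<Delta>'" "us \<subseteq> mutables \<Delta>'" and FG: "frozens \<Gamma>' \<subseteq> frozens \<Delta>' \<union> us"
    and U: "\<And>u. u \<in> us \<Longrightarrow> (\<exists>v\<in>vs. 0 < arr \<Delta>' v u) \<and> (\<exists>v\<in>vs. 0 < arr \<Delta>' u v)"
    using D(2) by (auto simp: mirrors_def frozens_def)
  have fin: "finite vs" using finite_subset[OF subset_trans[OF vs(1) frozens_subset] V] .
  have lr: "f \<in> laurent_ring K \<Delta>'' x''" if "mutation_equivalent \<Delta> x \<Delta>'' x''" for \<Delta>'' x''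
    using f(1) that unfolding upper_cluster_algebra_def by blast
  have "f \<in> T x' {m. 0 \<le> m p}" if p: "p \<in> frozens \<Gamma>'" for p
  proof (cases "p \<in> frozens \<Delta>'")
    case True
    have "f \<in> T x' {m. \<forall>p\<in>frozens \<Delta>'. 0 \<le> m p}"
      using lr[OF D(1)] good_seed_laurent_ring[OF K D(3)] by simp
    then show ?thesis by (rule lspan_mono) (use True in auto)
  next
    case False
    then have pu: "p \<in> us" "p \<in> mutables \<Delta>'" using p FG vs by auto
    note gp = good_seed_mutate[OF K D(3) pu(2)]
    have pos: "1 \<le> sum h vs" if "\<And>v. 0 \<le> h v" "v \<in> vs" "0 < h v" for h :: "_ \<Rightarrow> int" and v
    proof -
      have "h v \<le> sum h vs" using that fin by (intro member_le_sum) auto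
      then show ?thesis using that(3) by simp
    qed
    show ?thesis
    proof (rule exponent_nonneg[OF ind exch_mutate[OF K D(3) pu(2)] fin])
      show "p \<notin> vs" using vs pu by (auto simp: frozens_def)
      show "1 \<le> sum (in_arrows \<Delta>' p) vs" "1 \<le> sum (out_arrows \<Delta>' p) vs"
        using U[OF pu(1)] pos[of "in_arrows \<Delta>' p"] pos[of "out_arrows \<Delta>' p"] by (auto simp: in_arrows_def out_arrows_def)
      show "f \<in> T x' {m. sum m vs = 0}" using D(4) by (rule lspan_mono) auto
      have "f \<in> T (mutate_cluster p \<Delta>' x') {m. \<forall>p\<in>frozens \<Delta>'. 0 \<le> m p}"
        using lr[OF mutation_equivalent.step[OF D(1) pu(2)]] good_seed_laurent_ring[OF K gp] by simp
      then show "f \<in> T (mutate_cluster p \<Delta>' x') {m. 0 \<le> sum m vs}"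
        by (rule lspan_mono) (use vs in \<open>auto intro!: sum_nonneg\<close>)
    qed
  qed
  then have "f \<in> T x' ({m. \<forall>v\<in>vs. m v = 0} \<inter> (\<Inter>p\<in>frozens \<Gamma>'. {m. 0 \<le> m p}))"
    by (rule lspan_INT[OF ind D(4)])
  then show "f \<in> laurent_ring K \<Gamma>' y'"
    unfolding mirrors_laurent_eq[OF K D(3,2)] by (rule lspan_mono) auto
qed

text \<open>By the upper bound only \<open>\<Delta>\<close> and its neighbours matter. A neighbour
  at a vertex outside \<open>us\<close> mirrors a neighbour of \<open>\<Gamma>\<close>. At
  \<open>u\<close> in \<open>us\<close> the initial expansion suffices: it has no denominator
  \<open>x u\<close>, and \<open>x u\<close> is the exchange binomial divided by the new
  variable.\<close>

lemma restricted_algebra_subset: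
  assumes K: "is_subfield K" and g: "good_seed K \<Delta> x" and m: "mirrors vs us \<Gamma> y \<Delta> x"
    and f: "f \<in> upper_cluster_algebra K \<Gamma> y"
  shows "f \<in> upper_cluster_algebra K \<Delta> x"
proof (rule subsetD[OF upper_bound_subset[OF K g]])
  have q: "is_ice_quiver \<Delta>" and ind: "lindep K (verts \<Delta>) x" using g by (auto simp: good_seed_def)
  interpret laurent K "verts \<Delta>" by (rule laurent_verts[OF K q])
  have V: "verts \<Gamma> \<subseteq> verts \<Delta>" and qG: "is_ice_quiver \<Gamma>" and M: "mutables \<Gamma> = mutables \<Delta> - us"
    and y: "\<And>v. v \<in> verts \<Gamma> \<Longrightarrow> y v = x v"
    using m by (auto simp: mirrors_def)
  have MG: "mutables \<Gamma> \<subseteq> verts \<Gamma>" using is_ice_quiverD(3)[OF qG] .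
  have f1: "f \<in> laurent_ring K \<Gamma> y"
    using f mutation_equivalent.refl[of \<Gamma> y] unfolding upper_cluster_algebra_def by blast
  have "f \<in> laurent_ring K \<Delta> (mutate_cluster u \<Delta> x)" if u: "u \<in> mutables \<Delta>" for u
  proof (cases "u \<in> us")
    case False
    then have uG: "u \<in> mutables \<Gamma>" using u M by auto
    have "f \<in> laurent_ring K (mutate_quiver u \<Gamma>) (mutate_cluster u \<Gamma> y)"
      using f mutation_equivalent.step[OF mutation_equivalent.refl uG] unfolding upper_cluster_algebra_def by blast
    then have "f \<in> laurent_ring K (mutate_quiver u \<Delta>) (mutate_cluster u \<Delta> x)"
      using mirrors_laurent_subset[OF is_ice_quiver_mutate_quiver[OF q u] mirrors_mutate[OF q m uG]] by blast
    then show ?thesis by (simp add: laurent_ring_mutate_quiver)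
  next
    case True
    let ?z = "mutate_cluster u \<Delta> x"
    note e = exch_mutate[OF K g u]
    note gu = good_seed_mutate[OF K g u]
    have uV: "u \<in> verts \<Delta>" and uz: "in_arrows \<Delta> u u = 0" "out_arrows \<Delta> u u = 0" using e by (auto simp: exch_def)
    define S where "S = ?z ` verts \<Delta> \<union> (\<lambda>w. inverse (?z w)) ` mutables \<Delta>"
    have zv: "?z v = x v" if "v \<noteq> u" for v using that by (simp add: mutate_cluster_def)
    have "P ?z (in_arrows \<Delta> u) (out_arrows \<Delta> u) \<in> laurent_ring K (mutate_quiver u \<Delta>) ?z"
      unfolding good_seed_laurent_ring[OF K gu]
      using in_out_arrows_lattice[OF q, of u] by (auto intro!: lspan_add lmon_in simp: in_arrows_def out_arrows_def)
    then have "P x (in_arrows \<Delta> u) (out_arrows \<Delta> u) \<in> adjoin K S"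
      unfolding exch_P[OF e] laurent_ring_mutate_quiver by (simp add: laurent_ring_def S_def)
    moreover have "x u = P x (in_arrows \<Delta> u) (out_arrows \<Delta> u) * inverse (?z u)"
      using e exch_nonzero(2)[OF ind e uV] by (simp add: exch_def field_simps)
    moreover have "inverse (?z u) \<in> adjoin K S" using u by (intro adjoin.gen) (auto simp: S_def)
    ultimately have xu: "x u \<in> adjoin K S" by (metis adjoin.mult)
    have "s \<in> adjoin K S" if s: "s \<in> y ` verts \<Gamma> \<union> (\<lambda>w. inverse (y w)) ` mutables \<Gamma>" for s
    proof -
      from s consider v where "v \<in> verts \<Gamma>" "s = y v" | w where "w \<in> mutables \<Gamma>" "s = inverse (y w)" by blast
      then show ?thesis
      proof cases
        case 1
        show ?thesis
        proof (cases "v = u")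
          case True
          then show ?thesis using 1 y xu by simp
        next
          case False
          have "s = ?z v" using 1 y zv[OF False] by simp
          then show ?thesis using 1 V by (intro adjoin.gen) (auto simp: S_def)
        qed
      next
        case 2
        then have "w \<noteq> u" using True M by auto
        then have "s = inverse (?z w)" using 2 y[of w] MG zv[of w] by auto
        then show ?thesis using 2 M by (intro adjoin.gen) (auto simp: S_def)
      qed
    qed
    then have "f \<in> adjoin K S" using f1 unfolding laurent_ring_def by (rule adjoin_subset)
    then show ?thesis by (simp add: laurent_ring_def S_def)
  qed
  then show "f \<in> upper_bound K \<Delta> x"
    using mirrors_laurent_subset[OF q m f1] by (simp add: upper_bound_def)
qed

lemma upper_cluster_algebra_sum:
  assumes K: "is_subfield K" and f: "\<And>i. i \<in> I \<Longrightarrow> f i \<in> upper_cluster_algebra K \<Delta> x"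
  shows "sum f I \<in> upper_cluster_algebra K \<Delta> x"
proof -
  have "sum f I \<in> adjoin K S" if "\<And>i. i \<in> I \<Longrightarrow> f i \<in> adjoin K S" for S
    using that by (induction I rule: infinite_finite_induct) (auto intro: adjoin.intros is_subfieldD(1)[OF K])
  then show ?thesis using f unfolding upper_cluster_algebra_def laurent_ring_def by blast
qed

lemma sum_same_sign_eq_0:
  fixes h t :: "'v \<Rightarrow> int"
  assumes "finite A" "(\<forall>v\<in>A. t v < 0) \<or> (\<forall>v\<in>A. 0 < t v)" "\<forall>v\<in>A. 0 \<le> h v"
  shows "(\<Sum>v\<in>A. h v * t v) = 0 \<longleftrightarrow> (\<forall>v\<in>A. h v = 0)"
  using assms(2)
proof
  assume *: "\<forall>v\<in>A. t v < 0"
  have "(\<Sum>v\<in>A. - (h v * t v)) = 0 \<longleftrightarrow> (\<forall>v\<in>A. - (h v * t v) = 0)"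
    using assms * by (intro sum_nonneg_eq_0_iff) (auto simp: mult_nonneg_nonpos less_imp_le)
  then have "(\<Sum>v\<in>A. h v * t v) = 0 \<longleftrightarrow> (\<forall>v\<in>A. h v * t v = 0)" by (simp add: sum_negf)
  moreover have "t v \<noteq> 0" if "v \<in> A" for v using * that by force
  ultimately show ?thesis by simp
next
  assume *: "\<forall>v\<in>A. 0 < t v"
  have "(\<Sum>v\<in>A. h v * t v) = 0 \<longleftrightarrow> (\<forall>v\<in>A. h v * t v = 0)"
    using assms * by (intro sum_nonneg_eq_0_iff) (auto simp: less_imp_le)
  moreover have "t v \<noteq> 0" if "v \<in> A" for v using * that by force
  ultimately show ?thesis by simp
qed

lemma mirrors_delete_freeze:
  assumes gs: "graded_seed K \<Delta> x \<sigma>" and vs: "vs \<subseteq> frozens \<Delta>"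
    and F: "Modules.additive F" "\<forall>v\<in>verts \<Delta> - vs. F (\<sigma> v) = (0::int)"
    and sgn: "(\<forall>v\<in>vs. F (\<sigma> v) < 0) \<or> (\<forall>v\<in>vs. F (\<sigma> v) > 0)"
  shows "mirrors vs (attached \<Delta> vs) (delete_freeze \<Delta> vs (attached \<Delta> vs)) (restrict x (verts \<Delta> - vs)) \<Delta> x"
proof -
  let ?G = "delete_freeze \<Delta> vs (attached \<Delta> vs)"
  have q: "is_ice_quiver \<Delta>" and wc: "weight_configuration \<Delta> \<sigma>" using gs by (auto simp: graded_seed_def is_seed_def)
  have qG: "is_ice_quiver ?G" using graded_seed_delete_freeze[OF gs vs] by (simp add: graded_seed_def is_seed_def)
  have fin: "finite (verts \<Delta>)" using is_ice_quiverD[OF q] by simp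
  have vsV: "vs \<subseteq> verts \<Delta>" using subset_trans[OF vs frozens_subset] .
  have vsm: "vs \<inter> mutables \<Delta> = {}" using vs by (auto simp: frozens_def)
  have wF: "F (weight (verts \<Delta>) \<sigma> h) = (\<Sum>v\<in>vs. h v * F (\<sigma> v))" for h
    unfolding additive_weight[OF F(1)] using fin vsV F(2) by (intro sum.mono_neutral_right) auto
  have fvs: "finite vs" using finite_subset[OF vsV fin] .
  have zero_iff: "(\<Sum>v\<in>vs. int (h v) * F (\<sigma> v)) = 0 \<longleftrightarrow> (\<forall>v\<in>vs. h v = 0)" for h
    using sum_same_sign_eq_0[OF fvs sgn, of "\<lambda>v. int (h v)"] by simp
  have both: "(\<exists>v\<in>vs. 0 < arr \<Delta> v u) \<and> (\<exists>v\<in>vs. 0 < arr \<Delta> u v)" if u: "u \<in> attached \<Delta> vs" for u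
  proof -
    have "weight (verts \<Delta>) \<sigma> (in_arrows \<Delta> u) = weight (verts \<Delta>) \<sigma> (out_arrows \<Delta> u)"
      using wc u by (auto simp: weight_configuration_def weight_def in_arrows_def out_arrows_def attached_def)
    \<comment> \<open>Under \<open>F\<close> only the contributions of \<open>vs\<close> survive,
      all of one sign, so one term of the exchange relation is free of \<open>vs\<close> exactly if
      the other is.\<close>
    then have "(\<Sum>v\<in>vs. int (arr \<Delta> v u) * F (\<sigma> v)) = (\<Sum>v\<in>vs. int (arr \<Delta> u v) * F (\<sigma> v))"
      using wF[of "in_arrows \<Delta> u"] wF[of "out_arrows \<Delta> u"] by (simp add: in_arrows_def out_arrows_def)
    then have "(\<forall>v\<in>vs. arr \<Delta> v u = 0) \<longleftrightarrow> (\<forall>v\<in>vs. arr \<Delta> u v = 0)"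
      using zero_iff[of "\<lambda>v. arr \<Delta> v u"] zero_iff[of "\<lambda>v. arr \<Delta> u v"] by simp
    then show ?thesis using u by (auto simp: attached_def)
  qed
  show ?thesis
    unfolding mirrors_def using qG vs both vsm
    by (auto simp: delete_freeze_def attached_def)
qed

text \<open>The second conjunct makes the equality one of graded algebras: the weights are read off
  in the Laurent ring of \<open>x\<close> on the left and in that of the restricted cluster on the
  right.\<close>

theorem proposition2p13:
  fixes K :: "'f::field set"
    and \<Delta> :: "'v ice_quiver"
    and x :: "'v \<Rightarrow> 'f"
    and \<sigma> :: "'v \<Rightarrow> 'l::ab_group_add"
    and form :: "'l \<Rightarrow> 'l \<Rightarrow> int"
    and \<theta> :: 'l
    and vs :: "'v set"
  assumes "is_subfield K"
    and "is_lattice TYPE('l)"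
    and "is_unimodular_form form"
    and "graded_seed K \<Delta> x \<sigma>"
    and "full_rank \<Delta>"
    and "vs \<subseteq> frozens \<Delta>"
    and "\<forall>v\<in>verts \<Delta> - vs. form \<theta> (\<sigma> v) = 0"
    and "(\<forall>v\<in>vs. form \<theta> (\<sigma> v) < 0) \<or> (\<forall>v\<in>vs. form \<theta> (\<sigma> v) > 0)"
  shows "perp_subalgebra K \<Delta> x \<sigma> form \<theta> =
      upper_cluster_algebra K (delete_freeze \<Delta> vs (attached \<Delta> vs)) (restrict x (verts \<Delta> - vs)) \<and>
    (\<forall>\<alpha>. perp_subalgebra K \<Delta> x \<sigma> form \<theta> \<inter> upper_cluster_component K \<Delta> x \<sigma> \<alpha> =
      upper_cluster_component K (delete_freeze \<Delta> vs (attached \<Delta> vs))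
        (restrict x (verts \<Delta> - vs)) (restrict \<sigma> (verts \<Delta> - vs)) \<alpha>)"
proof -
  let ?V = "verts \<Delta>" and ?G = "delete_freeze \<Delta> vs (attached \<Delta> vs)"
  let ?y = "restrict x (?V - vs)" and ?\<tau> = "restrict \<sigma> (?V - vs)"
  let ?A = "upper_cluster_algebra K \<Delta> x" and ?S = "upper_cluster_algebra K ?G ?y"
  let ?w = "weight ?V \<sigma>"
  note K = assms(1) and gs = assms(4) and vs = assms(6)
  have F: "Modules.additive (form \<theta>)" using assms(3) by (simp add: is_unimodular_form_def)
  have q: "is_ice_quiver \<Delta>" and ai: "alg_independent K ?V x" and wc: "weight_configuration \<Delta> \<sigma>"
    using gs by (auto simp: graded_seed_def is_seed_def)
  interpret laurent K ?V by (rule laurent_verts[OF K q])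
  have ind: "lindep K ?V x" by (rule lindep_of_alg_independent[OF K V ai])
  have g: "good_seed K \<Delta> x" using q ind rows_indep_of_full_rank[OF q assms(5)] by (simp add: good_seed_def)
  have mir: "mirrors vs (attached \<Delta> vs) ?G ?y \<Delta> x"
    by (rule mirrors_delete_freeze[OF gs vs F assms(7,8)])
  have hw: "homogeneous_weight \<Delta> ?w"
    using wc weight_add[of ?V \<sigma>]
    by (simp add: homogeneous_weight_def weight_configuration_def weight_def in_arrows_def out_arrows_def)
  have vsV: "vs \<subseteq> ?V" using subset_trans[OF vs frozens_subset] .
  have fvs: "finite vs" using finite_subset[OF vsV V] .
  have wF: "form \<theta> (?w h) = (\<Sum>v\<in>vs. h v * form \<theta> (\<sigma> v))" for h
    unfolding additive_weight[OF F] using V vsV assms(7) by (intro sum.mono_neutral_right) auto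
  \<comment> \<open>The \<open>\<theta>\<close>-degree is a sum over \<open>vs\<close> whose terms
    do not differ in sign, frozen exponents being nonnegative.\<close>
  have supp: "h v = 0" if h: "\<forall>p\<in>frozens \<Delta>. 0 \<le> h p" "form \<theta> (?w h) = 0" and v: "v \<in> vs" for h v
  proof -
    have nn: "0 \<le> h v" if "v \<in> vs" for v using h(1) vs that by auto
    have "(\<Sum>v\<in>vs. h v * form \<theta> (\<sigma> v)) = 0" using h(2) wF by simp
    then show ?thesis using sum_same_sign_eq_0[OF fvs assms(8), of h] nn v by blast
  qed
  let ?N = "{m :: 'v \<Rightarrow> int. \<forall>p\<in>frozens ?G. 0 \<le> m p} \<inter> {m. \<forall>v\<in>vs. m v = 0}"
  let ?F = "{m :: 'v \<Rightarrow> int. \<forall>p\<in>frozens \<Delta>. 0 \<le> m p}"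
  have FG: "frozens \<Delta> \<subseteq> frozens ?G \<union> vs" by (auto simp: frozens_def delete_freeze_def)
  have S0F: "?N \<subseteq> ?F"
  proof (intro subsetI CollectI ballI)
    fix m p assume m: "m \<in> ?N" and "p \<in> frozens \<Delta>"
    then have "p \<in> frozens ?G \<or> p \<in> vs" using FG by blast
    then show "0 \<le> m p" using m by auto
  qed
  have S_laurent: "f \<in> T x ?N" if "f \<in> ?S" for f
    using that mutation_equivalent.refl[of ?G ?y] mirrors_laurent_eq[OF K g mir] unfolding upper_cluster_algebra_def by blast
  have SA: "f \<in> ?A" if "f \<in> ?S" for f using restricted_algebra_subset[OF K g mir that] .
  have comp: "laurent_component K \<Delta> x \<sigma> \<alpha> = T x (?F \<inter> {m. ?w m = \<alpha>})" for \<alpha>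
    by (rule laurent_component_eq_lspan[OF K q])
  have qG: "is_ice_quiver ?G" using mir by (simp add: mirrors_def)
  have compG: "laurent_component K ?G ?y ?\<tau> \<alpha> = T x (?N \<inter> {m. ?w m = \<alpha>})" for \<alpha>
  proof -
    have VG: "verts ?G = ?V - vs" by (simp add: delete_freeze_def)
    have wt: "weight (?V - vs) ?\<tau> m = ?w m" if "\<forall>v\<in>vs. m v = 0" for m
      unfolding weight_def using V that by (intro sum.mono_neutral_cong_left) (auto simp: int_mult_zero)
    have "lspan K (?V - vs) ?y S = lspan K (?V - vs) x S" for S
      using lspan_cong[of _ K "?V - vs" ?y S x] lspan_cong[of _ K "?V - vs" x S ?y] by (metis restrict_apply subsetI subset_antisym)
    then have "laurent_component K ?G ?y ?\<tau> \<alpha> =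
        T x ({m. \<forall>p\<in>frozens ?G. 0 \<le> m p} \<inter> {m. weight (?V - vs) ?\<tau> m = \<alpha>} \<inter> {m. \<forall>v\<in>vs. m v = 0})"
      unfolding laurent_component_eq_lspan[OF K qG] VG lspan_restrict[OF V, symmetric] by simp
    also have "{m. \<forall>p\<in>frozens ?G. 0 \<le> m p} \<inter> {m. weight (?V - vs) ?\<tau> m = \<alpha>} \<inter> {m. \<forall>v\<in>vs. m v = 0} =
        ?N \<inter> {m. ?w m = \<alpha>}"
      using wt by auto
    finally show ?thesis .
  qed
  have perp: "perp_subalgebra K \<Delta> x \<sigma> form \<theta> = ?S"
  proof (intro subset_antisym subsetI)
    fix f assume "f \<in> perp_subalgebra K \<Delta> x \<sigma> form \<theta>"
    then obtain D a where D: "finite D" "f = (\<Sum>\<alpha>\<in>D. a \<alpha>)"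
      "\<forall>\<alpha>\<in>D. form \<theta> \<alpha> = 0 \<and> a \<alpha> \<in> upper_cluster_component K \<Delta> x \<sigma> \<alpha>"
      unfolding perp_subalgebra_def by blast
    have "a \<alpha> \<in> ?S" if "\<alpha> \<in> D" for \<alpha>
    proof (rule upper_cluster_algebra_restrict[OF K g mir])
      have "a \<alpha> \<in> T x (?F \<inter> {m. ?w m = \<alpha>})" "a \<alpha> \<in> ?A" "form \<theta> \<alpha> = 0"
        using D(3) that comp by (auto simp: upper_cluster_component_def)
      then show "a \<alpha> \<in> ?A" "a \<alpha> \<in> T x {m. \<forall>v\<in>vs. m v = 0}"
        using supp by (auto elim!: lspan_mono)
    qed
    then show "f \<in> ?S" unfolding D(2) by (rule upper_cluster_algebra_sum[OF K])
  next
    fix f assume f: "f \<in> ?S"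
    \<comment> \<open>Decomposing over exponents that vanish on \<open>vs\<close> makes every
      occurring weight orthogonal to \<open>\<theta>\<close>.\<close>
    obtain D a where D: "finite D" "D \<subseteq> ?w ` ?N" "f = (\<Sum>\<alpha>\<in>D. a \<alpha>)" "\<forall>\<alpha>. a \<alpha> \<in> T x (?N \<inter> {m. ?w m = \<alpha>})"
      using lspan_decompose[OF S_laurent[OF f], of ?w] by blast
    have aF: "a \<alpha> \<in> T x (?F \<inter> {m. ?w m = \<alpha>})" for \<alpha>
      by (rule lspan_mono[OF D(4)[rule_format]]) (use S0F in blast)
    have "form \<theta> \<alpha> = 0 \<and> a \<alpha> \<in> upper_cluster_component K \<Delta> x \<sigma> \<alpha>" if "\<alpha> \<in> D" for \<alpha>
    proof
      show "form \<theta> \<alpha> = 0" using D(2) that wF by auto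
      have "a \<alpha> \<in> ?A"
        by (rule component_in_upper_cluster_algebra[OF K g hw D(1) _ aF that]) (use SA[OF f] D(3) in simp)
      then show "a \<alpha> \<in> upper_cluster_component K \<Delta> x \<sigma> \<alpha>"
        using aF comp by (simp add: upper_cluster_component_def)
    qed
    then show "f \<in> perp_subalgebra K \<Delta> x \<sigma> form \<theta>"
      unfolding perp_subalgebra_def using D(1,3) by blast
  qed
  have "?S \<inter> upper_cluster_component K \<Delta> x \<sigma> \<alpha> = upper_cluster_component K ?G ?y ?\<tau> \<alpha>" for \<alpha>
  proof (intro subset_antisym subsetI)
    fix f assume "f \<in> ?S \<inter> upper_cluster_component K \<Delta> x \<sigma> \<alpha>"
    then have f: "f \<in> ?S" "f \<in> T x (?F \<inter> {m. ?w m = \<alpha>})" by (auto simp: upper_cluster_component_def comp)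
    \<comment> \<open>The weight is known in the larger ring and the vanishing on \<open>vs\<close>
      in the smaller one; uniqueness of supports combines them.\<close>
    have "f \<in> T x (?N \<inter> {m. ?w m = \<alpha>})"
      using lspan_Int[OF ind S_laurent[OF f(1)] f(2)] by (rule lspan_mono) auto
    then show "f \<in> upper_cluster_component K ?G ?y ?\<tau> \<alpha>"
      using f(1) by (simp add: upper_cluster_component_def compG)
  next
    fix f assume "f \<in> upper_cluster_component K ?G ?y ?\<tau> \<alpha>"
    then have f: "f \<in> ?S" "f \<in> T x (?N \<inter> {m. ?w m = \<alpha>})" by (auto simp: upper_cluster_component_def compG)
    have "f \<in> T x (?F \<inter> {m. ?w m = \<alpha>})"
      using f(2) by (rule lspan_mono) (use S0F in blast)
    then show "f \<in> ?S \<inter> upper_cluster_component K \<Delta> x \<sigma> \<alpha>"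
      using f(1) SA by (simp add: upper_cluster_component_def comp)
  qed
  then show ?thesis unfolding perp by blast
qed

end
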